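(* Let $G$ be a critically apex graph. Then $G$ is $\mathcal{R}_3$-independent if and only if $G$ is $(3,6)$-sparse.
   Context: All graphs are finite and simple. $G=(V,E)$ is critically apex if $G-v$ is planar for every $v\in V$. For $p:V\to\mathbb{R}^3$, the rigidity matrix $R(G,p)$ is the $|E|\times 3|V|$ matrix whose row for edge $uw$ has $p(u)-p(w)$ in the columns of $u$, $p(w)-p(u)$ in the columns of $w$, zeros elsewhere; $G$ is $\mathcal{R}_3$-independent if these rows are linearly independent for generic $p$ (coordinates algebraically independent over $\mathbb{Q}$). $G$ is $(3,6)$-sparse if every $X\subseteq V$ with $|X|\ge3$ induces at most $3|X|-6$ edges. *)

theory Defs
  imports "HOL-Analysis.Analysis"
begin

definition simple_graph :: "'a set \<Rightarrow> 'a set set \<Rightarrow> bool" where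
  "simple_graph V E \<longleftrightarrow> finite V \<and> (\<forall>e\<in>E. e \<subseteq> V \<and> card e = 2)"

definition planar :: "'a set \<Rightarrow> 'a set set \<Rightarrow> bool" where
  "planar V E \<longleftrightarrow>
     (\<exists>(pos :: 'a \<Rightarrow> complex) (\<gamma> :: 'a set \<Rightarrow> real \<Rightarrow> complex).
        inj_on pos V \<and>
        (\<forall>e\<in>E. arc (\<gamma> e) \<and> {pathstart (\<gamma> e), pathfinish (\<gamma> e)} = pos ` e) \<and>
        (\<forall>e\<in>E. \<forall>v\<in>V. pos v \<in> path_image (\<gamma> e) \<longrightarrow> v \<in> e) \<and>
        (\<forall>e\<in>E. \<forall>e'\<in>E. e \<noteq> e' \<longrightarrow>
              path_image (\<gamma> e) \<inter> path_image (\<gamma> e') \<subseteq> pos ` (e \<inter> e')))"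

definition del_vertex_edges :: "'a set set \<Rightarrow> 'a \<Rightarrow> 'a set set" where
  "del_vertex_edges E v = {e\<in>E. v \<notin> e}"

definition critically_apex :: "'a set \<Rightarrow> 'a set set \<Rightarrow> bool" where
  "critically_apex V E \<longleftrightarrow> (\<forall>v\<in>V. planar (V - {v}) (del_vertex_edges E v))"

definition sparse36 :: "'a set \<Rightarrow> 'a set set \<Rightarrow> bool" where
  "sparse36 V E \<longleftrightarrow>
     (\<forall>X\<subseteq>V. card X \<ge> 3 \<longrightarrow> card {e\<in>E. e \<subseteq> X} \<le> 3 * card X - 6)"

text \<open>Algebraic independence over \<open>\<rat>\<close> of a finite family of reals \<open>x i\<close>, \<open>i \<in> I\<close>:
  no nonzero rational polynomial in the variables indexed by I vanishes at x.
  A polynomial is a finitely supported map from exponent vectors to rationals.\<close>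
definition alg_indep_over_Q :: "'i set \<Rightarrow> ('i \<Rightarrow> real) \<Rightarrow> bool" where
  "alg_indep_over_Q I x \<longleftrightarrow>
     (\<forall>c :: ('i \<Rightarrow> nat) \<Rightarrow> rat.
        finite {\<alpha>. c \<alpha> \<noteq> 0} \<and>
        (\<forall>\<alpha>. c \<alpha> \<noteq> 0 \<longrightarrow> (\<forall>i. i \<notin> I \<longrightarrow> \<alpha> i = 0)) \<and>
        (\<Sum>\<alpha>\<in>{\<alpha>. c \<alpha> \<noteq> 0}. of_rat (c \<alpha>) * (\<Prod>i\<in>I. x i ^ \<alpha> i)) = 0
        \<longrightarrow> (\<forall>\<alpha>. c \<alpha> = 0))"

definition generic :: "'a set \<Rightarrow> ('a \<Rightarrow> real^3) \<Rightarrow> bool" where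
  "generic V p \<longleftrightarrow> alg_indep_over_Q (V \<times> (UNIV :: 3 set)) (\<lambda>(v, k). p v $ k)"

definition rigidity_row :: "('a \<Rightarrow> real^3) \<Rightarrow> 'a set \<Rightarrow> 'a \<times> 3 \<Rightarrow> real" where
  "rigidity_row p e = (\<lambda>(v, k). if v \<in> e then (p v - p (THE w. w \<in> e \<and> w \<noteq> v)) $ k else 0)"

definition rows_independent :: "'a set set \<Rightarrow> ('a \<Rightarrow> real^3) \<Rightarrow> bool" where
  "rows_independent E p \<longleftrightarrow>
     (\<forall>lam :: 'a set \<Rightarrow> real.
        (\<forall>c. (\<Sum>e\<in>E. lam e * rigidity_row p e c) = 0) \<longrightarrow> (\<forall>e\<in>E. lam e = 0))"

definition R3_independent :: "'a set \<Rightarrow> 'a set set \<Rightarrow> bool" where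
  "R3_independent V E \<longleftrightarrow> (\<forall>p. generic V p \<longrightarrow> rows_independent E p)"

end

theory Submission
  imports Defs
begin

text \<open>A stress-free generic framework on a contraction \<open>G/uv\<close> yields one on \<open>G\<close> when \<open>uv\<close> lies in at most two
  triangles (vertex splitting), so one looks for an edge whose contraction is again sparse. Planarity enters
  only through an edge bound: a planar graph has no \<open>K\<^sub>5\<close> minor, hence all minors of the graphs
  \<open>G - v\<close> have at most \<open>3n - 6\<close> edges, and all minors of \<open>G\<close> have at most \<open>3n - 5\<close> (\<open>n \<ge> 3\<close> being the number of vertices of the minor). Vertices of degree at
  most 4 are removed by 0- and 1-extensions. If no contraction of an edge in at most two triangles is sparse,
  the two edge bounds force a complete bipartite graph \<open>K\<^sub>4\<^sub>,\<^sub>7\<close> in \<open>G\<close>, which is not sparse.\<close>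

section \<open>Crossing chords of a Jordan curve\<close>

text \<open>The obstacle is that contraction need not preserve (3,6)-sparsity. Two observations
  control the damage. A proper vertex subset lies inside some planar G - y, so in a critically apex
  graph only the total number of edges can violate sparsity. And contracting an edge in t triangles
  removes t + 1 edges while the bound 3n - 6 drops by 3, whereas the cap 3n - 5 permits an excess of
  a single edge; so a failure with t \<le> 2 determines the number of edges of the contraction
  exactly, and with it t. Contracting two edges in succession exploits this equality. Planarity is
  given by arcs in the plane, so the obstruction K_5 has to come from Jordan curves; it is applied
  to minors, so drawings must survive contraction, which plain points and arcs do not offer
  directly. On the rigidity side, independence at one placement is witnessed by a non-vanishing
  polynomial in the coordinates. Hence a single placement, however special, settles all generic
  ones, and new vertices may be put at convenient positions.\<close>

lemma Jordan_two_components: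
  fixes c :: "real \<Rightarrow> complex"
  assumes "simple_path c" "pathfinish c = pathstart c"
    and "x \<notin> path_image c" "y \<notin> path_image c" "z \<notin> path_image c"
    and "\<not> connected_component (- path_image c) x y" "\<not> connected_component (- path_image c) x z"
  shows "connected_component (- path_image c) y z"
proof -
  let ?I = "inside (path_image c)" and ?O = "outside (path_image c)"
  note J = Jordan_inside_outside[OF assms(1,2)]
  have IO: "?I \<union> ?O = - path_image c" using J by blast
  have same: "connected_component (- path_image c) p q"
    if "p \<in> ?I \<and> q \<in> ?I \<or> p \<in> ?O \<and> q \<in> ?O" for p q
  proof -
    have "\<exists>S. connected S \<and> S \<subseteq> - path_image c \<and> p \<in> S \<and> q \<in> S"
    proof (cases "p \<in> ?I \<and> q \<in> ?I")
      case True then show ?thesis using J IO by (intro exI[of _ ?I]) blast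
    next
      case False then show ?thesis using J IO that by (intro exI[of _ ?O]) blast
    qed
    then show ?thesis by (auto simp: connected_component_def)
  qed
  show ?thesis using same[of x y] same[of x z] same[of y z] assms(3-) IO by blast
qed

text \<open>Inside or outside, whichever misses \<open>x\<close>. That the curve lies in
  \<open>closure U\<close> is what the theta argument lives on: adding any point of the curve to
  \<open>U\<close> keeps it connected.\<close>

lemma Jordan_other_component:
  fixes c :: "real \<Rightarrow> complex"
  assumes "simple_path c" "pathfinish c = pathstart c" and "x \<notin> path_image c"
  obtains U y where "open U" "connected U" "U \<inter> path_image c = {}" "path_image c \<subseteq> closure U" "y \<in> U"
    "\<And>w. w \<in> U \<Longrightarrow> \<not> connected_component (- path_image c) x w"
proof -
  let ?I = "inside (path_image c)" and ?O = "outside (path_image c)"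
  note J = Jordan_inside_outside[OF assms(1,2)]
  have IO: "?I \<union> ?O = - path_image c" "?I \<inter> ?O = {}" using J by blast+
  have fr: "path_image c \<subseteq> closure ?I" "path_image c \<subseteq> closure ?O"
    using J by (auto simp: frontier_def)
  have sep: "\<not> connected_component (- path_image c) p q" if "p \<in> ?I" "q \<in> ?O" for p q
  proof
    assume "connected_component (- path_image c) p q"
    then obtain S where S: "connected S" "S \<subseteq> ?I \<union> ?O" "p \<in> S" "q \<in> S"
      using IO by (auto simp: connected_component_def)
    have "open ?I" "open ?O" using J by auto
    then have "?I \<inter> S = {} \<or> ?O \<inter> S = {}"
      using connectedD[OF S(1), of ?I ?O] S(2) IO(2) by blast
    then show False using S that by blast
  qed
  have x: "x \<in> ?I \<or> x \<in> ?O" using IO(1) assms(3) by blast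
  show ?thesis
  proof (cases "x \<in> ?I")
    case True
    obtain y where "y \<in> ?O" using J by blast
    then show ?thesis using that[of ?O y] sep[OF True] J fr IO by auto
  next
    case False
    then have "x \<in> ?O" using x by blast
    moreover obtain y where "y \<in> ?I" using J by blast
    ultimately show ?thesis
      using that[of ?I y] sep connected_component_sym[of "- path_image c"] J fr IO by auto
  qed
qed

text \<open>Each face of a theta graph borders only two of its arcs, whose cycle cuts it off from
  the third. If all three separations failed, take \<open>p\<close> on the side \<open>U\<close> of
  the cycle \<open>c1\<close>, \<open>c2\<close> opposite to \<open>x\<close>. \<open>U\<close>
  misses \<open>c3\<close>, so it can be extended to \<open>z2\<close> and to \<open>z1\<close>;
  hence \<open>p\<close> reaches \<open>x\<close> both off \<open>c1\<close> and \<open>c3\<close>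
  and off \<open>c2\<close> and \<open>c3\<close>. These two unions meet in the connected set
  \<open>c3\<close>, so Janiszewski's theorem joins \<open>p\<close> to \<open>x\<close> off all
  three arcs, against the choice of \<open>U\<close>.\<close>

lemma theta_separation:
  fixes c1 c2 c3 :: "real \<Rightarrow> complex"
  assumes arcs: "arc c1" "arc c2" "arc c3"
    and ends: "pathstart c1 = a" "pathfinish c1 = b" "pathstart c2 = a" "pathfinish c2 = b"
      "pathstart c3 = a" "pathfinish c3 = b"
    and int: "path_image c1 \<inter> path_image c2 = {a,b}" "path_image c1 \<inter> path_image c3 = {a,b}"
      "path_image c2 \<inter> path_image c3 = {a,b}"
    and x: "x \<notin> path_image c1 \<union> path_image c2 \<union> path_image c3"
    and z: "z1 \<in> path_image c1 - {a,b}" "z2 \<in> path_image c2 - {a,b}" "z3 \<in> path_image c3 - {a,b}"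
  shows "\<not> connected_component (- (path_image c1 \<union> path_image c2)) x z3 \<or>
         \<not> connected_component (- (path_image c1 \<union> path_image c3)) x z2 \<or>
         \<not> connected_component (- (path_image c2 \<union> path_image c3)) x z1"
proof (rule ccontr)
  assume "\<not> ?thesis"
  then have cx: "connected_component (- (path_image c1 \<union> path_image c2)) x z3"
    "connected_component (- (path_image c1 \<union> path_image c3)) x z2"
    "connected_component (- (path_image c2 \<union> path_image c3)) x z1" by auto
  let ?c = "c1 +++ reversepath c2"
  have pc: "path_image ?c = path_image c1 \<union> path_image c2"
    using ends by (simp add: path_image_join)
  have sc: "simple_path ?c"
    by (rule simple_path_join_loop) (use arcs ends int in \<open>auto simp: arc_reversepath\<close>)
  have "pathfinish ?c = pathstart ?c" using ends by simp
  then obtain U p where U: "open U" "connected U" "U \<inter> (path_image c1 \<union> path_image c2) = {}"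
    "path_image c1 \<union> path_image c2 \<subseteq> closure U" "p \<in> U"
    and nU: "\<And>w. w \<in> U \<Longrightarrow> \<not> connected_component (- (path_image c1 \<union> path_image c2)) x w"
    using Jordan_other_component[OF sc, of x] x unfolding pc by (metis UnCI)
  have "connected (path_image c3 - {a,b})"
    using connected_simple_path_endless[OF arc_imp_simple_path[OF arcs(3)]] ends by simp
  then have cc3: "connected_component (- (path_image c1 \<union> path_image c2)) z3 w" if "w \<in> path_image c3 - {a,b}" for w
    using that z int unfolding connected_component_def
    by (intro exI[of _ "path_image c3 - {a,b}"]) auto
  have U3: "U \<inter> path_image c3 = {}"
  proof (rule ccontr)
    assume "U \<inter> path_image c3 \<noteq> {}"
    then obtain w where w: "w \<in> U" "w \<in> path_image c3" by auto
    have "w \<notin> {a,b}" using w U(3) int(1) by auto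
    then have "connected_component (- (path_image c1 \<union> path_image c2)) x w"
      using connected_component_trans[OF cx(1) cc3] w by auto
    then show False using nU w by auto
  qed
  have nz: "z2 \<notin> path_image c1" "z2 \<notin> path_image c3" "z1 \<notin> path_image c2" "z1 \<notin> path_image c3"
    using z(1,2) int by blast+
  have ext: "connected_component (- S) p z" if "z \<in> path_image c1 \<union> path_image c2" "z \<notin> S" "U \<inter> S = {}" for z S
  proof -
    have "connected (insert z U)"
      by (rule connected_intermediate_closure[OF U(2)]) (use U(4) that closure_subset in auto)
    then show ?thesis using that U(5) by (auto simp: connected_component_def intro!: exI[of _ "insert z U"])
  qed
  have "connected_component (- (path_image c1 \<union> path_image c3)) p z2"
    "connected_component (- (path_image c2 \<union> path_image c3)) p z1"
    using nz z(1,2) U(3) U3 by (intro ext; auto)+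
  then have px: "connected_component (- (path_image c1 \<union> path_image c3)) p x"
    "connected_component (- (path_image c2 \<union> path_image c3)) p x"
    using cx connected_component_sym connected_component_trans by metis+
  have eq: "(path_image c1 \<union> path_image c3) \<inter> (path_image c2 \<union> path_image c3) = path_image c3"
    using int by blast
  have "connected_component (- ((path_image c1 \<union> path_image c3) \<union> (path_image c2 \<union> path_image c3))) p x"
    by (rule Janiszewski[OF _ _ _ px])
      (use arcs in \<open>auto simp: eq compact_Un compact_arc_image closed_arc_image connected_arc_image\<close>)
  then have "connected_component (- (path_image c1 \<union> path_image c2)) p x"
    by (rule connected_component_of_subset) auto
  then show False using nU[OF U(5)] connected_component_sym by blast
qed

lemma connected_arc_minus_start:
  assumes "arc g" shows "connected (path_image g - {pathstart g})"
proof -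
  have "path_image g - {pathstart g} = g ` {0<..1}"
  proof -
    have "{0..1::real} = insert 0 {0<..1}" by auto
    moreover have "g 0 \<notin> g ` {0<..1}" using assms by (fastforce simp: arc_def inj_on_def)
    ultimately show ?thesis by (auto simp: path_image_def pathstart_def)
  qed
  moreover have "continuous_on {0<..1} g"
    using arc_imp_path[OF assms] unfolding path_def by (rule continuous_on_subset) auto
  ultimately show ?thesis by (simp add: connected_continuous_image)
qed

lemma connected_arc_minus_finish:
  assumes "arc g" shows "connected (path_image g - {pathfinish g})"
  using connected_arc_minus_start[of "reversepath g"] assms by (simp add: arc_reversepath)

text \<open>This is \<open>theta_separation\<close> for \<open>J1\<close>, \<open>J2\<close>,
  \<open>D\<close> and the point \<open>z\<close>, with the ends of \<open>B\<close> as test points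
  on \<open>J1\<close> and \<open>J2\<close>. \<open>B\<close> without one end leads from
  \<open>z\<close> to the other end and avoids \<open>D\<close> and the arc carrying the removed
  end, which rules out two alternatives; the third is the claim.\<close>

lemma crossing_chords_separated:
  fixes J1 J2 D B :: "real \<Rightarrow> complex"
  assumes arcs: "arc J1" "arc J2" "arc D" "arc B"
    and ends: "pathstart J1 = a" "pathfinish J1 = b" "pathstart J2 = a" "pathfinish J2 = b"
      "pathstart D = a" "pathfinish D = b"
    and int: "path_image J1 \<inter> path_image J2 = {a,b}"
    and D: "path_image D \<inter> (path_image J1 \<union> path_image J2) = {a,b}"
    and B: "path_image B \<inter> (path_image J1 \<union> path_image J2) = {pathstart B, pathfinish B}"
    and s: "pathstart B \<in> path_image J1 - {a,b}" "pathfinish B \<in> path_image J2 - {a,b}"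
    and DB: "path_image D \<inter> path_image B = {}"
    and z: "z \<in> path_image B - {pathstart B, pathfinish B}" and w: "w \<in> path_image D - {a,b}"
  shows "\<not> connected_component (- (path_image J1 \<union> path_image J2)) z w"
proof -
  have n: "z \<notin> path_image J1" "z \<notin> path_image J2" "z \<notin> path_image D"
    "pathstart B \<notin> path_image J2" "pathfinish B \<notin> path_image J1"
    using z s B DB int by blast+
  have D12: "path_image J1 \<inter> path_image D = {a,b}" "path_image J2 \<inter> path_image D = {a,b}"
    using D int by blast+
  have "\<not> connected_component (- (path_image J1 \<union> path_image J2)) z w \<or>
     \<not> connected_component (- (path_image J1 \<union> path_image D)) z (pathfinish B) \<or>
     \<not> connected_component (- (path_image J2 \<union> path_image D)) z (pathstart B)"
    by (rule theta_separation[OF arcs(1-3) ends int D12]) (use n s w in auto)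
  moreover have "connected_component (- (path_image J1 \<union> path_image D)) z (pathfinish B)"
    unfolding connected_component_def
  proof (intro exI[of _ "path_image B - {pathstart B}"] conjI)
    have "path_image B \<inter> path_image J1 \<subseteq> {pathstart B}" using equalityD1[OF B] n by blast
    then show "path_image B - {pathstart B} \<subseteq> - (path_image J1 \<union> path_image D)"
      using DB by blast
  qed (use connected_arc_minus_start[OF arcs(4)] arc_distinct_ends[OF arcs(4)] z in auto)
  moreover have "connected_component (- (path_image J2 \<union> path_image D)) z (pathstart B)"
    unfolding connected_component_def
  proof (intro exI[of _ "path_image B - {pathfinish B}"] conjI)
    have "path_image B \<inter> path_image J2 \<subseteq> {pathfinish B}" using equalityD1[OF B] n by blast
    then show "path_image B - {pathfinish B} \<subseteq> - (path_image J2 \<union> path_image D)"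
      using DB by blast
  qed (use connected_arc_minus_finish[OF arcs(4)] arc_distinct_ends[OF arcs(4)] z in auto)
  ultimately show ?thesis by blast
qed

text \<open>Cut an arc of \<open>X\<close> at its first visit to \<open>K2\<close>, then at the last
  visit to \<open>K1\<close> before that. Closedness of both sets makes these times exist, and
  strictly between them neither set is visited.\<close>

lemma arc_between_sets:
  fixes K1 K2 X :: "'a::{complete_space,real_normed_vector} set"
  assumes X: "path_connected X" and K: "closed K1" "closed K2" "K1 \<inter> K2 = {}"
    and ne: "X \<inter> K1 \<noteq> {}" "X \<inter> K2 \<noteq> {}"
  obtains g where "arc g" "path_image g \<subseteq> X" "pathstart g \<in> K1" "pathfinish g \<in> K2"
    "path_image g \<inter> (K1 \<union> K2) = {pathstart g, pathfinish g}"
proof -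
  obtain x y where xy: "x \<in> X" "x \<in> K1" "y \<in> X" "y \<in> K2" using ne by auto
  then have "x \<noteq> y" using K by auto
  then obtain p where p: "arc p" "path_image p \<subseteq> X" "pathstart p = x" "pathfinish p = y"
    using X xy unfolding path_connected_arcwise by metis
  have cont: "continuous_on {0..1} p" using arc_imp_path[OF p(1)] by (simp add: path_def)
  have cl: "compact ({a..b} \<inter> p -` K)" if "closed K" "0 \<le> a" "b \<le> 1" for K a b
  proof -
    have "continuous_on {a..b} p" using cont by (rule continuous_on_subset) (use that in auto)
    then have "closed ({a..b} \<inter> p -` K)" using that by (intro continuous_closed_preimage) auto
    then have "compact ({a..b} \<inter> ({a..b} \<inter> p -` K))" by (intro compact_Int_closed) auto
    then show ?thesis by (simp add: Int_assoc[symmetric])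
  qed
  have "1 \<in> {0..1} \<inter> p -` K2" using p xy by (auto simp: pathfinish_def)
  then have "{0..1} \<inter> p -` K2 \<noteq> {}" by blast
  from compact_attains_inf[OF cl[OF K(2), of 0 1] this]
  obtain t where t: "t \<in> {0..1}" "p t \<in> K2" and tmin: "\<And>s. s \<in> {0..1} \<Longrightarrow> p s \<in> K2 \<Longrightarrow> t \<le> s"
    by fastforce
  have "0 \<in> {0..t} \<inter> p -` K1" using p xy t by (auto simp: pathstart_def)
  then have ne1: "{0..t} \<inter> p -` K1 \<noteq> {}" by blast
  have "compact ({0..t} \<inter> p -` K1)" using cl[OF K(1), of 0 t] t by simp
  from compact_attains_sup[OF this ne1]
  obtain s where s: "s \<in> {0..t}" "p s \<in> K1" and smax: "\<And>r. r \<in> {0..t} \<Longrightarrow> p r \<in> K1 \<Longrightarrow> r \<le> s"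
    by fastforce
  have st: "s < t" using s t K(3) by (metis IntI atLeastAtMost_iff empty_iff order_less_le)
  have im: "path_image (subpath s t p) = p ` {s..t}" using st by (simp add: path_image_subpath)
  show ?thesis
  proof
    show "arc (subpath s t p)" by (rule arc_subpath_arc[OF p(1)]) (use s t st in auto)
    show "path_image (subpath s t p) \<subseteq> X"
      using p(2) path_image_subpath_subset[of s t p] s t by auto
    show "pathstart (subpath s t p) \<in> K1" "pathfinish (subpath s t p) \<in> K2" using s t by simp_all
    have "r = s \<or> r = t" if "r \<in> {s..t}" "p r \<in> K1 \<union> K2" for r
      using that smax[of r] tmin[of r] s t by force
    then show "path_image (subpath s t p) \<inter> (K1 \<union> K2) = {pathstart (subpath s t p), pathfinish (subpath s t p)}"
      unfolding im using s t st by fastforce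
  qed
qed

lemma connected_meets_middle:
  assumes "connected S" "S \<subseteq> X \<union> Z \<union> Y" "S \<inter> X \<noteq> {}" "S \<inter> Y \<noteq> {}" "closed X" "closed Y" "X \<inter> Y \<subseteq> Z"
  shows "S \<inter> Z \<noteq> {}"
proof
  assume "S \<inter> Z = {}"
  then have "S \<subseteq> X \<union> Y" "X \<inter> Y \<inter> S = {}" using assms(2,7) by blast+
  then show False using connected_closedD[OF assms(1), of X Y] assms(3-6) by blast
qed

text \<open>A genuine Jordan curve is extracted from two fat points joined by two fat edges. One
  half is an arc \<open>g\<close> in \<open>P\<close>, the other an arc \<open>k\<close> with the
  same ends inside \<open>C1\<close>, \<open>C2\<close> and the image of \<open>h\<close>. Within
  the fat points \<open>k\<close> is uncontrolled, but it can pass from \<open>C1\<close> to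
  \<open>C2\<close> only along \<open>h\<close> and so contains the interior of
  \<open>h\<close>.\<close>

lemma cycle_through_sets:
  fixes C1 C2 P Q :: "complex set"
  assumes C: "closed C1" "path_connected C1" "closed C2" "path_connected C2" "C1 \<inter> C2 = {}"
    and P: "path_connected P" "P \<inter> C1 \<noteq> {}" "P \<inter> C2 \<noteq> {}"
    and Q: "path_connected Q" "Q \<inter> C1 \<noteq> {}" "Q \<inter> C2 \<noteq> {}"
    and PQ: "P \<inter> Q \<subseteq> C1 \<union> C2"
  obtains c g h where "simple_path c" "pathfinish c = pathstart c"
    "arc g" "path_image g \<subseteq> P" "pathstart g \<in> C1" "pathfinish g \<in> C2"
    "path_image g \<inter> (C1 \<union> C2) = {pathstart g, pathfinish g}"
    "arc h" "path_image h \<subseteq> Q" "pathstart h \<in> C1" "pathfinish h \<in> C2"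
    "path_image h \<inter> (C1 \<union> C2) = {pathstart h, pathfinish h}"
    "path_image g \<union> (path_image h - {pathstart h, pathfinish h}) \<subseteq> path_image c"
    "path_image c \<subseteq> path_image g \<union> path_image h \<union> C1 \<union> C2"
proof -
  obtain g where g: "arc g" "path_image g \<subseteq> P" "pathstart g \<in> C1" "pathfinish g \<in> C2"
    "path_image g \<inter> (C1 \<union> C2) = {pathstart g, pathfinish g}"
    using arc_between_sets[OF P(1) C(1,3,5) P(2,3)] by blast
  obtain h where h: "arc h" "path_image h \<subseteq> Q" "pathstart h \<in> C1" "pathfinish h \<in> C2"
    "path_image h \<inter> (C1 \<union> C2) = {pathstart h, pathfinish h}"
    using arc_between_sets[OF Q(1) C(1,3,5) Q(2,3)] by blast
  have "path_connected (C1 \<union> path_image h)"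
    by (rule path_connected_Un) (use C h in \<open>auto simp: path_connected_path_image arc_imp_path\<close>)
  then have pc: "path_connected ((C1 \<union> path_image h) \<union> C2)"
    by (rule path_connected_Un) (use C h in auto)
  have "pathstart g \<noteq> pathfinish g" using arc_distinct_ends[OF g(1)] by auto
  then obtain k where k: "arc k" "path_image k \<subseteq> (C1 \<union> path_image h) \<union> C2"
    "pathstart k = pathstart g" "pathfinish k = pathfinish g"
    using pc g(3,4) unfolding path_connected_arcwise by blast
  have gk: "path_image g \<inter> path_image k \<subseteq> {pathstart g, pathfinish g}"
    using k(2) g h PQ by blast
  let ?c = "g +++ reversepath k"
  have im: "path_image ?c = path_image g \<union> path_image k" using k by (simp add: path_image_join)
  have hk: "path_image h - {pathstart h, pathfinish h} \<subseteq> path_image k"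
  proof
    fix y assume "y \<in> path_image h - {pathstart h, pathfinish h}"
    then have y: "y \<in> path_image h" and False: "y \<notin> {pathstart h, pathfinish h}" by auto
    show "y \<in> path_image k"
    proof -
      have yC: "y \<notin> C1 \<union> C2" using False y h(5) by blast
      obtain r where r: "r \<in> {0..1}" "y = h r" using y by (auto simp: path_image_def)
      have sub: "closed (h ` {a..b})" if "0 \<le> a" "b \<le> 1" for a b
      proof -
        have "continuous_on {a..b} h"
          using arc_imp_path[OF h(1)] unfolding path_def by (rule continuous_on_subset) (use that in auto)
        then show ?thesis by (simp add: compact_continuous_image compact_imp_closed)
      qed
      \<comment> \<open>Removing \<open>y\<close> disconnects \<open>C1 \<union> path_image h \<union> C2\<close>.\<close>
      have eq: "path_image h = h ` {0..r} \<union> h ` {r..1}"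
        using r(1) ivl_disj_un_two_touch(4)[of 0 r 1] by (simp add: path_image_def image_Un[symmetric])
      have inj: "inj_on h {0..1}" using h(1) by (simp add: arc_def)
      have mid: "h ` {0..r} \<inter> h ` {r..1} = {y}"
        using r inj by (fastforce simp: inj_on_def)
      have e1: "C2 \<inter> h ` {0..r} = {}" "C1 \<inter> h ` {r..1} = {}"
      proof -
        have r1: "r < 1" "0 < r" using r False by (auto simp: pathfinish_def pathstart_def order_less_le)
        have "h t \<notin> C2" if "t \<in> {0..r}" for t
        proof
          assume "h t \<in> C2"
          then have "h t \<in> {pathstart h, pathfinish h}" using h(5) that r1 by (auto simp: path_image_def)
          then have "h t = pathfinish h" using \<open>h t \<in> C2\<close> h(3) C(5) by auto
          then show False using inj_onD[OF inj, of t 1] that r1 by (simp add: pathfinish_def)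
        qed
        moreover have "h t \<notin> C1" if "t \<in> {r..1}" for t
        proof
          assume "h t \<in> C1"
          then have "h t \<in> {pathstart h, pathfinish h}" using h(5) that r1 by (auto simp: path_image_def)
          then have "h t = pathstart h" using \<open>h t \<in> C1\<close> h(4) C(5) by auto
          then show False using inj_onD[OF inj, of t 0] that r1 by (simp add: pathstart_def)
        qed
        ultimately show "C2 \<inter> h ` {0..r} = {}" "C1 \<inter> h ` {r..1} = {}" by auto
      qed
      have cl: "closed (C1 \<union> h ` {0..r})" "closed (C2 \<union> h ` {r..1})" using C sub r by auto
      have XY: "(C1 \<union> h ` {0..r}) \<inter> (C2 \<union> h ` {r..1}) = {y}"
        using e1 mid C(5) by blast
      show ?thesis
      proof (rule ccontr)
        assume ny: "y \<notin> path_image k"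
        have "path_image k \<subseteq> (C1 \<union> h ` {0..r}) \<union> (C2 \<union> h ` {r..1})" using k(2) eq by blast
        moreover have "pathstart g \<in> path_image k" "pathfinish g \<in> path_image k"
          using k pathstart_in_path_image[of k] pathfinish_in_path_image[of k] by auto
        moreover have "connected (path_image k)" using connected_arc_image[OF k(1)] .
        moreover have "(C1 \<union> h ` {0..r}) \<inter> (C2 \<union> h ` {r..1}) \<inter> path_image k = {}" using XY ny by simp
        ultimately show False
          using connected_closedD[OF _ _ _ cl, of "path_image k"] g(3,4) by blast
      qed
    qed
  qed
  show ?thesis
  proof (rule that[of ?c g h])
    show "simple_path ?c"
      by (rule simple_path_join_loop) (use g k gk in \<open>auto simp: arc_reversepath\<close>)
    show "pathfinish ?c = pathstart ?c" using k by simp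
    show "path_image g \<union> (path_image h - {pathstart h, pathfinish h}) \<subseteq> path_image ?c"
      using hk im by blast
    show "path_image ?c \<subseteq> path_image g \<union> path_image h \<union> C1 \<union> C2" using im k(2) by blast
  qed (use g h in auto)
qed

text \<open>The ends of \<open>D\<close> cut the cycle into two halves. The interiors of
  \<open>g\<close> and \<open>h\<close> are connected and avoid both ends, so each lies in one half.
  No half fits into \<open>C1\<close> and \<open>C2\<close> alone, because it is connected and joins
  these disjoint closed sets; so the two interiors occupy different halves. As \<open>B\<close> runs
  from one interior to the other, \<open>B\<close> and \<open>D\<close> are crossing chords.\<close>

lemma crossing_chords_of_cycle:
  fixes C1 C2 P Q :: "complex set"
  assumes C: "closed C1" "closed C2" "C1 \<inter> C2 = {}" and PQ: "P \<inter> Q \<subseteq> C1 \<union> C2"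
    and c: "simple_path c" "pathfinish c = pathstart c"
    and g: "arc g" "path_image g \<subseteq> P" "path_image g \<inter> (C1 \<union> C2) = {pathstart g, pathfinish g}"
    and h: "arc h" "path_image h \<subseteq> Q" "path_image h \<inter> (C1 \<union> C2) = {pathstart h, pathfinish h}"
    and gh: "path_image g \<union> (path_image h - {pathstart h, pathfinish h}) \<subseteq> path_image c"
      "path_image c \<subseteq> path_image g \<union> path_image h \<union> C1 \<union> C2"
    and D: "arc D" "path_image D \<inter> path_image c = {pathstart D, pathfinish D}"
      "pathstart D \<in> C1" "pathfinish D \<in> C2"
    and B: "arc B" "path_image B \<inter> path_image c = {pathstart B, pathfinish B}"
      "pathstart B \<in> P - (C1 \<union> C2)" "pathfinish B \<in> Q - (C1 \<union> C2)"
    and DB: "path_image D \<inter> path_image B = {}"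
    and z: "z \<in> path_image B - path_image c" and w: "w \<in> path_image D - path_image c"
  shows "\<not> connected_component (- path_image c) z w"
proof -
  define a b where "a = pathstart D" and "b = pathfinish D"
  have ab: "a \<noteq> b" "a \<in> path_image c" "b \<in> path_image c" "a \<in> C1" "b \<in> C2"
    using arc_distinct_ends[OF D(1)] D by (auto simp: a_def b_def)
  obtain u d where ud: "arc u" "arc d" "pathstart u = a" "pathfinish u = b" "pathstart d = b" "pathfinish d = a"
    and int: "path_image u \<inter> path_image d = {a,b}" and un: "path_image u \<union> path_image d = path_image c"
    using exists_double_arc[OF c ab(2,3,1)] by metis
  define G H where "G = path_image g - {pathstart g, pathfinish g}" and "H = path_image h - {pathstart h, pathfinish h}"
  have conn: "connected G" "connected H"
    using connected_simple_path_endless arc_imp_simple_path g h by (auto simp: G_def H_def)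
  have GH: "G \<subseteq> path_image c" "H \<subseteq> path_image c" "G \<inter> (C1 \<union> C2) = {}" "H \<inter> (C1 \<union> C2) = {}"
    "path_image c \<subseteq> G \<union> H \<union> C1 \<union> C2"
    using gh g(3) h(3) by (auto simp: G_def H_def)
  have Bc: "pathstart B \<in> path_image c" "pathfinish B \<in> path_image c" using B(2) by auto
  have BG: "pathstart B \<in> G" "pathfinish B \<in> H"
  proof -
    have "pathstart B \<notin> H" "pathfinish B \<notin> G" using B(3,4) PQ g(2) h(2) by (auto simp: G_def H_def)
    then show "pathstart B \<in> G" "pathfinish B \<in> H" using subsetD[OF GH(5) Bc(1)] subsetD[OF GH(5) Bc(2)] B(3,4) by auto
  qed
  have cl: "closed (path_image u)" "closed (path_image d)" using ud by (auto simp: closed_arc_image)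
  have one: "S \<subseteq> path_image u - {a,b} \<or> S \<subseteq> path_image d - {a,b}"
    if "connected S" "S \<subseteq> path_image c" "S \<inter> (C1 \<union> C2) = {}" for S
  proof -
    have nab: "a \<notin> S" "b \<notin> S" using that(3) ab by blast+
    then have "path_image u \<inter> path_image d \<inter> S = {}" using int by simp
    moreover have "S \<subseteq> path_image u \<union> path_image d" using that un by blast
    ultimately have "path_image u \<inter> S = {} \<or> path_image d \<inter> S = {}"
      using connected_closedD[OF that(1) _ _ cl] by blast
    then show ?thesis using un that(2) nab by blast
  qed
  have both: "path_image x \<inter> (G \<union> H) \<noteq> {}" if x: "arc x" "{pathstart x, pathfinish x} = {a,b}" "path_image x \<subseteq> path_image c" for x
  proof
    assume "path_image x \<inter> (G \<union> H) = {}"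
    then have "path_image x \<subseteq> C1 \<union> C2" using GH(5) x(3) by blast
    moreover have "a \<in> path_image x" "b \<in> path_image x"
      using x(2) pathstart_in_path_image[of x] pathfinish_in_path_image[of x] by (auto simp: doubleton_eq_iff)
    ultimately show False
      using connected_closedD[OF connected_arc_image[OF x(1)] _ _ C(1,2)] C(3) ab(4,5) by blast
  qed
  have bu: "path_image u \<inter> (G \<union> H) \<noteq> {}" "path_image d \<inter> (G \<union> H) \<noteq> {}"
    using both[of u] both[of d] ud un by auto
  have cross: "G \<subseteq> path_image u - {a,b} \<and> H \<subseteq> path_image d - {a,b} \<or> G \<subseteq> path_image d - {a,b} \<and> H \<subseteq> path_image u - {a,b}"
  proof -
    have "path_image d \<inter> (G \<union> H) = {}" if "G \<subseteq> path_image u - {a,b}" "H \<subseteq> path_image u - {a,b}"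
      using that int by auto
    moreover have "path_image u \<inter> (G \<union> H) = {}" if "G \<subseteq> path_image d - {a,b}" "H \<subseteq> path_image d - {a,b}"
      using that int by auto
    ultimately have nu: "\<not> (G \<subseteq> path_image u - {a,b} \<and> H \<subseteq> path_image u - {a,b})"
      "\<not> (G \<subseteq> path_image d - {a,b} \<and> H \<subseteq> path_image d - {a,b})"
      using bu by blast+
    then show ?thesis using one[OF conn(1) GH(1,3)] one[OF conn(2) GH(2,4)] by blast
  qed
  have im: "path_image D \<inter> (path_image u \<union> path_image d) = {a,b}"
    "path_image B \<inter> (path_image u \<union> path_image d) = {pathstart B, pathfinish B}"
    using D(2) B(2) un by (auto simp: a_def b_def)
  have zw: "z \<in> path_image B - {pathstart B, pathfinish B}" "w \<in> path_image D - {a,b}"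
    using z w Bc ab by auto
  have rd: "arc (reversepath d)" "pathstart (reversepath d) = a" "pathfinish (reversepath d) = b"
    using ud by (simp_all add: arc_reversepath)
  show ?thesis
    using cross
  proof (elim disjE conjE)
    assume "G \<subseteq> path_image u - {a,b}" "H \<subseteq> path_image d - {a,b}"
    with BG have "pathstart B \<in> path_image u - {a,b}" "pathfinish B \<in> path_image d - {a,b}" by auto
    then show ?thesis
      using crossing_chords_separated[OF ud(1) rd(1) D(1) B(1) ud(3,4) rd(2,3), of z w] im int DB zw un
      by (simp add: a_def b_def)
  next
    assume "G \<subseteq> path_image d - {a,b}" "H \<subseteq> path_image u - {a,b}"
    with BG have "pathstart B \<in> path_image d - {a,b}" "pathfinish B \<in> path_image u - {a,b}" by auto
    moreover have "path_image d \<union> path_image u = path_image c" "path_image d \<inter> path_image u = {a,b}"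
      using un int by auto
    ultimately show ?thesis
      using crossing_chords_separated[OF rd(1) ud(1) D(1) B(1) rd(2,3) ud(3,4), of z w] im DB zw
      by (simp add: a_def b_def un)
  qed
qed

section \<open>Fat drawings and the non-planarity of the complete graph on five vertices\<close>

text \<open>Points and arcs of a plane drawing are relaxed to path-connected sets, so that contractions
  inherit drawings by taking unions.\<close>

definition fat_drawing :: "'a set \<Rightarrow> 'a set set \<Rightarrow> ('a \<Rightarrow> complex set) \<Rightarrow> ('a set \<Rightarrow> complex set) \<Rightarrow> bool" where
  "fat_drawing V E C A \<longleftrightarrow>
     (\<forall>v\<in>V. compact (C v) \<and> path_connected (C v) \<and> C v \<noteq> {}) \<and>
     (\<forall>u\<in>V. \<forall>v\<in>V. u \<noteq> v \<longrightarrow> C u \<inter> C v = {}) \<and>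
     (\<forall>e\<in>E. compact (A e) \<and> path_connected (A e)) \<and>
     (\<forall>e\<in>E. \<forall>v\<in>V. A e \<inter> C v \<noteq> {} \<longleftrightarrow> v \<in> e) \<and>
     (\<forall>e\<in>E. \<forall>e'\<in>E. e \<noteq> e' \<longrightarrow> A e \<inter> A e' \<subseteq> \<Union> (C ` (e \<inter> e')))"

definition fat_planar :: "'a set \<Rightarrow> 'a set set \<Rightarrow> bool" where
  "fat_planar V E \<longleftrightarrow> (\<exists>C A. fat_drawing V E C A)"

text \<open>The 4-cycle \<open>v1 v3 v2 v4\<close> gives a Jordan curve. Crossing chords lie on opposite sides of it: this holds for the
  pairs \<open>v1 v2\<close> and \<open>v3 v4\<close>, \<open>v1 v2\<close> and \<open>v3 v5 v4\<close>, \<open>v1 v5 v2\<close> and \<open>v3 v4\<close>, although \<open>v1 v5 v2\<close> and \<open>v3 v5 v4\<close>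
  are on the side of \<open>v5\<close>.\<close>

lemma no_fat_K5:
  assumes dist: "distinct [v1, v2, v3, v4, v5]"
    and dr: "fat_drawing {v1, v2, v3, v4, v5} {e. e \<subseteq> {v1, v2, v3, v4, v5} \<and> card e = 2} C A"
  shows False
proof -
  define V where "V = {v1, v2, v3, v4, v5}"
  define E where "E = {e. e \<subseteq> V \<and> card e = 2}"
  have [simp]: "v1 \<noteq> v2" "v1 \<noteq> v3" "v1 \<noteq> v4" "v1 \<noteq> v5" "v2 \<noteq> v3" "v2 \<noteq> v4" "v2 \<noteq> v5" "v3 \<noteq> v4" "v3 \<noteq> v5" "v4 \<noteq> v5"
    "v2 \<noteq> v1" "v3 \<noteq> v1" "v4 \<noteq> v1" "v5 \<noteq> v1" "v3 \<noteq> v2" "v4 \<noteq> v2" "v5 \<noteq> v2" "v4 \<noteq> v3" "v5 \<noteq> v3" "v5 \<noteq> v4"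
    using dist by auto
  have [simp]: "v1 \<in> V" "v2 \<in> V" "v3 \<in> V" "v4 \<in> V" "v5 \<in> V" by (auto simp: V_def)
  define a where "a = (\<lambda>i j. A {i,j})"
  have fd: "\<forall>v\<in>V. compact (C v) \<and> path_connected (C v) \<and> C v \<noteq> {}"
     "\<forall>u\<in>V. \<forall>v\<in>V. u \<noteq> v \<longrightarrow> C u \<inter> C v = {}"
     "\<forall>e\<in>E. compact (A e) \<and> path_connected (A e)"
     "\<forall>e\<in>E. \<forall>v\<in>V. A e \<inter> C v \<noteq> {} \<longleftrightarrow> v \<in> e"
     "\<forall>e\<in>E. \<forall>e'\<in>E. e \<noteq> e' \<longrightarrow> A e \<inter> A e' \<subseteq> \<Union> (C ` (e \<inter> e'))"
    using dr unfolding fat_drawing_def V_def[symmetric] E_def[symmetric] by simp_all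
  have e2: "{i,j} \<in> E" if "i \<in> V" "j \<in> V" "i \<noteq> j" for i j
    using that by (simp add: E_def)
  have cC: "compact (C i)" "path_connected (C i)" "C i \<noteq> {}" "closed (C i)" if "i \<in> V" for i
    using fd(1) that by (simp_all add: compact_imp_closed)
  have cA: "compact (a i j)" "path_connected (a i j)" "closed (a i j)" if "i \<in> V" "j \<in> V" "i \<noteq> j" for i j
    using fd(3) e2[OF that] by (simp_all add: compact_imp_closed a_def)
  have CC: "p \<in> C i \<longrightarrow> p \<notin> C j" if "i \<in> V" "j \<in> V" "i \<noteq> j" for i j p
    using fd(2) that by blast
  have CCd: "C i \<inter> C j = {}" if "i \<in> V" "j \<in> V" "i \<noteq> j" for i j
    using fd(2) that by blast
  have AV: "a i j \<inter> C k \<noteq> {} \<longleftrightarrow> k = i \<or> k = j" if "i \<in> V" "j \<in> V" "k \<in> V" "i \<noteq> j" for i j k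
    using bspec[OF bspec[OF fd(4) e2[OF that(1,2,4)]] that(3)] by (simp add: a_def)
  have AC: "p \<in> a i j \<longrightarrow> p \<notin> C k" if "i \<in> V" "j \<in> V" "k \<in> V" "i \<noteq> j" "k \<noteq> i" "k \<noteq> j" for i j k p
    using AV[OF that(1-4)] that(5,6) by blast
  have ACm: "a i j \<inter> C i \<noteq> {}" "a i j \<inter> C j \<noteq> {}" if "i \<in> V" "j \<in> V" "i \<noteq> j" for i j
    using AV[of i j i] AV[of i j j] that by simp_all
  have AA: "a i j \<inter> a k l \<subseteq> \<Union> (C ` ({i,j} \<inter> {k,l}))"
    if "i \<in> V" "j \<in> V" "i \<noteq> j" "k \<in> V" "l \<in> V" "k \<noteq> l" "{i,j} \<noteq> {k,l}" for i j k l
    using bspec[OF bspec[OF fd(5) e2[OF that(1-3)]] e2[OF that(4-6)]] that(7) by (simp add: a_def)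
  have AA0: "p \<in> a i j \<longrightarrow> p \<notin> a k l" if "i \<in> V" "j \<in> V" "k \<in> V" "l \<in> V" "i \<noteq> j" "k \<noteq> l" "i \<noteq> k" "i \<noteq> l" "j \<noteq> k" "j \<noteq> l" for i j k l p
  proof -
    have "{i,j} \<noteq> {k,l}" "{i,j} \<inter> {k,l} = {}" using that by (auto simp: doubleton_eq_iff)
    then show ?thesis using AA[of i j k l] that by auto
  qed
  have AA1: "p \<in> a i j \<longrightarrow> p \<in> a i k \<longrightarrow> p \<in> C i" if "i \<in> V" "j \<in> V" "k \<in> V" "i \<noteq> j" "k \<noteq> i" "k \<noteq> j" for i j k p
  proof -
    have "{i,j} \<noteq> {i,k}" "{i,j} \<inter> {i,k} = {i}" using that by (auto simp: doubleton_eq_iff)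
    then show ?thesis using AA[of i j i k] that by auto
  qed
  have sym: "a i j = a j i" for i j by (simp add: a_def insert_commute)
  have symr: "a v2 v1 = a v1 v2" "a v3 v1 = a v1 v3" "a v4 v1 = a v1 v4" "a v5 v1 = a v1 v5" "a v3 v2 = a v2 v3"
    "a v4 v2 = a v2 v4" "a v5 v2 = a v2 v5" "a v4 v3 = a v3 v4" "a v5 v3 = a v3 v5" "a v5 v4 = a v4 v5"
    using sym by blast+
  have pc1: "path_connected (C i \<union> a i j \<union> C j)" if "i \<in> V" "j \<in> V" "i \<noteq> j" for i j
    using cC[OF that(1)] cC[OF that(2)] cA[OF that] ACm[OF that]
    by (intro path_connected_Un) (auto simp: Int_commute)
  have pc2: "path_connected (a i j \<union> C j \<union> a k j)" if "i \<in> V" "j \<in> V" "k \<in> V" "i \<noteq> j" "k \<noteq> j" for i j k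
    using cC[OF that(2)] cA[of i j] cA[of k j] ACm[of i j] ACm[of k j] that
    by (intro path_connected_Un) (auto simp: Int_commute)
  have pc3: "path_connected (C i \<union> (a i j \<union> C j \<union> a k j) \<union> C k)" if "i \<in> V" "j \<in> V" "k \<in> V" "i \<noteq> j" "k \<noteq> j" for i j k p
  proof -
    have "path_connected (C i \<union> (a i j \<union> C j \<union> a k j))"
      by (rule path_connected_Un[OF cC(2)[OF that(1)] pc2[OF that]]) (use ACm[of i j] that in auto)
    then show ?thesis
      by (rule path_connected_Un[OF _ cC(2)[OF that(3)]]) (use ACm[of k j] that in auto)
  qed
  define P Q where "P = a v1 v3 \<union> C v3 \<union> a v2 v3" and "Q = a v1 v4 \<union> C v4 \<union> a v2 v4"
  have PQ: "P \<inter> Q \<subseteq> C v1 \<union> C v2"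
  proof
    fix p assume "p \<in> P \<inter> Q"
    then show "p \<in> C v1 \<union> C v2"
      using AA1[of v1 v3 v4 p, simplified] AC[of v1 v3 v4 p, simplified] AA0[of v1 v3 v2 v4 p, simplified] AC[of v1 v4 v3 p, simplified] CC[of v3 v4 p, simplified] AC[of v2 v4 v3 p, simplified] AA0[of v2 v3 v1 v4 p, simplified] AC[of v2 v3 v4 p, simplified] AA1[of v2 v3 v4 p, simplified] unfolding P_def Q_def by (elim IntE UnE) simp_all
  qed
  have PC: "P \<inter> C v1 \<noteq> {}" "P \<inter> C v2 \<noteq> {}" "Q \<inter> C v1 \<noteq> {}" "Q \<inter> C v2 \<noteq> {}"
    using ACm(1)[of v1 v3] ACm(1)[of v2 v3] ACm(1)[of v1 v4] ACm(1)[of v2 v4]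
    by (simp_all add: P_def Q_def Int_Un_distrib2)
  have pcPQ: "path_connected P" "path_connected Q"
    using pc2[of v1 v3 v2] pc2[of v1 v4 v2] by (auto simp: P_def Q_def)
  have c12: "closed (C v1)" "path_connected (C v1)" "closed (C v2)" "path_connected (C v2)" "C v1 \<inter> C v2 = {}"
    using cC CCd[of v1 v2] by auto
  obtain c g h where c: "simple_path c" "pathfinish c = pathstart c"
    and g: "arc g" "path_image g \<subseteq> P" "pathstart g \<in> C v1" "pathfinish g \<in> C v2"
      "path_image g \<inter> (C v1 \<union> C v2) = {pathstart g, pathfinish g}"
    and h: "arc h" "path_image h \<subseteq> Q" "pathstart h \<in> C v1" "pathfinish h \<in> C v2"
      "path_image h \<inter> (C v1 \<union> C v2) = {pathstart h, pathfinish h}"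
    and gh: "path_image g \<union> (path_image h - {pathstart h, pathfinish h}) \<subseteq> path_image c"
      "path_image c \<subseteq> path_image g \<union> path_image h \<union> C v1 \<union> C v2"
    using cycle_through_sets[OF c12 pcPQ(1) PC(1,2) pcPQ(2) PC(3,4) PQ] by blast
  define J where "J = path_image c"
  have Jsub: "J \<subseteq> P \<union> Q \<union> C v1 \<union> C v2" using gh(2) g(2) h(2) by (auto simp: J_def)
  have clJ: "closed J" using closed_simple_path_image[OF c(1)] by (simp add: J_def)
  have J1: "J \<inter> C v1 \<noteq> {}" "J \<inter> C v2 \<noteq> {}"
    using gh(1) g(3,4) pathstart_in_path_image[of g] pathfinish_in_path_image[of g] by (auto simp: J_def)
  \<comment> \<open>\<open>g\<close> is only known to run inside \<open>P\<close>. Chords from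
    \<open>v3\<close> need a foot on the cycle within \<open>C v3\<close>, and connectedness forces
    \<open>g\<close> across that set.\<close>
  have "path_image g \<inter> C v3 \<noteq> {}"
  proof (rule connected_meets_middle)
    show "connected (path_image g)" using connected_arc_image[OF g(1)] .
    show "path_image g \<subseteq> (C v1 \<union> a v1 v3) \<union> C v3 \<union> (C v2 \<union> a v2 v3)" using g(2) by (auto simp: P_def)
    show "path_image g \<inter> (C v1 \<union> a v1 v3) \<noteq> {}" using g(3) pathstart_in_path_image[of g] by blast
    show "path_image g \<inter> (C v2 \<union> a v2 v3) \<noteq> {}" using g(4) pathfinish_in_path_image[of g] by blast
    show "closed (C v1 \<union> a v1 v3)" "closed (C v2 \<union> a v2 v3)" using cC cA[of v1 v3] cA[of v2 v3] by auto
    show "(C v1 \<union> a v1 v3) \<inter> (C v2 \<union> a v2 v3) \<subseteq> C v3"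
    proof
      fix p assume "p \<in> (C v1 \<union> a v1 v3) \<inter> (C v2 \<union> a v2 v3)"
      then show "p \<in> C v3"
        using CC[of v1 v2 p, simplified] AC[of v1 v3 v2 p, simplified] AC[of v2 v3 v1 p, simplified] AA1[of v3 v1 v2 p, simplified] by (elim IntE UnE) (simp_all add: symr)
    qed
  qed
  then have J3: "J \<inter> C v3 \<noteq> {}" using gh(1) by (auto simp: J_def)
  have "path_image h \<inter> C v4 \<noteq> {}"
  proof (rule connected_meets_middle)
    show "connected (path_image h)" using connected_arc_image[OF h(1)] .
    show "path_image h \<subseteq> (C v1 \<union> a v1 v4) \<union> C v4 \<union> (C v2 \<union> a v2 v4)" using h(2) by (auto simp: Q_def)
    show "path_image h \<inter> (C v1 \<union> a v1 v4) \<noteq> {}" using h(3) pathstart_in_path_image[of h] by blast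
    show "path_image h \<inter> (C v2 \<union> a v2 v4) \<noteq> {}" using h(4) pathfinish_in_path_image[of h] by blast
    show "closed (C v1 \<union> a v1 v4)" "closed (C v2 \<union> a v2 v4)" using cC cA[of v1 v4] cA[of v2 v4] by auto
    show "(C v1 \<union> a v1 v4) \<inter> (C v2 \<union> a v2 v4) \<subseteq> C v4"
    proof
      fix p assume "p \<in> (C v1 \<union> a v1 v4) \<inter> (C v2 \<union> a v2 v4)"
      then show "p \<in> C v4"
        using CC[of v1 v2 p, simplified] AC[of v1 v4 v2 p, simplified] AC[of v2 v4 v1 p, simplified] AA1[of v4 v1 v2 p, simplified] by (elim IntE UnE) (simp_all add: symr)
    qed
  qed
  then obtain y where y: "y \<in> path_image h" "y \<in> C v4" by blast
  then have "y \<noteq> pathstart h" "y \<noteq> pathfinish h" using h(3,4) CC[of v1 v4 y] CC[of v2 v4 y] by auto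
  then have J4: "J \<inter> C v4 \<noteq> {}" using gh(1) y by (auto simp: J_def)
  have J5: "J \<inter> C v5 = {}"
  proof (rule equals0I)
    fix p assume "p \<in> J \<inter> C v5"
    then show False
      using Jsub CC[of v1 v5 p, simplified] CC[of v2 v5 p, simplified] CC[of v3 v5 p, simplified] CC[of v4 v5 p, simplified] AC[of v1 v3 v5 p, simplified] AC[of v2 v3 v5 p, simplified] AC[of v1 v4 v5 p, simplified] AC[of v2 v4 v5 p, simplified] unfolding P_def Q_def by auto
  qed
  \<comment> \<open>The arc is taken between \<open>J \<inter> C i\<close> and
    \<open>J \<inter> C j\<close> rather than between the fat points, so that its ends lie on the
    curve and it touches the curve nowhere else.\<close>
  have chord: "\<exists>D. arc D \<and> path_image D \<subseteq> X \<and> pathstart D \<in> C i \<and> pathfinish D \<in> C j \<and>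
      path_image D \<inter> J = {pathstart D, pathfinish D}"
    if pre: "path_connected X" "C i \<union> C j \<subseteq> X" "X \<inter> J \<subseteq> C i \<union> C j" "J \<inter> C i \<noteq> {}" "J \<inter> C j \<noteq> {}"
      "i \<in> V" "j \<in> V" "i \<noteq> j" for X i j
  proof -
    obtain D where D: "arc D" "path_image D \<subseteq> X" "pathstart D \<in> J \<inter> C i" "pathfinish D \<in> J \<inter> C j"
      "path_image D \<inter> (J \<inter> C i \<union> J \<inter> C j) = {pathstart D, pathfinish D}"
      by (rule arc_between_sets[OF pre(1), of "J \<inter> C i" "J \<inter> C j"])
        (use pre clJ cC[OF pre(6)] cC[OF pre(7)] CCd[OF pre(6-8)] in auto)
    have "path_image D \<inter> J = path_image D \<inter> (J \<inter> C i \<union> J \<inter> C j)" using D(2) pre(3) by blast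
    then show ?thesis using D by auto
  qed
  have interior: "\<exists>w. w \<in> path_image D - J" if "arc D" "path_image D \<inter> J = {pathstart D, pathfinish D}" for D
  proof -
    have "\<not> path_image D \<subseteq> {pathstart D, pathfinish D}"
      using that(1) finite_subset[of "path_image D" "{pathstart D, pathfinish D}"]
        connected_finite_iff_sing[OF connected_arc_image[OF that(1)]] arc_distinct_ends[OF that(1)]
        pathstart_in_path_image[of D] pathfinish_in_path_image[of D] by fastforce
    then show ?thesis using that(2) by blast
  qed
  let ?X12 = "C v1 \<union> a v1 v2 \<union> C v2" and ?X34 = "C v3 \<union> a v3 v4 \<union> C v4"
    and ?X152 = "C v1 \<union> (a v1 v5 \<union> C v5 \<union> a v2 v5) \<union> C v2" and ?X354 = "C v3 \<union> (a v3 v5 \<union> C v5 \<union> a v4 v5) \<union> C v4"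
  have "?X12 \<inter> J \<subseteq> C v1 \<union> C v2"
  proof -
    have "a v1 v2 \<inter> (P \<union> Q) \<subseteq> C v1 \<union> C v2"
    proof
      fix p assume "p \<in> a v1 v2 \<inter> (P \<union> Q)"
      then show "p \<in> C v1 \<union> C v2"
        using AA1[of v1 v2 v3 p, simplified] AC[of v1 v2 v3 p, simplified] AA1[of v2 v1 v3 p, simplified] AA1[of v1 v2 v4 p, simplified] AC[of v1 v2 v4 p, simplified] AA1[of v2 v1 v4 p, simplified] unfolding P_def Q_def by (elim IntE UnE) (simp_all add: symr)
    qed
    then show ?thesis using Jsub by blast
  qed
  then obtain D12 where D12: "arc D12" "path_image D12 \<subseteq> ?X12" "pathstart D12 \<in> C v1" "pathfinish D12 \<in> C v2"
    "path_image D12 \<inter> J = {pathstart D12, pathfinish D12}"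
    using chord[of ?X12 v1 v2] pc1[of v1 v2] J1 by auto
  have "?X152 \<inter> J \<subseteq> C v1 \<union> C v2"
  proof -
    have "(a v1 v5 \<union> a v2 v5) \<inter> (P \<union> Q) \<subseteq> C v1 \<union> C v2"
    proof
      fix p assume "p \<in> (a v1 v5 \<union> a v2 v5) \<inter> (P \<union> Q)"
      then show "p \<in> C v1 \<union> C v2"
        using AA1[of v1 v5 v3 p, simplified] AC[of v1 v5 v3 p, simplified] AA0[of v1 v5 v2 v3 p, simplified] AA1[of v1 v5 v4 p, simplified] AC[of v1 v5 v4 p, simplified] AA0[of v1 v5 v2 v4 p, simplified] AA1[of v2 v5 v3 p, simplified] AC[of v2 v5 v3 p, simplified] AA0[of v2 v5 v1 v3 p, simplified] AA1[of v2 v5 v4 p, simplified] AC[of v2 v5 v4 p, simplified] AA0[of v2 v5 v1 v4 p, simplified] unfolding P_def Q_def by (elim IntE UnE) simp_all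
    qed
    then show ?thesis using Jsub J5 by blast
  qed
  then obtain D152 where D152: "arc D152" "path_image D152 \<subseteq> ?X152" "pathstart D152 \<in> C v1" "pathfinish D152 \<in> C v2"
    "path_image D152 \<inter> J = {pathstart D152, pathfinish D152}"
    using chord[of ?X152 v1 v2] pc3[of v1 v5 v2] J1 by auto
  have "?X34 \<inter> J \<subseteq> C v3 \<union> C v4"
  proof -
    have "a v3 v4 \<inter> (P \<union> Q \<union> C v1 \<union> C v2) \<subseteq> C v3 \<union> C v4"
    proof
      fix p assume "p \<in> a v3 v4 \<inter> (P \<union> Q \<union> C v1 \<union> C v2)"
      then show "p \<in> C v3 \<union> C v4"
        using AA1[of v3 v4 v1 p, simplified] AA1[of v3 v4 v2 p, simplified] AA1[of v4 v3 v1 p, simplified] AA1[of v4 v3 v2 p, simplified] AC[of v3 v4 v1 p, simplified] AC[of v3 v4 v2 p, simplified] unfolding P_def Q_def by (elim IntE UnE) (simp_all add: symr)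
    qed
    then show ?thesis using Jsub by blast
  qed
  then obtain D34 where D34: "arc D34" "path_image D34 \<subseteq> ?X34" "pathstart D34 \<in> C v3" "pathfinish D34 \<in> C v4"
    "path_image D34 \<inter> J = {pathstart D34, pathfinish D34}"
    using chord[of ?X34 v3 v4] pc1[of v3 v4] J3 J4 by auto
  have "?X354 \<inter> J \<subseteq> C v3 \<union> C v4"
  proof -
    have "(a v3 v5 \<union> a v4 v5) \<inter> (P \<union> Q \<union> C v1 \<union> C v2) \<subseteq> C v3 \<union> C v4"
    proof
      fix p assume "p \<in> (a v3 v5 \<union> a v4 v5) \<inter> (P \<union> Q \<union> C v1 \<union> C v2)"
      then show "p \<in> C v3 \<union> C v4"
        using AA1[of v3 v5 v1 p, simplified] AA1[of v3 v5 v2 p, simplified] AC[of v3 v5 v4 p, simplified] AA0[of v3 v5 v1 v4 p, simplified] AA0[of v3 v5 v2 v4 p, simplified] AC[of v3 v5 v1 p, simplified] AC[of v3 v5 v2 p, simplified] AA1[of v4 v5 v1 p, simplified] AA1[of v4 v5 v2 p, simplified] AC[of v4 v5 v3 p, simplified] AA0[of v4 v5 v1 v3 p, simplified] AA0[of v4 v5 v2 v3 p, simplified] AC[of v4 v5 v1 p, simplified] AC[of v4 v5 v2 p, simplified] unfolding P_def Q_def by (elim IntE UnE) (simp_all add: symr)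
    qed
    then show ?thesis using Jsub J5 by blast
  qed
  then obtain D354 where D354: "arc D354" "path_image D354 \<subseteq> ?X354" "pathstart D354 \<in> C v3" "pathfinish D354 \<in> C v4"
    "path_image D354 \<inter> J = {pathstart D354, pathfinish D354}"
    using chord[of ?X354 v3 v4] pc3[of v3 v5 v4] J3 J4 by auto
  \<comment> \<open>Both long chords must visit \<open>C v5\<close>. This connected set misses
    \<open>J\<close>, so the points \<open>w\<close> and \<open>z\<close> found there lie on one
    side, which links the two chords.\<close>
  have "path_image D152 \<inter> C v5 \<noteq> {}"
  proof (rule connected_meets_middle)
    show "connected (path_image D152)" using connected_arc_image[OF D152(1)] .
    show "path_image D152 \<subseteq> (C v1 \<union> a v1 v5) \<union> C v5 \<union> (C v2 \<union> a v2 v5)" using D152(2) by auto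
    show "path_image D152 \<inter> (C v1 \<union> a v1 v5) \<noteq> {}" using D152(3) pathstart_in_path_image[of D152] by blast
    show "path_image D152 \<inter> (C v2 \<union> a v2 v5) \<noteq> {}" using D152(4) pathfinish_in_path_image[of D152] by blast
    show "closed (C v1 \<union> a v1 v5)" "closed (C v2 \<union> a v2 v5)" using cC cA[of v1 v5] cA[of v2 v5] by auto
    show "(C v1 \<union> a v1 v5) \<inter> (C v2 \<union> a v2 v5) \<subseteq> C v5"
    proof
      fix p assume "p \<in> (C v1 \<union> a v1 v5) \<inter> (C v2 \<union> a v2 v5)"
      then show "p \<in> C v5"
        using CC[of v1 v2 p, simplified] AC[of v1 v5 v2 p, simplified] AC[of v2 v5 v1 p, simplified] AA1[of v5 v1 v2 p, simplified] by (elim IntE UnE) (simp_all add: symr)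
    qed
  qed
  then obtain w where w: "w \<in> path_image D152" "w \<in> C v5" by auto
  have "path_image D354 \<inter> C v5 \<noteq> {}"
  proof (rule connected_meets_middle)
    show "connected (path_image D354)" using connected_arc_image[OF D354(1)] .
    show "path_image D354 \<subseteq> (C v3 \<union> a v3 v5) \<union> C v5 \<union> (C v4 \<union> a v4 v5)" using D354(2) by auto
    show "path_image D354 \<inter> (C v3 \<union> a v3 v5) \<noteq> {}" using D354(3) pathstart_in_path_image[of D354] by blast
    show "path_image D354 \<inter> (C v4 \<union> a v4 v5) \<noteq> {}" using D354(4) pathfinish_in_path_image[of D354] by blast
    show "closed (C v3 \<union> a v3 v5)" "closed (C v4 \<union> a v4 v5)" using cC cA[of v3 v5] cA[of v4 v5] by auto
    show "(C v3 \<union> a v3 v5) \<inter> (C v4 \<union> a v4 v5) \<subseteq> C v5"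
    proof
      fix p assume "p \<in> (C v3 \<union> a v3 v5) \<inter> (C v4 \<union> a v4 v5)"
      then show "p \<in> C v5"
        using CC[of v3 v4 p, simplified] AC[of v3 v5 v4 p, simplified] AC[of v4 v5 v3 p, simplified] AA1[of v5 v3 v4 p, simplified] by (elim IntE UnE) (simp_all add: symr)
    qed
  qed
  then obtain z where z: "z \<in> path_image D354" "z \<in> C v5" by auto
  obtain p where p: "p \<in> path_image D12 - J" using interior[OF D12(1,5)] by auto
  obtain q where q: "q \<in> path_image D34 - J" using interior[OF D34(1,5)] by auto
  have ends: "C v3 \<subseteq> P - (C v1 \<union> C v2)" "C v4 \<subseteq> Q - (C v1 \<union> C v2)"
    using CCd[of v1 v3] CCd[of v2 v3] CCd[of v1 v4] CCd[of v2 v4] by (auto simp: P_def Q_def)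
  have cross: "\<not> connected_component (- J) y x"
    if "arc D" "path_image D \<inter> J = {pathstart D, pathfinish D}" "pathstart D \<in> C v1" "pathfinish D \<in> C v2"
      "arc B" "path_image B \<inter> J = {pathstart B, pathfinish B}" "pathstart B \<in> C v3" "pathfinish B \<in> C v4"
      "path_image D \<inter> path_image B = {}" "y \<in> path_image B - J" "x \<in> path_image D - J" for D B x y
    using crossing_chords_of_cycle[OF c12(1,3,5) PQ c g(1,2,5) h(1,2,5) gh that(1) _ that(3,4,5), of y x]
      that ends unfolding J_def by blast
  have dis: "?X12 \<inter> ?X34 = {}" "?X12 \<inter> ?X354 = {}" "?X152 \<inter> ?X34 = {}"
  proof -
    show "?X12 \<inter> ?X34 = {}"
    proof (rule equals0I)
      fix p assume "p \<in> ?X12 \<inter> ?X34"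
      then show False
        using CC[of v1 v3 p, simplified] CC[of v1 v4 p, simplified] CC[of v2 v3 p, simplified] CC[of v2 v4 p, simplified] AC[of v1 v2 v3 p, simplified] AC[of v1 v2 v4 p, simplified] AC[of v3 v4 v1 p, simplified] AC[of v3 v4 v2 p, simplified] AA0[of v1 v2 v3 v4 p, simplified] by (elim IntE UnE) simp_all
    qed
    show "?X12 \<inter> ?X354 = {}"
    proof (rule equals0I)
      fix p assume "p \<in> ?X12 \<inter> ?X354"
      then show False
        using CC[of v1 v3 p, simplified] CC[of v1 v4 p, simplified] CC[of v2 v3 p, simplified] CC[of v2 v4 p, simplified] CC[of v1 v5 p, simplified] CC[of v2 v5 p, simplified] AC[of v1 v2 v3 p, simplified] AC[of v1 v2 v4 p, simplified] AC[of v1 v2 v5 p, simplified] AC[of v3 v5 v1 p, simplified] AC[of v3 v5 v2 p, simplified] AC[of v4 v5 v1 p, simplified] AC[of v4 v5 v2 p, simplified] AA0[of v1 v2 v3 v5 p, simplified] AA0[of v1 v2 v4 v5 p, simplified] by (elim IntE UnE) simp_all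
    qed
    show "?X152 \<inter> ?X34 = {}"
    proof (rule equals0I)
      fix p assume "p \<in> ?X152 \<inter> ?X34"
      then show False
        using CC[of v1 v3 p, simplified] CC[of v1 v4 p, simplified] CC[of v2 v3 p, simplified] CC[of v2 v4 p, simplified] CC[of v3 v5 p, simplified] CC[of v4 v5 p, simplified] AC[of v3 v4 v1 p, simplified] AC[of v3 v4 v2 p, simplified] AC[of v3 v4 v5 p, simplified] AC[of v1 v5 v3 p, simplified] AC[of v1 v5 v4 p, simplified] AC[of v2 v5 v3 p, simplified] AC[of v2 v5 v4 p, simplified] AA0[of v1 v5 v3 v4 p, simplified] AA0[of v2 v5 v3 v4 p, simplified] by (elim IntE UnE) simp_all
    qed
  qed
  have zJ: "z \<in> path_image D354 - J" "w \<in> path_image D152 - J" using z w J5 by auto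
  have qp: "\<not> connected_component (- J) q p"
    by (rule cross[OF D12(1,5,3,4) D34(1,5,3,4) _ q p]) (use D12(2) D34(2) dis(1) in blast)
  have zp: "\<not> connected_component (- J) z p"
    by (rule cross[OF D12(1,5,3,4) D354(1,5,3,4) _ zJ(1) p]) (use D12(2) D354(2) dis(2) in blast)
  have qw: "\<not> connected_component (- J) q w"
    by (rule cross[OF D152(1,5,3,4) D34(1,5,3,4) _ q zJ(2)]) (use D152(2) D34(2) dis(3) in blast)
  have "connected_component (- J) z w"
    unfolding connected_component_def
    using z w J5 path_connected_imp_connected[OF cC(2)[of v5]] by (intro exI[of _ "C v5"]) auto
  moreover have "connected_component (- J) q z"
    unfolding J_def
    by (rule Jordan_two_components[OF c, of p])
      (use p q zJ qp zp connected_component_sym in \<open>auto simp: J_def\<close>)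
  ultimately show False using qw connected_component_trans by metis
qed

section \<open>Contraction and degrees\<close>

lemma planar_imp_fat_planar:
  assumes "planar V E"
  shows "fat_planar V E"
proof -
  obtain pos :: "'a \<Rightarrow> complex" and \<gamma> :: "'a set \<Rightarrow> real \<Rightarrow> complex" where inj: "inj_on pos V"
    and arc: "\<forall>e\<in>E. arc (\<gamma> e) \<and> {pathstart (\<gamma> e), pathfinish (\<gamma> e)} = pos ` e"
    and avoid: "\<forall>e\<in>E. \<forall>v\<in>V. pos v \<in> path_image (\<gamma> e) \<longrightarrow> v \<in> e"
    and cross: "\<forall>e\<in>E. \<forall>e'\<in>E. e \<noteq> e' \<longrightarrow> path_image (\<gamma> e) \<inter> path_image (\<gamma> e') \<subseteq> pos ` (e \<inter> e')"
    using assms unfolding planar_def by (elim exE conjE) (rule that)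
  have on: "pos v \<in> path_image (\<gamma> e)" if "e \<in> E" "v \<in> e" for e v
  proof -
    have "pos v \<in> {pathstart (\<gamma> e), pathfinish (\<gamma> e)}" using arc that by blast
    then show ?thesis by auto
  qed
  have "fat_drawing V E (\<lambda>v. {pos v}) (\<lambda>e. path_image (\<gamma> e))"
    unfolding fat_drawing_def
  proof (intro conjI ballI impI)
    fix e v assume "e \<in> E" "v \<in> V"
    then show "(path_image (\<gamma> e) \<inter> {pos v} \<noteq> {}) = (v \<in> e)" using on avoid by auto
  next
    fix e e' assume "e \<in> E" "e' \<in> E" "e \<noteq> e'"
    then show "path_image (\<gamma> e) \<inter> path_image (\<gamma> e') \<subseteq> (\<Union>v\<in>e \<inter> e'. {pos v})" using cross by auto
  qed (use arc inj in \<open>auto simp: compact_arc_image path_connected_path_image arc_imp_path inj_on_def\<close>)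
  then show ?thesis unfolding fat_planar_def by blast
qed

lemma fat_planar_mono:
  assumes "fat_planar V E" "V' \<subseteq> V" "E' \<subseteq> E"
  shows "fat_planar V' E'"
proof -
  obtain C A where "fat_drawing V E C A" using assms(1) unfolding fat_planar_def by blast
  then have "fat_drawing V' E' C A"
    unfolding fat_drawing_def using assms(2,3) by (meson subset_iff)
  then show ?thesis unfolding fat_planar_def by blast
qed

definition nbr :: "'a set set \<Rightarrow> 'a \<Rightarrow> 'a set" where
  "nbr E v = {w. {v,w} \<in> E}"

definition induced :: "'a set set \<Rightarrow> 'a set \<Rightarrow> 'a set set" where
  "induced E X = {e \<in> E. e \<subseteq> X}"

text \<open>The vertex \<open>v\<close> is merged into \<open>u\<close>, so the matching vertex set is \<open>V - {v}\<close>.\<close>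

definition contract :: "'a set set \<Rightarrow> 'a \<Rightarrow> 'a \<Rightarrow> 'a set set" where
  "contract E u v = del_vertex_edges E v \<union> (\<lambda>w. {u,w}) ` (nbr E v - {u})"

lemma nbr_sym: "w \<in> nbr E v \<longleftrightarrow> v \<in> nbr E w"
  by (simp add: nbr_def insert_commute)

lemma simple_graph_edgeE:
  assumes "simple_graph V E" "e \<in> E"
  obtains x y where "e = {x,y}" "x \<noteq> y" "x \<in> V" "y \<in> V"
  using assms unfolding simple_graph_def by (metis card_2_iff insert_subset)

lemma simple_graph_edge:
  assumes "simple_graph V E" "{x,y} \<in> E"
  shows "x \<noteq> y" "x \<in> V" "y \<in> V"
  using assms unfolding simple_graph_def by (auto dest!: bspec)

lemma simple_graph_finite:
  assumes "simple_graph V E"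
  shows "finite V" "finite E" "finite (nbr E v)" "v \<notin> nbr E v" "nbr E v \<subseteq> V"
proof -
  show V: "finite V" using assms by (simp add: simple_graph_def)
  have "E \<subseteq> Pow V" using assms by (auto simp: simple_graph_def)
  then show "finite E" using V finite_subset by blast
  show "v \<notin> nbr E v" using simple_graph_edge(1)[OF assms, of v v] by (auto simp: nbr_def)
  show N: "nbr E v \<subseteq> V" using simple_graph_edge(3)[OF assms] by (auto simp: nbr_def)
  then show "finite (nbr E v)" using V finite_subset by blast
qed

lemma simple_graph_mono: "simple_graph V E \<Longrightarrow> E' \<subseteq> E \<Longrightarrow> simple_graph V E'"
  by (auto simp: simple_graph_def)

lemma simple_graph_induced: "simple_graph V E \<Longrightarrow> X \<subseteq> V \<Longrightarrow> simple_graph X (induced E X)"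
  by (auto simp: simple_graph_def induced_def finite_subset)

lemma simple_graph_del: "simple_graph V E \<Longrightarrow> simple_graph (V - {v}) (del_vertex_edges E v)"
  by (auto simp: simple_graph_def del_vertex_edges_def)

lemma simple_graph_contract:
  assumes "simple_graph V E" "{u,v} \<in> E"
  shows "simple_graph (V - {v}) (contract E u v)"
proof -
  have "card {u,w} = 2 \<and> {u,w} \<subseteq> V - {v}" if "w \<in> nbr E v - {u}" for w
    using that simple_graph_edge[OF assms] simple_graph_finite(4,5)[OF assms(1), of v] by auto
  then show ?thesis
    using simple_graph_del[OF assms(1), of v] unfolding contract_def simple_graph_def by auto
qed

lemma edges_at:
  assumes "simple_graph V E"
  shows "{e \<in> E. v \<in> e} = (\<lambda>w. {v,w}) ` nbr E v"
proof
  show "{e \<in> E. v \<in> e} \<subseteq> (\<lambda>w. {v,w}) ` nbr E v"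
  proof
    fix e assume e: "e \<in> {e \<in> E. v \<in> e}"
    then obtain x y where "e = {x,y}" by (auto elim: simple_graph_edgeE[OF assms])
    then obtain w where "e = {v,w}" using e by auto
    then show "e \<in> (\<lambda>w. {v,w}) ` nbr E v" using e by (auto simp: nbr_def)
  qed
qed (auto simp: nbr_def)

lemma nbr_contract:
  assumes "y \<in> nbr (contract E u v) x"
  shows "{x,y} \<in> E \<or> x = u \<and> {v,y} \<in> E \<or> y = u \<and> {v,x} \<in> E"
proof -
  have "{x,y} \<in> E \<or> (\<exists>w. {v,w} \<in> E \<and> {x,y} = {u,w})"
    using assms unfolding nbr_def contract_def del_vertex_edges_def by blast
  then show ?thesis unfolding doubleton_eq_iff by blast
qed

lemma inj_on_doubleton: "inj_on (\<lambda>w. {v,w}) S"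
  by (auto simp: inj_on_def doubleton_eq_iff)

lemma card_nbr: "simple_graph V E \<Longrightarrow> card (nbr E v) = card {e \<in> E. v \<in> e}"
  by (simp add: edges_at card_image inj_on_doubleton)

lemma card_del_vertex_edges:
  assumes "simple_graph V E"
  shows "card E = card (del_vertex_edges E v) + card (nbr E v)"
proof -
  have "E = del_vertex_edges E v \<union> {e \<in> E. v \<in> e}" by (auto simp: del_vertex_edges_def)
  then have "card E = card (del_vertex_edges E v \<union> {e \<in> E. v \<in> e})" by simp
  also have "\<dots> = card (del_vertex_edges E v) + card {e \<in> E. v \<in> e}"
    using simple_graph_finite(2)[OF assms] by (intro card_Un_disjoint) (auto simp: del_vertex_edges_def)
  finally show ?thesis using card_nbr[OF assms] by simp
qed

text \<open>The lost edges are \<open>{u,v}\<close> and, for each common neighbour, one of two edges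
  that become parallel.\<close>

lemma card_contract:
  assumes "simple_graph V E" "{u,v} \<in> E"
  shows "card E = card (contract E u v) + 1 + card (nbr E u \<inter> nbr E v)"
proof -
  note fin = simple_graph_finite[OF assms(1)]
  let ?N = "nbr E v - {u} - nbr E u"
  have uv: "u \<noteq> v" using simple_graph_edge[OF assms] by simp
  have "{u,w} \<in> del_vertex_edges E v" if "w \<in> nbr E v - {u}" "w \<in> nbr E u" for w
    using that fin(4)[of v] uv by (auto simp: nbr_def del_vertex_edges_def)
  then have eq: "contract E u v = del_vertex_edges E v \<union> (\<lambda>w. {u,w}) ` ?N"
    unfolding contract_def by auto
  have "card (contract E u v) = card (del_vertex_edges E v) + card ((\<lambda>w. {u,w}) ` ?N)"
    unfolding eq using fin(2) fin(3)[of v]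
    by (intro card_Un_disjoint) (auto simp: del_vertex_edges_def nbr_def)
  also have "card ((\<lambda>w. {u,w}) ` ?N) = card ?N"
    by (simp add: card_image inj_on_doubleton)
  finally have 1: "card (contract E u v) = card (del_vertex_edges E v) + card ?N" .
  have "nbr E v = insert u (?N \<union> (nbr E u \<inter> nbr E v))"
    using assms(2) by (auto simp: nbr_def insert_commute)
  moreover have "card (insert u (?N \<union> (nbr E u \<inter> nbr E v))) = 1 + (card ?N + card (nbr E u \<inter> nbr E v))"
    using fin(3)[of v] fin(4)[of u] by (simp add: card_Un_disjoint Int_commute disjoint_iff)
  ultimately have "card (nbr E v) = 1 + card ?N + card (nbr E u \<inter> nbr E v)" by simp
  then show ?thesis using 1 card_del_vertex_edges[OF assms(1), of v] by simp
qed

lemma handshake: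
  assumes "simple_graph V E"
  shows "(\<Sum>v\<in>V. card (nbr E v)) = 2 * card E"
proof -
  note fin = simple_graph_finite[OF assms]
  have "(\<Sum>v\<in>V. card {e \<in> E. v \<in> e}) = (\<Sum>e\<in>E. 2)"
  proof (rule sum_multicount_gen[OF fin(1,2)], intro ballI)
    fix e assume "e \<in> E"
    then have "{v \<in> V. v \<in> e} = e" "card e = 2" using assms by (auto simp: simple_graph_def)
    then show "card {v \<in> V. v \<in> e} = 2" by simp
  qed
  then show ?thesis using card_nbr[OF assms] by simp
qed

lemma exists_low_degree:
  assumes "simple_graph V E" "2 * card E < k * card V"
  shows "\<exists>v\<in>V. card (nbr E v) < k"
proof (rule ccontr)
  assume "\<not> ?thesis"
  then have "(\<Sum>v\<in>V. k) \<le> (\<Sum>v\<in>V. card (nbr E v))" by (intro sum_mono) auto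
  then show False using handshake[OF assms(1)] assms(2) by (simp add: mult.commute)
qed

lemma degree_lower_bound:
  assumes "simple_graph V E" "\<And>v. v \<in> V \<Longrightarrow> k \<le> card (nbr E v)"
  shows "k * card V \<le> 2 * card E"
  using exists_low_degree[OF assms(1), of k] assms(2) by (meson leD not_le_imp_less)

lemma degree_less_card:
  assumes "simple_graph V E" "v \<in> V"
  shows "card (nbr E v) < card V"
  using simple_graph_finite[OF assms(1)] assms(2) by (metis psubset_card_mono psubsetI)

lemma card_edges_le:
  assumes "simple_graph V E"
  shows "2 * card E \<le> card V * (card V - 1)"
proof -
  have "(\<Sum>v\<in>V. card (nbr E v)) \<le> (\<Sum>v\<in>V. card V - 1)"
    using degree_less_card[OF assms] by (intro sum_mono) fastforce
  then show ?thesis using handshake[OF assms] by simp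
qed

text \<open>Inside the closed neighbourhood \<open>v\<close> has degree
  \<open>card (nbr E v)\<close> and each neighbour has degree at least \<open>k + 1\<close>,
  counting \<open>v\<close> and the common neighbours. The handshake identity adds these up to the
  factor \<open>k + 2\<close>.\<close>

lemma closed_neighbourhood_edges:
  assumes s: "simple_graph V E" and k: "\<And>w. w \<in> nbr E v \<Longrightarrow> k \<le> card (nbr E v \<inter> nbr E w)"
  shows "(k + 2) * card (nbr E v) \<le> 2 * card (induced E (insert v (nbr E v)))"
    and "card (insert v (nbr E v)) = Suc (card (nbr E v))"
proof -
  note fin = simple_graph_finite[OF s]
  let ?N = "nbr E v" let ?X = "insert v ?N" let ?H = "induced E ?X"
  show cX: "card ?X = Suc (card ?N)" using fin(3)[of v] fin(4)[of v] by simp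
  show "(k + 2) * card ?N \<le> 2 * card ?H"
  proof (cases "?N = {}")
    case False
    then have "v \<in> V" using simple_graph_edge[OF s] by (auto simp: nbr_def)
    then have H: "simple_graph ?X ?H" using simple_graph_induced[OF s] fin(5)[of v] by simp
    have 1: "nbr ?H v = ?N" by (auto simp: nbr_def induced_def)
    have 2: "k + 1 \<le> card (nbr ?H w)" if w: "w \<in> ?N" for w
    proof -
      have "insert v (?N \<inter> nbr E w) \<subseteq> nbr ?H w"
        using w by (auto simp: nbr_def induced_def insert_commute)
      moreover have "card (insert v (?N \<inter> nbr E w)) = Suc (card (?N \<inter> nbr E w))"
        using fin(3)[of v] fin(4)[of v] by simp
      ultimately show ?thesis
        using k[OF w] card_mono[OF simple_graph_finite(3)[OF H, of w]] by (metis Suc_eq_plus1 Suc_leI le_trans not_less_eq_eq)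
    qed
    have "(\<Sum>w\<in>?X. card (nbr ?H w)) = card ?N + (\<Sum>w\<in>?N. card (nbr ?H w))"
      using fin(3)[of v] fin(4)[of v] 1 by simp
    moreover have "(\<Sum>w\<in>?N. k + 1) \<le> (\<Sum>w\<in>?N. card (nbr ?H w))" using 2 by (intro sum_mono)
    ultimately show ?thesis using handshake[OF H] by (simp add: algebra_simps)
  qed simp
qed

lemma fat_planar_contract:
  assumes s: "simple_graph V E" and f: "fat_planar V E" and uv: "{u,v} \<in> E"
  shows "fat_planar (V - {v}) (contract E u v)"
proof -
  obtain C A where "fat_drawing V E C A" using f unfolding fat_planar_def by blast
  then have fd: "\<forall>v\<in>V. compact (C v) \<and> path_connected (C v) \<and> C v \<noteq> {}"
     "\<forall>u\<in>V. \<forall>v\<in>V. u \<noteq> v \<longrightarrow> C u \<inter> C v = {}"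
     "\<forall>e\<in>E. compact (A e) \<and> path_connected (A e)"
     "\<forall>e\<in>E. \<forall>v\<in>V. A e \<inter> C v \<noteq> {} \<longleftrightarrow> v \<in> e"
     "\<forall>e\<in>E. \<forall>e'\<in>E. e \<noteq> e' \<longrightarrow> A e \<inter> A e' \<subseteq> \<Union> (C ` (e \<inter> e'))"
    unfolding fat_drawing_def by simp_all
  have d1: "compact (C x) \<and> path_connected (C x) \<and> C x \<noteq> {}" if "x \<in> V" for x using fd(1) that by blast
  have d2: "C x \<inter> C y = {}" if "x \<in> V" "y \<in> V" "x \<noteq> y" for x y using fd(2) that by blast
  have d3: "compact (A e) \<and> path_connected (A e)" if "e \<in> E" for e using fd(3) that by blast
  have d4: "A e \<inter> C x \<noteq> {} \<longleftrightarrow> x \<in> e" if "e \<in> E" "x \<in> V" for e x using fd(4) that by blast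
  have d5: "A e \<inter> A e' \<subseteq> \<Union> (C ` (e \<inter> e'))" if "e \<in> E" "e' \<in> E" "e \<noteq> e'" for e e' using fd(5) that by blast
  have ne: "u \<noteq> v" "u \<in> V" "v \<in> V" using simple_graph_edge[OF s uv] by auto
  \<comment> \<open>The merged fat point absorbs the set drawn for the contracted edge.
    \<open>r e\<close> is the old edge whose set now represents \<open>e\<close>: \<open>e\<close>
    itself if it was an edge, otherwise the edge at \<open>v\<close> that was redirected to
    \<open>u\<close>. Of two parallel edges \<open>{u,w}\<close> and \<open>{v,w}\<close> the first
    is kept.\<close>
  define C' where "C' = C(u := C u \<union> A {u,v} \<union> C v)"
  define r where "r = (\<lambda>e. if e \<in> E then e else insert v (e - {u}))"
  have r: "r e \<in> E \<and> (v \<notin> r e \<and> r e = e \<or> v \<in> r e \<and> u \<notin> r e \<and> e = insert u (r e - {v}))"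
    if "e \<in> contract E u v" for e
  proof (cases "e \<in> E")
    case True
    have "v \<notin> e" using that simple_graph_edge[OF s] ne simple_graph_finite(4)[OF s]
      by (auto simp: contract_def del_vertex_edges_def)
    then show ?thesis using True by (simp add: r_def)
  next
    case False
    then have "e \<in> (\<lambda>w. {u,w}) ` (nbr E v - {u})" using that by (simp add: contract_def del_vertex_edges_def)
    then obtain w where w: "w \<in> nbr E v" "w \<noteq> u" "e = {u,w}" by blast
    then have "r e = {v,w}" using False by (auto simp: r_def)
    moreover have "w \<noteq> v" using w simple_graph_finite(4)[OF s] by auto
    ultimately show ?thesis using w ne by (auto simp: nbr_def)
  qed
  have rinj: "r e \<noteq> r e'" if "e \<in> contract E u v" "e' \<in> contract E u v" "e \<noteq> e'" for e e'
    using r[OF that(1)] r[OF that(2)] that(3) by auto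
  have rne: "r e \<noteq> {u,v}" if "e \<in> contract E u v" for e
    using r[OF that] by auto
  have Cx: "C' x = C x" if "x \<noteq> u" for x
    using that by (auto simp: C'_def)
  have Cu: "C' u = C u \<union> A {u,v} \<union> C v" by (simp add: C'_def)
  have sub: "\<Union> (C ` (r e \<inter> r e')) \<subseteq> \<Union> (C' ` (e \<inter> e'))"
    if "e \<in> contract E u v" "e' \<in> contract E u v" for e e'
  proof -
    have "C x \<subseteq> \<Union> (C' ` (e \<inter> e'))" if x: "x \<in> r e" "x \<in> r e'" for x
    proof (cases "x = v")
      case True
      then have "u \<in> e \<inter> e'" using r[OF \<open>e \<in> contract E u v\<close>] r[OF \<open>e' \<in> contract E u v\<close>] x by auto
      then show ?thesis using Cu True by auto
    next
      case False
      then have "x \<in> e \<inter> e'" using r[OF \<open>e \<in> contract E u v\<close>] r[OF \<open>e' \<in> contract E u v\<close>] x by auto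
      moreover have "C x \<subseteq> C' x" by (auto simp: C'_def)
      ultimately show ?thesis by blast
    qed
    then show ?thesis by blast
  qed
  have "fat_drawing (V - {v}) (contract E u v) C' (A \<circ> r)"
    unfolding fat_drawing_def
  proof (intro conjI ballI impI)
    have m: "A {u,v} \<inter> C u \<noteq> {}" "A {u,v} \<inter> C v \<noteq> {}" using d4[OF uv] ne by auto
    have "path_connected (C u \<union> A {u,v} \<union> C v)"
      by (intro path_connected_Un) (use m d1[OF ne(2)] d1[OF ne(3)] d3[OF uv] in auto)
    moreover have "compact (C u \<union> A {u,v} \<union> C v)"
      using d1[OF ne(2)] d1[OF ne(3)] d3[OF uv] by (intro compact_Un) auto
    moreover fix x assume "x \<in> V - {v}"
    ultimately show "compact (C' x)" "path_connected (C' x)" "C' x \<noteq> {}"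
      using d1[of x] d1[OF ne(2)] Cu Cx[of x] by (cases "x = u"; simp)+
  next
    fix x y assume xy: "x \<in> V - {v}" "y \<in> V - {v}" "x \<noteq> y"
    have un: "C z \<inter> (C u \<union> A {u,v} \<union> C v) = {}" if "z \<in> V - {v}" "z \<noteq> u" for z
      using d2[of z u] d2[of z v] d4[OF uv, of z] that ne by auto
    show "C' x \<inter> C' y = {}"
      using un[OF xy(1)] un[OF xy(2)] Cu Cx[of x] Cx[of y] d2[of x y] xy by (metis DiffD1 Int_commute)
  next
    fix e assume "e \<in> contract E u v"
    then show "compact ((A \<circ> r) e)" "path_connected ((A \<circ> r) e)" using d3 r by auto
  next
    fix e x assume e: "e \<in> contract E u v" and x: "x \<in> V - {v}"
    note re = r[OF e]
    show "((A \<circ> r) e \<inter> C' x \<noteq> {}) = (x \<in> e)"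
    proof (cases "x = u")
      case False
      then show ?thesis using d4[of "r e" x] re x Cx[OF False] by auto
    next
      case True
      have a: "A (r e) \<inter> C u \<noteq> {} \<longleftrightarrow> u \<in> r e" "A (r e) \<inter> C v \<noteq> {} \<longleftrightarrow> v \<in> r e"
        using d4 re ne by auto
      have b: "A (r e) \<inter> A {u,v} \<subseteq> \<Union> (C ` (r e \<inter> {u,v}))" using d5 re uv rne[OF e] by blast
      have c: "u \<in> e \<longleftrightarrow> u \<in> r e \<or> v \<in> r e" using re by auto
      have "A (r e) \<inter> A {u,v} = {}" if "u \<notin> r e" "v \<notin> r e" using b that by auto
      then have "A (r e) \<inter> (C u \<union> A {u,v} \<union> C v) \<noteq> {} \<longleftrightarrow> u \<in> r e \<or> v \<in> r e"
        using a by blast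
      then show ?thesis using True Cu c by simp
    qed
  next
    fix e e' assume e: "e \<in> contract E u v" "e' \<in> contract E u v" "e \<noteq> e'"
    have "A (r e) \<inter> A (r e') \<subseteq> \<Union> (C ` (r e \<inter> r e'))"
      using d5 r[OF e(1)] r[OF e(2)] rinj[OF e] by blast
    then show "(A \<circ> r) e \<inter> (A \<circ> r) e' \<subseteq> \<Union> (C' ` (e \<inter> e'))" using sub[OF e(1,2)] by auto
  qed
  then show ?thesis unfolding fat_planar_def by blast
qed

section \<open>Edge bounds\<close>

lemma not_fat_planar_complete_5:
  assumes "card V = 5" "simple_graph V E" "card E = 10"
  shows "\<not> fat_planar V E"
proof
  assume "fat_planar V E"
  then obtain C A where dr: "fat_drawing V E C A" unfolding fat_planar_def by blast
  have finV: "finite V" using assms(2) by (simp add: simple_graph_def)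
  have "card {e. e \<subseteq> V \<and> card e = 2} = 10"
    using n_subsets[OF finV, of 2] assms(1) by (simp add: choose_two)
  moreover have "E \<subseteq> {e. e \<subseteq> V \<and> card e = 2}" using assms(2) by (auto simp: simple_graph_def)
  ultimately have E: "E = {e. e \<subseteq> V \<and> card e = 2}"
    using card_subset_eq[of "{e. e \<subseteq> V \<and> card e = 2}" E] assms(3) finV by simp
  obtain xs where xs: "set xs = V" "distinct xs" using finite_distinct_list[OF finV] by auto
  then have "length xs = Suc (Suc (Suc (Suc (Suc 0))))" using distinct_card[OF xs(2)] assms(1) by simp
  then obtain v1 v2 v3 v4 v5 where "xs = [v1,v2,v3,v4,v5]"
    by (auto simp: length_Suc_conv)
  then show False using no_fat_K5[of v1 v2 v3 v4 v5 C A] xs dr unfolding E by auto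
qed

text \<open>In an edge-minimal counterexample of least order, every edge lies in at least three triangles
  (otherwise contract it), so the closed neighbourhood of a vertex of degree 4 or 5 is too dense.\<close>

lemma fat_planar_edge_bound:
  assumes "fat_planar V E" "simple_graph V E" "3 \<le> card V"
  shows "card E + 6 \<le> 3 * card V"
  using assms
proof (induction "card V" arbitrary: V E rule: less_induct)
  case less
  show ?case
  proof (rule ccontr)
    assume neg: "\<not> ?thesis"
    then have "3 * card V - 5 \<le> card E" by simp
    \<comment> \<open>Trimming to exactly one edge above the bound turns the later counts into
      equalities.\<close>
    then obtain F where F: "F \<subseteq> E" "card F = 3 * card V - 5"
      using obtain_subset_with_card_n by metis
    have sF: "simple_graph V F" using simple_graph_mono[OF less.prems(2) F(1)] .
    have fF: "fat_planar V F" using fat_planar_mono[OF less.prems(1) _ F(1)] by simp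
    note fin = simple_graph_finite[OF sF]
    have n5: "5 \<le> card V"
    proof (rule ccontr)
      assume "\<not> ?thesis"
      then have "card V = 3 \<or> card V = 4" using less.prems(3) by auto
      then show False using card_edges_le[OF sF] F(2) by auto
    qed
    have cV: "card (V - {v}) = card V - 1" "card (V - {v}) < card V" if "v \<in> V" for v
      using that fin(1) n5 by (auto simp: card_Diff_singleton)
    \<comment> \<open>Deleting a vertex lowers the bound by 3, so an excess of one edge forces
      degree at least 4. A contraction must likewise lose at least 4 edges, hence the three
      triangles in \<open>tri\<close>.\<close>
    have deg: "4 \<le> card (nbr F v)" if v: "v \<in> V" for v
    proof -
      have "card (del_vertex_edges F v) + 6 \<le> 3 * card (V - {v})"
        using cV[OF v] n5 fat_planar_mono[OF fF, of "V - {v}" "del_vertex_edges F v"] simple_graph_del[OF sF]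
        by (intro less.hyps) (auto simp: del_vertex_edges_def)
      then show ?thesis using card_del_vertex_edges[OF sF, of v] F(2) n5 cV[OF v] by simp
    qed
    have tri: "3 \<le> card (nbr F u \<inter> nbr F v)" if e: "{u,v} \<in> F" for u v
    proof -
      have v: "v \<in> V" using simple_graph_edge[OF sF e] by simp
      have "card (contract F u v) + 6 \<le> 3 * card (V - {v})"
        using cV[OF v] n5 fat_planar_contract[OF sF fF e] simple_graph_contract[OF sF e]
        by (intro less.hyps) auto
      then show ?thesis using card_contract[OF sF e] F(2) n5 cV[OF v] by simp
    qed
    have nb: "5 * card (nbr F v) \<le> 2 * card (induced F (insert v (nbr F v)))"
      "card (insert v (nbr F v)) = Suc (card (nbr F v))" for v
      using closed_neighbourhood_edges[OF sF, of v 3] tri[of v] by (auto simp: nbr_def)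
    have small: "card (induced F X) + 6 \<le> 3 * card X" if "X \<subset> V" "3 \<le> card X" for X
      using that fin(1) fat_planar_mono[OF fF, of X "induced F X"] simple_graph_induced[OF sF, of X]
      by (intro less.hyps) (auto simp: psubset_card_mono induced_def)
    have sub: "insert v (nbr F v) \<subseteq> V" if "v \<in> V" for v using that fin(5)[of v] by auto
    have deg5: "5 \<le> card (nbr F v)" if v: "v \<in> V" for v
    proof (rule ccontr)
      assume "\<not> ?thesis"
      then have d: "card (nbr F v) = 4" using deg[OF v] by simp
      \<comment> \<open>Ten edges on five vertices beat the bound 9 for a proper subset, so these
        vertices are all of \<open>V\<close> and form a complete graph.\<close>
      then have i: "10 \<le> card (induced F (insert v (nbr F v)))" using nb(1)[of v] by simp
      have "insert v (nbr F v) = V"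
      proof (rule ccontr)
        assume "insert v (nbr F v) \<noteq> V"
        then have "insert v (nbr F v) \<subset> V" using sub[OF v] by auto
        from small[OF this] show False using i nb(2)[of v] d by simp
      qed
      then have "card V = 5" using nb(2)[of v] d by simp
      then show False using not_fat_planar_complete_5[OF _ sF] fF F(2) by simp
    qed
    have "2 * card F < 6 * card V" using F(2) n5 by simp
    then obtain v where v: "v \<in> V" "card (nbr F v) < 6" using exists_low_degree[OF sF] by blast
    then have d: "card (nbr F v) = 5" using deg5[OF v(1)] by simp
    \<comment> \<open>13 is 25/2 rounded up and beats the bound 12 for six vertices, so
      \<open>V\<close> has exactly six. Minimum degree 5 then requires 15 edges, whereas
      \<open>F\<close> has 13.\<close>
    then have i: "13 \<le> card (induced F (insert v (nbr F v)))" using nb(1)[of v] by simp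
    have "insert v (nbr F v) = V"
    proof (rule ccontr)
      assume "insert v (nbr F v) \<noteq> V"
      then have "insert v (nbr F v) \<subset> V" using sub[OF v(1)] by auto
      from small[OF this] show False using i nb(2)[of v] d by simp
    qed
    then have "card V = 6" using nb(2)[of v] d by simp
    then show False using degree_lower_bound[OF sF deg5] F(2) by simp
  qed
qed

text \<open>Fat drawings replace plane ones because this class is closed under contraction.
  Simplicity is bundled in since every edge count relies on it.\<close>

definition crit_apex :: "'a set \<Rightarrow> 'a set set \<Rightarrow> bool" where
  "crit_apex V E \<longleftrightarrow> simple_graph V E \<and> (\<forall>x\<in>V. fat_planar (V - {x}) (del_vertex_edges E x))"

lemma crit_apex_mono: "crit_apex V E \<Longrightarrow> E' \<subseteq> E \<Longrightarrow> crit_apex V E'"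
  unfolding crit_apex_def
  by (auto intro: simple_graph_mono elim!: fat_planar_mono simp: del_vertex_edges_def)

lemma crit_apex_del:
  assumes "crit_apex V E" "v \<in> V"
  shows "crit_apex (V - {v}) (del_vertex_edges E v)"
  unfolding crit_apex_def
proof (intro conjI ballI)
  show "simple_graph (V - {v}) (del_vertex_edges E v)"
    using assms simple_graph_del by (auto simp: crit_apex_def)
  fix x assume "x \<in> V - {v}"
  have "fat_planar (V - {v}) (del_vertex_edges E v)" using assms by (auto simp: crit_apex_def)
  then show "fat_planar (V - {v} - {x}) (del_vertex_edges (del_vertex_edges E v) x)"
    by (rule fat_planar_mono) (auto simp: del_vertex_edges_def)
qed

text \<open>Deleting the merged vertex \<open>u\<close> leaves a subgraph of G - v, which has a fat
  drawing already. Deleting any other vertex \<open>x\<close> gives a subgraph of the contraction of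
  G - x.\<close>

lemma crit_apex_contract:
  assumes "crit_apex V E" "{u,v} \<in> E"
  shows "crit_apex (V - {v}) (contract E u v)"
  unfolding crit_apex_def
proof (intro conjI ballI)
  have s: "simple_graph V E" using assms by (simp add: crit_apex_def)
  show "simple_graph (V - {v}) (contract E u v)" using simple_graph_contract[OF s assms(2)] .
  have ne: "u \<noteq> v" "u \<in> V" "v \<in> V" using simple_graph_edge[OF s assms(2)] by auto
  fix x assume x: "x \<in> V - {v}"
  show "fat_planar (V - {v} - {x}) (del_vertex_edges (contract E u v) x)"
  proof (cases "x = u")
    case True
    have "fat_planar (V - {v}) (del_vertex_edges E v)" using assms ne by (auto simp: crit_apex_def)
    then show ?thesis
      by (rule fat_planar_mono) (auto simp: del_vertex_edges_def contract_def True)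
  next
    case False
    have e: "{u,v} \<in> del_vertex_edges E x" using assms(2) False x by (simp add: del_vertex_edges_def)
    have "fat_planar (V - {x}) (del_vertex_edges E x)" using assms x by (auto simp: crit_apex_def)
    from fat_planar_contract[OF simple_graph_del[OF s] this e]
    show ?thesis
      by (rule fat_planar_mono) (use x in \<open>auto simp: del_vertex_edges_def contract_def nbr_def\<close>)
  qed
qed

text \<open>Some \<open>y\<close> lies outside \<open>X\<close>, so \<open>X\<close> induces a
  subgraph of the drawable graph G - y. Thus only \<open>V\<close> itself can violate sparsity, and
  sparsity of a reduced graph comes down to one edge count.\<close>

lemma crit_apex_proper_bound:
  assumes "crit_apex V E" "X \<subset> V" "3 \<le> card X"
  shows "card (induced E X) + 6 \<le> 3 * card X"
proof -
  obtain y where y: "y \<in> V" "y \<notin> X" using assms(2) by auto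
  have "fat_planar (V - {y}) (del_vertex_edges E y)" using assms(1) y by (simp add: crit_apex_def)
  then have "fat_planar X (induced E X)"
    by (rule fat_planar_mono) (use assms(2) y in \<open>auto simp: induced_def del_vertex_edges_def\<close>)
  then show ?thesis
    using fat_planar_edge_bound simple_graph_induced assms by (metis crit_apex_def psubset_imp_subset)
qed

text \<open>The planar argument with one more edge. Vertex deletion leads to a graph with the
  sharper bound 3n - 6, which forces degree at least 5 and so bypasses the case of K_5. Contraction
  stays in the class, so three triangles per edge come from the induction.\<close>

lemma crit_apex_edge_bound:
  assumes "crit_apex V E" "3 \<le> card V"
  shows "card E + 5 \<le> 3 * card V"
  using assms
proof (induction "card V" arbitrary: V E rule: less_induct)
  case less
  show ?case
  proof (rule ccontr)
    assume neg: "\<not> ?thesis"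
    then have "3 * card V - 4 \<le> card E" by simp
    then obtain F where F: "F \<subseteq> E" "card F = 3 * card V - 4"
      using obtain_subset_with_card_n by metis
    have cF: "crit_apex V F" using crit_apex_mono[OF less.prems(1) F(1)] .
    then have sF: "simple_graph V F" by (simp add: crit_apex_def)
    note fin = simple_graph_finite[OF sF]
    have n6: "6 \<le> card V"
    proof (rule ccontr)
      assume "\<not> ?thesis"
      then have "card V = 3 \<or> card V = 4 \<or> card V = 5" using less.prems(2) by auto
      then show False using card_edges_le[OF sF] F(2) by auto
    qed
    have cV: "card (V - {v}) = card V - 1" "card (V - {v}) < card V" if "v \<in> V" for v
      using that fin(1) n6 by (auto simp: card_Diff_singleton)
    have deg: "5 \<le> card (nbr F v)" if v: "v \<in> V" for v
    proof -
      have "card (del_vertex_edges F v) + 6 \<le> 3 * card (V - {v})"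
        using cV[OF v] n6 cF v simple_graph_del[OF sF]
        by (intro fat_planar_edge_bound) (auto simp: crit_apex_def)
      then show ?thesis using card_del_vertex_edges[OF sF, of v] F(2) n6 cV[OF v] by simp
    qed
    have tri: "3 \<le> card (nbr F u \<inter> nbr F v)" if e: "{u,v} \<in> F" for u v
    proof -
      have v: "v \<in> V" using simple_graph_edge[OF sF e] by simp
      have "card (contract F u v) + 5 \<le> 3 * card (V - {v})"
        using cV[OF v] n6 crit_apex_contract[OF cF e] by (intro less.hyps) auto
      then show ?thesis using card_contract[OF sF e] F(2) n6 cV[OF v] by simp
    qed
    have nb: "5 * card (nbr F v) \<le> 2 * card (induced F (insert v (nbr F v)))"
      "card (insert v (nbr F v)) = Suc (card (nbr F v))" for v
      using closed_neighbourhood_edges[OF sF, of v 3] tri[of v] by (auto simp: nbr_def)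
    have "2 * card F < 6 * card V" using F(2) n6 by simp
    then obtain v where v: "v \<in> V" "card (nbr F v) < 6" using exists_low_degree[OF sF] by blast
    then have d: "card (nbr F v) = 5" using deg[OF v(1)] by simp
    then have i: "13 \<le> card (induced F (insert v (nbr F v)))" using nb(1)[of v] by simp
    have "insert v (nbr F v) = V"
    proof (rule ccontr)
      assume "insert v (nbr F v) \<noteq> V"
      then have "insert v (nbr F v) \<subset> V" using v(1) fin(5)[of v] by auto
      from crit_apex_proper_bound[OF cF this] show False using i nb(2)[of v] d by simp
    qed
    then have "card V = 6" using nb(2)[of v] d by simp
    \<comment> \<open>On six vertices \<open>F\<close> has 14 edges, but minimum degree 5 needs
      15.\<close>
    then show False using degree_lower_bound[OF sF deg] F(2) by simp
  qed
qed

lemma crit_apex_imp_sparse36: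
  assumes "crit_apex V E" "card E + 6 \<le> 3 * card V"
  shows "sparse36 V E"
  unfolding sparse36_def
proof (intro allI impI)
  fix X assume X: "X \<subseteq> V" "3 \<le> card X"
  show "card {e \<in> E. e \<subseteq> X} \<le> 3 * card X - 6"
  proof (cases "X = V")
    case True
    have "finite E" using assms(1) simple_graph_finite by (auto simp: crit_apex_def)
    then have "card {e \<in> E. e \<subseteq> X} \<le> card E" by (intro card_mono) auto
    then show ?thesis using True assms(2) by simp
  next
    case False
    then have "X \<subset> V" using X by blast
    then show ?thesis using crit_apex_proper_bound[OF assms(1), of X] X by (simp add: induced_def)
  qed
qed

text \<open>Additive form for linear arithmetic: with at least three vertices the natural
  subtraction in \<open>sparse36\<close> does not truncate.\<close>

lemma sparse36_induced:
  assumes "sparse36 V E" "X \<subseteq> V" "3 \<le> card X"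
  shows "card (induced E X) + 6 \<le> 3 * card X"
proof -
  have "card {e \<in> E. e \<subseteq> X} \<le> 3 * card X - 6" using assms unfolding sparse36_def by simp
  then show ?thesis using assms(3) by (simp add: induced_def)
qed

section \<open>Reducible configurations\<close>

text \<open>If no vertex of degree at most 4 is reducible and no edge in at most two triangles contracts to a
  sparse graph, then all edges in fewer than three triangles lie in the same number of triangles, which is 0 or 1.
  There are at least twelve vertices of degree 5; contracting two such edges at non-adjacent vertices of degree 5 shows that
  these vertices share four neighbours, and the resulting complete bipartite graph violates sparsity.\<close>

lemma crit_apex_reducible:
  assumes ca: "crit_apex V E" and sp: "sparse36 V E" and ne: "V \<noteq> {}"
  obtains (low) v where "v \<in> V" "card (nbr E v) \<le> 3"
  | (four) v x y where "v \<in> V" "card (nbr E v) = 4" "x \<in> nbr E v" "y \<in> nbr E v" "x \<noteq> y" "{x,y} \<notin> E"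
  | (split) u v where "{u,v} \<in> E" "card (nbr E u \<inter> nbr E v) \<le> 2" "card (contract E u v) + 6 \<le> 3 * card (V - {v})"
proof (rule ccontr)
  assume contr: "\<not> thesis"
  have deg4: "4 \<le> card (nbr E v)" if "v \<in> V" for v using contr low[OF that] by linarith
  have s: "simple_graph V E" using ca by (simp add: crit_apex_def)
  note fin = simple_graph_finite[OF s]
  obtain v0 where "v0 \<in> V" using ne by auto
  then have n5: "5 \<le> card V" using deg4[of v0] degree_less_card[OF s, of v0] by simp
  have cV: "card (V - {v}) = card V - 1" if "v \<in> V" for v
    using that fin(1) by (auto simp: card_Diff_singleton)
  have "induced E V = E" using s by (auto simp: induced_def simple_graph_def)
  then have cE: "card E + 6 \<le> 3 * card V" using sparse36_induced[OF sp, of V] n5 by simp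
  \<comment> \<open>A vertex of degree 4 whose neighbours are pairwise adjacent spans a K_5 with
    them: 10 edges against the permitted 9.\<close>
  have deg5: "5 \<le> card (nbr E v)" if v: "v \<in> V" for v
  proof (rule ccontr)
    assume "\<not> ?thesis"
    then have d: "card (nbr E v) = 4" using deg4[OF v] by simp
    have adj: "{x,y} \<in> E" if "x \<in> nbr E v" "y \<in> nbr E v" "x \<noteq> y" for x y
      using four[OF v d that] contr by blast
    have "3 \<le> card (nbr E v \<inter> nbr E w)" if w: "w \<in> nbr E v" for w
    proof -
      have "nbr E v - {w} \<subseteq> nbr E v \<inter> nbr E w" using adj[OF w] by (auto simp: nbr_def)
      then have "card (nbr E v - {w}) \<le> card (nbr E v \<inter> nbr E w)"
        using fin(3)[of v] by (intro card_mono) auto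
      then show ?thesis using d w by simp
    qed
    from closed_neighbourhood_edges[OF s this] d
    have "10 \<le> card (induced E (insert v (nbr E v)))" "card (insert v (nbr E v)) = 5" by simp_all
    then show False using sparse36_induced[OF sp, of "insert v (nbr E v)"] v fin(5)[of v] by simp
  qed
  \<comment> \<open>If contracting an edge in t \<le> 2 triangles fails, the edge bound leaves
    exactly 3(n - 1) - 5 edges in the contraction. It lost t + 1 edges, so t = |E| + 7 - 3n, the
    same number for every such edge, and sparsity gives t \<le> 1. The additive conjunct of
    \<open>few\<close> records that the subtraction does not truncate once such an edge
    exists.\<close>
  define \<tau> where "\<tau> = card E + 7 - 3 * card V"
  have few: "card (nbr E u \<inter> nbr E v) = \<tau> \<and> \<tau> \<le> 1 \<and> card E + 7 = 3 * card V + \<tau>"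
    if e: "{u,v} \<in> E" "card (nbr E u \<inter> nbr E v) \<le> 2" for u v
  proof -
    have v: "v \<in> V" using simple_graph_edge[OF s e(1)] by simp
    have "card (contract E u v) + 5 \<le> 3 * card (V - {v})"
      using crit_apex_edge_bound[OF crit_apex_contract[OF ca e(1)]] cV[OF v] n5 by simp
    moreover have "\<not> card (contract E u v) + 6 \<le> 3 * card (V - {v})"
      using split[OF e] contr by blast
    ultimately have c: "card (contract E u v) + 8 = 3 * card V" using cV[OF v] n5 by linarith
    then show ?thesis using card_contract[OF s e(1)] cE unfolding \<tau>_def by linarith
  qed
  define D where "D = {v \<in> V. card (nbr E v) = 5}"
  have finD: "finite D" using fin(1) by (simp add: D_def)
  \<comment> \<open>All degrees are at least 5, and 2|E| \<le> 6n - 12 means a total deficit of at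
    least 12 against degree 6; a vertex contributes at most 1 to it.\<close>
  have D12: "12 \<le> card D"
  proof -
    have "(\<Sum>v\<in>V. 6) \<le> (\<Sum>v\<in>V. card (nbr E v) + (if v \<in> D then 1 else 0))"
      using deg5 by (intro sum_mono) (fastforce simp: D_def)
    also have "\<dots> = 2 * card E + card D"
      using handshake[OF s] fin(1) by (simp add: sum.distrib sum.If_cases Int_def D_def)
    finally show ?thesis using cE by simp
  qed
  define B where "B = (\<lambda>v. {b \<in> nbr E v. card (nbr E v \<inter> nbr E b) \<le> 2})"
  have finB: "finite (B v)" for v using fin(3)[of v] by (simp add: B_def)
  have B4: "4 \<le> card (B v)" if v: "v \<in> D" for v
  proof (rule ccontr)
    assume "\<not> ?thesis"
    \<comment> \<open>\<open>S\<close> holds the neighbours \<open>w\<close> with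
      \<open>{v,w}\<close> in at least three triangles. Let k = \<open>card S\<close>, here at least
      2. Each \<open>w\<close> in \<open>S\<close> has three common neighbours with
      \<open>v\<close>, while each member of \<open>B v\<close> is adjacent to at most one vertex of
      \<open>S\<close>. So the degrees inside \<open>S\<close> sum to at least 3k - (5 - k), and
      twice the number of edges on \<open>insert v S\<close> is at least 6k - 5, whereas sparsity
      permits 6k - 6.\<close>
    define S where "S = nbr E v - B v"
    have d: "card (nbr E v) = 5" "v \<in> V" using v by (auto simp: D_def)
    have BS: "card (B v) + card S = 5"
      using d fin(3)[of v] card_Diff_subset[OF finB, of v "nbr E v"] card_mono[OF fin(3)[of v], of "B v"]
      by (auto simp: S_def B_def)
    then have k: "2 \<le> card S" using \<open>\<not> 4 \<le> card (B v)\<close> by simp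
    have finS: "finite S" using fin(3)[of v] by (simp add: S_def)
    have vS: "v \<notin> S" using fin(4)[of v] by (simp add: S_def)
    let ?X = "insert v S" let ?H = "induced E ?X"
    have X: "?X \<subseteq> V" using d fin(5)[of v] by (auto simp: S_def)
    have H: "simple_graph ?X ?H" using simple_graph_induced[OF s X] .
    have nv: "nbr ?H v = S" using fin(4)[of v] by (auto simp: nbr_def induced_def S_def)
    have S3: "3 \<le> card (nbr E v \<inter> nbr E w)" if "w \<in> S" for w using that by (auto simp: S_def B_def)
    have nw: "card (nbr ?H w) = 1 + card (S \<inter> nbr E w)" if w: "w \<in> S" for w
    proof -
      have "nbr ?H w = insert v (S \<inter> nbr E w)"
        using w by (auto simp: nbr_def induced_def S_def insert_commute)
      then show ?thesis using vS finS by simp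
    qed
    have sp3: "card (nbr E v \<inter> nbr E w) = card (S \<inter> nbr E w) + card (B v \<inter> nbr E w)" for w
    proof -
      have "nbr E v \<inter> nbr E w = (S \<inter> nbr E w) \<union> (B v \<inter> nbr E w)" by (auto simp: S_def B_def)
      then show ?thesis
        using finS finB[of v] by (simp add: card_Un_disjoint disjoint_iff S_def)
    qed
    have "(\<Sum>w\<in>S. card (B v \<inter> nbr E w)) = (\<Sum>b\<in>B v. card {w \<in> S. b \<in> nbr E w})"
      using sum_multicount_gen[OF finS finB[of v], of "\<lambda>w b. b \<in> nbr E w" "\<lambda>b. card {w \<in> S. b \<in> nbr E w}"]
      by (simp add: Int_def)
    also have "\<dots> \<le> (\<Sum>b\<in>B v. 1)"
    proof (rule sum_mono)
      fix b assume b: "b \<in> B v"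
      have "{w \<in> S. b \<in> nbr E w} \<subseteq> nbr E v \<inter> nbr E b" using nbr_sym by (fastforce simp: S_def)
      then have "card {w \<in> S. b \<in> nbr E w} \<le> card (nbr E v \<inter> nbr E b)"
        using fin(3)[of v] by (intro card_mono) auto
      also have "\<dots> \<le> 1" using few[of v b] b by (auto simp: B_def nbr_def)
      finally show "card {w \<in> S. b \<in> nbr E w} \<le> 1" .
    qed
    finally have le: "(\<Sum>w\<in>S. card (B v \<inter> nbr E w)) \<le> card (B v)" by simp
    have "(\<Sum>w\<in>S. 3) \<le> (\<Sum>w\<in>S. card (nbr E v \<inter> nbr E w))" using S3 by (intro sum_mono)
    then have "3 * card S \<le> (\<Sum>w\<in>S. card (S \<inter> nbr E w)) + card (B v)"
      using le by (simp add: sp3 sum.distrib)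
    moreover have "2 * card ?H = card S + (\<Sum>w\<in>S. 1 + card (S \<inter> nbr E w))"
      using handshake[OF H] nv nw vS finS by simp
    moreover have "card ?H + 6 \<le> 3 * card ?X" using sparse36_induced[OF sp X] vS finS k by simp
    moreover have "card ?X = Suc (card S)" using vS finS by simp
    ultimately show False using BS by (simp only: sum.distrib) simp
  qed
  \<comment> \<open>Were \<open>b\<close> not adjacent to \<open>v'\<close>, contract
    \<open>{b,v}\<close> and then an edge \<open>{b',v'}\<close> with \<open>b'\<close> in
    \<open>B v'\<close> other than \<open>b\<close>. The first contraction attains 3(n - 1) - 5
    edges, so the second must lose at least 3, which gives \<open>b'\<close> and \<open>v'\<close>
    two common neighbours. As \<open>v'\<close> is adjacent to neither \<open>v\<close> nor
    \<open>b\<close>, these are already common neighbours in the original graph, where there are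
    only \<tau> \<le> 1.\<close>
  have shared: "b \<in> nbr E v'"
    if v: "v \<in> D" and v': "v' \<in> D" and vv: "v \<noteq> v'" "{v,v'} \<notin> E" and b: "b \<in> B v" for v v' b
  proof (rule ccontr)
    assume nb: "b \<notin> nbr E v'"
    have "\<not> B v' \<subseteq> {b}" using B4[OF v'] card_mono[of "{b}" "B v'"] by auto
    then obtain b' where b': "b' \<in> B v'" "b' \<noteq> b" by auto
    have e: "{b,v} \<in> E" "{b',v'} \<in> E" using b b' by (auto simp: B_def nbr_def insert_commute)
    have c: "card (nbr E b \<inter> nbr E v) \<le> 2" "card (nbr E b' \<inter> nbr E v') \<le> 2"
      using b b' by (auto simp: B_def Int_commute)
    note f1 = few[OF e(1) c(1)] and f2 = few[OF e(2) c(2)]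
    have d: "b \<noteq> v'" "b' \<noteq> v" using e vv by (auto simp: insert_commute)
    let ?F = "contract E b v"
    have e2: "{b',v'} \<in> ?F" using e(2) d vv by (auto simp: contract_def del_vertex_edges_def)
    have cF: "crit_apex (V - {v}) ?F" using crit_apex_contract[OF ca e(1)] .
    have sF: "simple_graph (V - {v}) ?F" using cF by (simp add: crit_apex_def)
    have vin: "v \<in> V" "v' \<in> V" using v v' by (auto simp: D_def)
    have "card (V - {v} - {v'}) = card V - 2" using vin vv fin(1) by (simp add: card_Diff_singleton)
    then have "card (contract ?F b' v') + 5 \<le> 3 * (card V - 2)"
      using crit_apex_edge_bound[OF crit_apex_contract[OF cF e2]] n5 by simp
    then have "2 \<le> card (nbr ?F b' \<inter> nbr ?F v')"
      using card_contract[OF sF e2] card_contract[OF s e(1)] f1 n5 by linarith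
    moreover have "nbr ?F b' \<inter> nbr ?F v' \<subseteq> nbr E b' \<inter> nbr E v'"
    proof
      fix y assume y: "y \<in> nbr ?F b' \<inter> nbr ?F v'"
      have "v' \<notin> nbr E v" using vv by (simp add: nbr_def)
      then have 1: "y \<in> nbr E v'"
        using nbr_contract[of y E b v v'] y d by (auto simp: nbr_def)
      have "y \<in> nbr E b' \<or> y = b"
        using nbr_contract[of y E b v b'] y b'(2) by (auto simp: nbr_def)
      then show "y \<in> nbr E b' \<inter> nbr E v'" using 1 nb by auto
    qed
    then have "card (nbr ?F b' \<inter> nbr ?F v') \<le> card (nbr E b' \<inter> nbr E v')"
      using fin(3)[of b'] by (intro card_mono) auto
    ultimately show False using f2 by simp
  qed
  have "D \<noteq> {}" using D12 by auto
  then obtain v where v: "v \<in> D" by auto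
  \<comment> \<open>\<open>v\<close> itself stays in \<open>W\<close>, so at least 12 - 5 = 7
    vertices remain. Seven of them, joined to four members of \<open>B v\<close>, give 28 edges on
    11 vertices, one more than 3 * 11 - 6.\<close>
  define W where "W = D - nbr E v"
  have "card D \<le> card W + card (nbr E v)"
    using card_mono[of "W \<union> nbr E v" D] finD fin(3)[of v] card_Un_le[of W "nbr E v"] by (force simp: W_def)
  then have "7 \<le> card W" using D12 v by (simp add: D_def)
  then obtain T where T: "T \<subseteq> W" "card T = 7" using obtain_subset_with_card_n by metis
  obtain Q where Q: "Q \<subseteq> B v" "card Q = 4" using obtain_subset_with_card_n[OF B4[OF v]] by metis
  have fTQ: "finite T" "finite Q" using T Q by (auto intro: card_ge_0_finite)
  have adj: "{x,b} \<in> E" if "x \<in> T" "b \<in> Q" for x b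
  proof (cases "x = v")
    case True then show ?thesis using that Q(1) by (auto simp: B_def nbr_def)
  next
    case False
    then have "b \<in> nbr E x" using shared[OF v, of x b] that T(1) Q(1) by (auto simp: W_def nbr_def)
    then show ?thesis by (simp add: nbr_def)
  qed
  have TQ: "T \<inter> Q = {}" using T(1) Q(1) by (auto simp: W_def B_def)
  have sub: "T \<union> Q \<subseteq> V" using T(1) Q(1) fin(5)[of v] by (auto simp: W_def D_def B_def)
  have cX: "card (T \<union> Q) = 11" using T Q TQ fTQ by (simp add: card_Un_disjoint)
  have "inj_on (\<lambda>(x,b). {x,b}) (T \<times> Q)" using TQ by (auto simp: inj_on_def doubleton_eq_iff)
  then have "card ((\<lambda>(x,b). {x,b}) ` (T \<times> Q)) = 28" using T Q by (simp add: card_image card_cartesian_product)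
  moreover have "(\<lambda>(x,b). {x,b}) ` (T \<times> Q) \<subseteq> induced E (T \<union> Q)" using adj by (auto simp: induced_def)
  ultimately have "28 \<le> card (induced E (T \<union> Q))"
    using card_mono[of "induced E (T \<union> Q)" "(\<lambda>(x,b). {x,b}) ` (T \<times> Q)"] fin(2) by (simp add: induced_def)
  then show False using sparse36_induced[OF sp sub] cX by simp
qed

section \<open>Linear independence by elimination\<close>

text \<open>Rows indexed by \<open>I\<close> are tested only on the columns in \<open>K\<close>:
  elimination discards a row and a column together, and the necessity proof counts the columns that
  suffice.\<close>

definition lin_indep :: "'i set \<Rightarrow> 'c set \<Rightarrow> ('i \<Rightarrow> 'c \<Rightarrow> real) \<Rightarrow> bool" where
  "lin_indep I K r \<longleftrightarrow> (\<forall>lam. (\<forall>c\<in>K. (\<Sum>i\<in>I. lam i * r i c) = 0) \<longrightarrow> (\<forall>i\<in>I. lam i = 0))"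

lemma lin_indepD:
  "lin_indep I K r \<Longrightarrow> (\<And>c. c \<in> K \<Longrightarrow> (\<Sum>i\<in>I. lam i * r i c) = 0) \<Longrightarrow> i \<in> I \<Longrightarrow> lam i = 0"
  unfolding lin_indep_def by blast

lemma lin_indep_mono:
  assumes "lin_indep I K r" "J \<subseteq> I" "finite I"
  shows "lin_indep J K r"
  unfolding lin_indep_def
proof (intro allI impI ballI)
  fix lam i assume z: "\<forall>c\<in>K. (\<Sum>i\<in>J. lam i * r i c) = 0" and i: "i \<in> J"
  have "(\<Sum>i\<in>I. (if i \<in> J then lam i else 0) * r i c) = (\<Sum>i\<in>J. lam i * r i c)" for c
    using assms(2,3) by (intro sum.mono_neutral_cong_right) auto
  then have "(if i \<in> J then lam i else 0) = 0"
    using lin_indepD[OF assms(1), of "\<lambda>i. if i \<in> J then lam i else 0" i] z i assms(2) by auto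
  then show "lam i = 0" using i by simp
qed

text \<open>Pivoting without division: row \<open>j\<close> is scaled by the pivot and cleared in
  column \<open>k\<close>, which is then dropped. New entries arise by products and differences
  only.\<close>

lemma lin_indep_eliminate:
  assumes "finite I" "i \<notin> I" "k \<in> K" "r i k \<noteq> 0"
  shows "lin_indep (insert i I) K r \<longleftrightarrow> lin_indep I (K - {k}) (\<lambda>j c. r i k * r j c - r j k * r i c)"
    (is "?L \<longleftrightarrow> ?R")
proof
  assume L: ?L
  show ?R
    unfolding lin_indep_def
  proof (intro allI impI ballI)
    fix lam j assume z: "\<forall>c\<in>K - {k}. (\<Sum>j\<in>I. lam j * (r i k * r j c - r j k * r i c)) = 0" and j: "j \<in> I"
    let ?l = "\<lambda>j. if j = i then - (\<Sum>j\<in>I. lam j * r j k) else lam j * r i k"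
    have "(\<Sum>j\<in>insert i I. ?l j * r j c) = 0" if "c \<in> K" for c
    proof -
      have "(\<Sum>j\<in>I. ?l j * r j c) = (\<Sum>j\<in>I. lam j * r i k * r j c)"
        using assms(2) by (intro sum.cong) auto
      then have "(\<Sum>j\<in>insert i I. ?l j * r j c) = (\<Sum>j\<in>I. lam j * (r i k * r j c - r j k * r i c))"
        using assms(1,2) by (simp add: algebra_simps sum_subtractf sum_distrib_left sum_distrib_right)
      also have "\<dots> = 0" using z that by (cases "c = k") (auto simp: mult.commute)
      finally show ?thesis .
    qed
    then have "?l j = 0" using lin_indepD[OF L, of ?l j] j by blast
    then show "lam j = 0" using assms(2,4) j by (auto split: if_splits)
  qed
next
  assume R: ?R
  show ?L
    unfolding lin_indep_def
  proof (intro allI impI)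
    fix lam assume z: "\<forall>c\<in>K. (\<Sum>j\<in>insert i I. lam j * r j c) = 0"
    have z': "(\<Sum>j\<in>I. lam j * r j c) = - lam i * r i c" if "c \<in> K" for c
      using bspec[OF z that] assms(1,2) by simp
    have "(\<Sum>j\<in>I. lam j * (r i k * r j c - r j k * r i c)) = 0" if "c \<in> K - {k}" for c
    proof -
      have "(\<Sum>j\<in>I. lam j * (r i k * r j c - r j k * r i c)) =
          r i k * (\<Sum>j\<in>I. lam j * r j c) - r i c * (\<Sum>j\<in>I. lam j * r j k)"
        by (simp add: algebra_simps sum_subtractf sum_distrib_left)
      then show ?thesis using z'[of c] z'[OF assms(3)] that by simp
    qed
    then have 0: "lam j = 0" if "j \<in> I" for j using lin_indepD[OF R, of lam j] that by blast
    then have "lam i * r i k = 0" using z'[OF assms(3)] by simp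
    then show "\<forall>j\<in>insert i I. lam j = 0" using 0 assms(4) by auto
  qed
qed

lemma lin_indep_nonzero:
  assumes "lin_indep (insert i I) K r" "i \<notin> I" "finite I"
  shows "\<exists>k\<in>K. r i k \<noteq> 0"
proof (rule ccontr)
  assume "\<not> ?thesis"
  then have "(\<Sum>j\<in>insert i I. (if j = i then 1 else 0) * r j c) = 0" if "c \<in> K" for c
    using that assms(2,3) by (intro sum.neutral) auto
  then have "(if i = i then 1 else (0::real)) = 0"
    using lin_indepD[OF assms(1), of "\<lambda>j. if j = i then 1 else 0" i] by blast
  then show False by simp
qed

lemma lin_indep_card_le:
  assumes "finite I" "finite K" "lin_indep I K r"
  shows "card I \<le> card K"
  using assms
proof (induction I arbitrary: K r rule: finite_induct)
  case (insert i I)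
  obtain k where k: "k \<in> K" "r i k \<noteq> 0" using lin_indep_nonzero[OF insert.prems(2) insert.hyps(2,1)] by blast
  have "card I \<le> card (K - {k})"
    using insert.IH insert.prems lin_indep_eliminate[of I i k K r] insert.hyps k by blast
  then show ?case using k insert by (simp add: card_Diff_singleton) (metis Suc_le_eq Suc_pred card_gt_0_iff empty_iff le_imp_less_Suc)
qed simp

text \<open>Elimination never leaves a ring of functions, hence independence at one point is witnessed by
  the non-vanishing of a function of that ring.\<close>

lemma lin_indep_witness:
  fixes A :: "('x \<Rightarrow> real) set"
  assumes A: "(\<lambda>x. 1) \<in> A" "\<And>f g. f \<in> A \<Longrightarrow> g \<in> A \<Longrightarrow> (\<lambda>x. f x - g x) \<in> A"
      "\<And>f g. f \<in> A \<Longrightarrow> g \<in> A \<Longrightarrow> (\<lambda>x. f x * g x) \<in> A"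
    and "finite I" and "\<And>i c. i \<in> I \<Longrightarrow> c \<in> K \<Longrightarrow> (\<lambda>x. r x i c) \<in> A" and "lin_indep I K (r x0)"
  shows "\<exists>f\<in>A. f x0 \<noteq> 0 \<and> (\<forall>x. f x \<noteq> 0 \<longrightarrow> lin_indep I K (r x))"
  using assms(4-)
proof (induction I arbitrary: K r rule: finite_induct)
  case empty
  then show ?case using A(1) by (intro bexI[of _ "\<lambda>x. 1"]) (auto simp: lin_indep_def)
next
  case (insert i I)
  obtain k where k: "k \<in> K" "r x0 i k \<noteq> 0" using lin_indep_nonzero[OF insert.prems(2) insert.hyps(2,1)] by blast
  let ?r = "\<lambda>x j c. r x i k * r x j c - r x j k * r x i c"
  have "\<exists>f\<in>A. f x0 \<noteq> 0 \<and> (\<forall>x. f x \<noteq> 0 \<longrightarrow> lin_indep I (K - {k}) (?r x))"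
  proof (rule insert.IH)
    show "(\<lambda>x. ?r x j c) \<in> A" if "j \<in> I" "c \<in> K - {k}" for j c
      using that k insert.prems(1) by (intro A(2) A(3)) auto
    show "lin_indep I (K - {k}) (?r x0)"
      using lin_indep_eliminate[of I i k K "r x0"] insert.hyps insert.prems(2) k by blast
  qed
  then obtain f where f: "f \<in> A" "f x0 \<noteq> 0" "\<And>x. f x \<noteq> 0 \<Longrightarrow> lin_indep I (K - {k}) (?r x)" by blast
  \<comment> \<open>The witness is the product of all pivots, each chosen to be non-zero at
    \<open>x0\<close>.\<close>
  have "(\<lambda>x. f x * r x i k) \<in> A" using f(1) insert.prems(1) k(1) by (intro A(3)) auto
  moreover have "lin_indep (insert i I) K (r x)" if "f x * r x i k \<noteq> 0" for x
    using lin_indep_eliminate[of I i k K "r x"] insert.hyps k(1) f(3)[of x] that by auto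
  ultimately show ?case using f(2) k(2) by (intro bexI[of _ "\<lambda>x. f x * r x i k"]) auto
qed

section \<open>Polynomial functions and generic points\<close>

text \<open>Polynomials as lists of terms: exponent vectors may repeat and are unconstrained outside
  \<open>I\<close>, so sums and products are mere list operations. The normal form that
  \<open>alg_indep_over_Q\<close> speaks about is produced once, in
  \<open>alg_indep_poly_fun_zero\<close>.\<close>

definition poly_fun :: "'i set \<Rightarrow> (('i \<Rightarrow> real) \<Rightarrow> real) \<Rightarrow> bool" where
  "poly_fun I f \<longleftrightarrow> (\<exists>L :: (rat \<times> ('i \<Rightarrow> nat)) list. \<forall>x. f x = (\<Sum>(a,e)\<leftarrow>L. of_rat a * (\<Prod>i\<in>I. x i ^ e i)))"

lemma poly_fun_const: "poly_fun I (\<lambda>x. of_rat a)"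
  unfolding poly_fun_def by (intro exI[of _ "[(a, \<lambda>_. 0)]"]) simp

lemma poly_fun_var:
  assumes "finite I" "i \<in> I"
  shows "poly_fun I (\<lambda>x. x i)"
proof -
  have "(\<Prod>j\<in>I. x j ^ (if j = i then 1 else 0)) = x i" for x :: "_ \<Rightarrow> real"
  proof -
    have "(\<Prod>j\<in>I. x j ^ (if j = i then 1 else 0)) = (\<Prod>j\<in>I. if j = i then x j else 1)"
      by (intro prod.cong) auto
    then show ?thesis using assms by (simp add: prod.delta)
  qed
  then show ?thesis
    unfolding poly_fun_def by (intro exI[of _ "[(1, \<lambda>j. if j = i then 1 else 0)]"]) simp
qed

lemma poly_fun_add:
  assumes "poly_fun I f" "poly_fun I g"
  shows "poly_fun I (\<lambda>x. f x + g x)"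
proof -
  obtain L M where "\<And>x. f x = (\<Sum>(a,e)\<leftarrow>L. of_rat a * (\<Prod>i\<in>I. x i ^ e i))"
    "\<And>x. g x = (\<Sum>(a,e)\<leftarrow>M. of_rat a * (\<Prod>i\<in>I. x i ^ e i))"
    using assms unfolding poly_fun_def by blast
  then show ?thesis unfolding poly_fun_def by (intro exI[of _ "L @ M"]) simp
qed

lemma poly_fun_monom_mult:
  assumes "poly_fun I f"
  shows "poly_fun I (\<lambda>x. of_rat b * (\<Prod>i\<in>I. x i ^ d i) * f x)"
proof -
  obtain L where L: "\<And>x. f x = (\<Sum>(a,e)\<leftarrow>L. of_rat a * (\<Prod>i\<in>I. x i ^ e i))"
    using assms unfolding poly_fun_def by blast
  have "of_rat b * (\<Prod>i\<in>I. x i ^ d i) * (\<Sum>(a,e)\<leftarrow>L. of_rat a * (\<Prod>i\<in>I. x i ^ e i)) =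
      (\<Sum>(a,e)\<leftarrow>map (\<lambda>(a,e). (b * a, \<lambda>i. d i + e i)) L. of_rat a * (\<Prod>i\<in>I. x i ^ e i))" for x
    by (induction L) (auto simp: algebra_simps of_rat_mult power_add prod.distrib)
  then have "of_rat b * (\<Prod>i\<in>I. x i ^ d i) * f x =
      (\<Sum>(a,e)\<leftarrow>map (\<lambda>(a,e). (b * a, \<lambda>i. d i + e i)) L. of_rat a * (\<Prod>i\<in>I. x i ^ e i))" for x
    unfolding L .
  then show ?thesis unfolding poly_fun_def by blast
qed

lemma poly_fun_mult:
  assumes "poly_fun I f" "poly_fun I g"
  shows "poly_fun I (\<lambda>x. f x * g x)"
proof -
  obtain L where L: "\<And>x. f x = (\<Sum>(a,e)\<leftarrow>L. of_rat a * (\<Prod>i\<in>I. x i ^ e i))"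
    using assms(1) unfolding poly_fun_def by blast
  have "poly_fun I (\<lambda>x. (\<Sum>(a,e)\<leftarrow>L. of_rat a * (\<Prod>i\<in>I. x i ^ e i)) * g x)"
  proof (induction L)
    case Nil
    then show ?case using poly_fun_const[of I 0] by simp
  next
    case (Cons p L)
    then show ?case
      using poly_fun_add[OF poly_fun_monom_mult[OF assms(2), of "fst p" "snd p"] Cons.IH]
      by (simp add: case_prod_unfold algebra_simps)
  qed
  then show ?thesis using L by simp
qed

lemma poly_fun_diff:
  assumes "poly_fun I f" "poly_fun I g"
  shows "poly_fun I (\<lambda>x. f x - g x)"
proof -
  have "poly_fun I (\<lambda>x. of_rat (- 1) * g x)" by (rule poly_fun_mult[OF poly_fun_const assms(2)])
  from poly_fun_add[OF assms(1) this] show ?thesis by (simp add: of_rat_minus)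
qed

text \<open>After truncating exponents to \<open>I\<close> and collecting equal exponent vectors,
  the coefficient function \<open>c\<close> describes \<open>f\<close> at every point. Algebraic
  independence of \<open>x\<close> makes \<open>c\<close> vanish, so \<open>f\<close> is zero
  everywhere.\<close>

lemma alg_indep_poly_fun_zero:
  assumes x: "alg_indep_over_Q I x" and f: "poly_fun I f" "f x = 0"
  shows "f y = 0"
proof -
  obtain L where L: "\<And>x. f x = (\<Sum>(a,e)\<leftarrow>L. of_rat a * (\<Prod>i\<in>I. x i ^ e i))"
    using f(1) unfolding poly_fun_def by blast
  define tr where "tr = (\<lambda>(e :: 'a \<Rightarrow> nat) i. if i \<in> I then e i else 0)"
  define M where "M = map (\<lambda>(a,e). (a, tr e)) L"
  define c where "c = (\<lambda>\<alpha>. \<Sum>(a,e)\<leftarrow>M. if e = \<alpha> then a else 0)"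
  have LM: "f x = (\<Sum>(a,e)\<leftarrow>M. of_rat a * (\<Prod>i\<in>I. x i ^ e i))" for x
    unfolding L M_def by (induction L) (auto simp: tr_def intro!: prod.cong)
  have fin: "finite (snd ` set M)" by simp
  have c0: "c \<alpha> = 0" if "\<alpha> \<notin> snd ` set M" for \<alpha>
    using that unfolding c_def by (induction M) auto
  have coll: "(\<Sum>\<alpha>\<in>T. of_rat (\<Sum>(a,e)\<leftarrow>N. if e = \<alpha> then a else 0) * m \<alpha>) = (\<Sum>(a,e)\<leftarrow>N. of_rat a * m e)"
    if "finite T" "snd ` set N \<subseteq> T" for T and N :: "(rat \<times> ('a \<Rightarrow> nat)) list" and m :: "_ \<Rightarrow> real"
    using that(2)
  proof (induction N)
    case (Cons p N)
    obtain a e where p: "p = (a,e)" by (cases p)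
    have "(\<Sum>\<alpha>\<in>T. of_rat (\<Sum>(a,e)\<leftarrow>p # N. if e = \<alpha> then a else 0) * m \<alpha>) =
      (\<Sum>\<alpha>\<in>T. (if \<alpha> = e then of_rat a * m \<alpha> else 0)) + (\<Sum>\<alpha>\<in>T. of_rat (\<Sum>(a,e)\<leftarrow>N. if e = \<alpha> then a else 0) * m \<alpha>)"
      unfolding p sum.distrib[symmetric] by (intro sum.cong) (auto simp: of_rat_add algebra_simps)
    also have "(\<Sum>\<alpha>\<in>T. (if \<alpha> = e then of_rat a * m \<alpha> else 0)) = of_rat a * m e"
      using that(1) Cons.prems p by (simp add: sum.delta)
    finally show ?case using Cons p by simp
  qed simp
  have fc: "f x = (\<Sum>\<alpha>\<in>{\<alpha>. c \<alpha> \<noteq> 0}. of_rat (c \<alpha>) * (\<Prod>i\<in>I. x i ^ \<alpha> i))" for x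
  proof -
    have "f x = (\<Sum>\<alpha>\<in>snd ` set M. of_rat (c \<alpha>) * (\<Prod>i\<in>I. x i ^ \<alpha> i))"
      unfolding LM c_def by (rule coll[OF fin, symmetric]) simp
    also have "\<dots> = (\<Sum>\<alpha>\<in>{\<alpha>. c \<alpha> \<noteq> 0}. of_rat (c \<alpha>) * (\<Prod>i\<in>I. x i ^ \<alpha> i))"
      using fin c0 by (intro sum.mono_neutral_right) auto
    finally show ?thesis .
  qed
  have "finite {\<alpha>. c \<alpha> \<noteq> 0}" using c0 by (intro finite_subset[OF _ fin]) auto
  moreover have "\<forall>\<alpha>. c \<alpha> \<noteq> 0 \<longrightarrow> (\<forall>i. i \<notin> I \<longrightarrow> \<alpha> i = 0)"
  proof (intro allI impI)
    fix \<alpha> i assume "c \<alpha> \<noteq> 0" "i \<notin> I"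
    then have "\<alpha> \<in> snd ` set M" using c0 by blast
    then show "\<alpha> i = 0" using \<open>i \<notin> I\<close> by (auto simp: M_def tr_def)
  qed
  ultimately have "\<forall>\<alpha>. c \<alpha> = 0" using x f(2) unfolding alg_indep_over_Q_def fc by blast
  then show ?thesis unfolding fc by simp
qed

lemma alg_indep_mono:
  assumes "alg_indep_over_Q I x" "J \<subseteq> I" "finite I"
  shows "alg_indep_over_Q J x"
  unfolding alg_indep_over_Q_def
proof (intro allI impI, elim conjE)
  fix c :: "('a \<Rightarrow> nat) \<Rightarrow> rat" and \<alpha>
  assume c: "finite {\<alpha>. c \<alpha> \<noteq> 0}" "\<forall>\<alpha>. c \<alpha> \<noteq> 0 \<longrightarrow> (\<forall>i. i \<notin> J \<longrightarrow> \<alpha> i = 0)"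
    "(\<Sum>\<alpha>\<in>{\<alpha>. c \<alpha> \<noteq> 0}. of_rat (c \<alpha>) * (\<Prod>i\<in>J. x i ^ \<alpha> i)) = 0"
  have "(\<Prod>i\<in>I. x i ^ \<alpha> i) = (\<Prod>i\<in>J. x i ^ \<alpha> i)" if "c \<alpha> \<noteq> 0" for \<alpha>
    using c(2) that assms(2,3) by (intro prod.mono_neutral_right) auto
  then have "(\<Sum>\<alpha>\<in>{\<alpha>. c \<alpha> \<noteq> 0}. of_rat (c \<alpha>) * (\<Prod>i\<in>I. x i ^ \<alpha> i)) = 0"
    unfolding c(3)[symmetric] by (intro sum.cong) auto
  moreover have "\<forall>\<alpha>. c \<alpha> \<noteq> 0 \<longrightarrow> (\<forall>i. i \<notin> I \<longrightarrow> \<alpha> i = 0)" using c(2) assms(2) by blast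
  ultimately show "c \<alpha> = 0" using assms(1) c(1) unfolding alg_indep_over_Q_def by blast
qed

lemma countable_rat_polys:
  assumes "finite I"
  shows "countable {c :: ('i \<Rightarrow> nat) \<Rightarrow> rat. finite {\<alpha>. c \<alpha> \<noteq> 0} \<and> (\<forall>\<alpha>. c \<alpha> \<noteq> 0 \<longrightarrow> (\<forall>i. i \<notin> I \<longrightarrow> \<alpha> i = 0))}"
    (is "countable ?S")
proof -
  let ?E = "{\<alpha> :: 'i \<Rightarrow> nat. \<forall>i. i \<notin> I \<longrightarrow> \<alpha> i = 0}"
  have "inj_on (\<lambda>\<alpha>. restrict \<alpha> I) ?E"
  proof (rule inj_onI, rule ext)
    fix \<alpha> \<beta> :: "'i \<Rightarrow> nat" and i
    assume "\<alpha> \<in> ?E" "\<beta> \<in> ?E" "restrict \<alpha> I = restrict \<beta> I"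
    then show "\<alpha> i = \<beta> i" by (cases "i \<in> I") (auto dest: fun_cong[of _ _ i])
  qed
  moreover have "countable ((\<lambda>\<alpha>. restrict \<alpha> I) ` ?E)"
    by (rule countable_subset[of _ "PiE I (\<lambda>_. UNIV)"]) (use assms in \<open>auto intro: countable_PiE\<close>)
  ultimately have "countable ?E" using countable_image_inj_on by blast
  then have "countable {T. finite T \<and> T \<subseteq> ?E \<times> (UNIV :: rat set)}"
    by (intro countable_Collect_finite_subset) auto
  \<comment> \<open>A coefficient function is encoded by its graph over its support, a finite subset
    of a countable set.\<close>
  moreover have "(\<lambda>c. (\<lambda>\<alpha>. (\<alpha>, c \<alpha>)) ` {\<alpha>. c \<alpha> \<noteq> 0}) ` ?S \<subseteq> {T. finite T \<and> T \<subseteq> ?E \<times> (UNIV :: rat set)}"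
    by auto
  ultimately have "countable ((\<lambda>c. (\<lambda>\<alpha>. (\<alpha>, c \<alpha>)) ` {\<alpha>. c \<alpha> \<noteq> 0}) ` ?S)" using countable_subset by blast
  moreover have "inj_on (\<lambda>c. (\<lambda>\<alpha>. (\<alpha>, c \<alpha>)) ` {\<alpha>. c \<alpha> \<noteq> 0}) ?S"
  proof (rule inj_onI, rule ext)
    fix c d :: "('i \<Rightarrow> nat) \<Rightarrow> rat" and \<alpha>
    assume eq: "(\<lambda>\<alpha>. (\<alpha>, c \<alpha>)) ` {\<alpha>. c \<alpha> \<noteq> 0} = (\<lambda>\<alpha>. (\<alpha>, d \<alpha>)) ` {\<alpha>. d \<alpha> \<noteq> 0}"
    have "c \<alpha> \<noteq> 0 \<Longrightarrow> (\<alpha>, c \<alpha>) \<in> (\<lambda>\<alpha>. (\<alpha>, d \<alpha>)) ` {\<alpha>. d \<alpha> \<noteq> 0}" unfolding eq[symmetric] by auto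
    moreover have "d \<alpha> \<noteq> 0 \<Longrightarrow> (\<alpha>, d \<alpha>) \<in> (\<lambda>\<alpha>. (\<alpha>, c \<alpha>)) ` {\<alpha>. c \<alpha> \<noteq> 0}" unfolding eq by auto
    ultimately show "c \<alpha> = d \<alpha>" by force
  qed
  ultimately show ?thesis using countable_image_inj_on by blast
qed

text \<open>Adjoin one coordinate at a time: each of the countably many polynomials excludes only
  finitely many values of the new coordinate.\<close>

lemma exists_alg_indep:
  assumes "finite I"
  shows "\<exists>x :: 'i \<Rightarrow> real. alg_indep_over_Q I x"
  using assms
proof (induction I rule: finite_induct)
  case empty
  show ?case
    unfolding alg_indep_over_Q_def
  proof (intro exI allI impI, elim conjE)
    fix c :: "('i \<Rightarrow> nat) \<Rightarrow> rat" and \<alpha>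
    assume c: "\<forall>\<alpha>. c \<alpha> \<noteq> 0 \<longrightarrow> (\<forall>i. i \<notin> {} \<longrightarrow> \<alpha> i = 0)"
      "(\<Sum>\<alpha>\<in>{\<alpha>. c \<alpha> \<noteq> 0}. of_rat (c \<alpha>) * (\<Prod>i\<in>{}. (0::real) ^ \<alpha> i)) = 0"
    show "c \<alpha> = 0"
    proof (rule ccontr)
      assume "c \<alpha> \<noteq> 0"
      have "\<beta> = (\<lambda>_. 0)" if "c \<beta> \<noteq> 0" for \<beta> using c(1) that by auto
      from this[OF \<open>c \<alpha> \<noteq> 0\<close>] this have "{\<alpha>. c \<alpha> \<noteq> 0} = {\<alpha>}" using \<open>c \<alpha> \<noteq> 0\<close> by auto
      then show False using c(2) \<open>c \<alpha> \<noteq> 0\<close> by simp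
    qed
  qed
next
  case (insert j I)
  then obtain x :: "'i \<Rightarrow> real" where x: "alg_indep_over_Q I x" by blast
  let ?J = "insert j I"
  define S where "S = {c :: ('i \<Rightarrow> nat) \<Rightarrow> rat. finite {\<alpha>. c \<alpha> \<noteq> 0} \<and> (\<forall>\<alpha>. c \<alpha> \<noteq> 0 \<longrightarrow> (\<forall>i. i \<notin> ?J \<longrightarrow> \<alpha> i = 0))}"
  \<comment> \<open>\<open>P c\<close> is \<open>c\<close> with the old coordinates substituted, a
    univariate polynomial in the new one.\<close>
  define P where "P = (\<lambda>c :: ('i \<Rightarrow> nat) \<Rightarrow> rat. \<Sum>\<alpha>\<in>{\<alpha>. c \<alpha> \<noteq> 0}. monom (of_rat (c \<alpha>) * (\<Prod>i\<in>I. x i ^ \<alpha> i)) (\<alpha> j))"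
  have P0: "P c \<noteq> 0" if c: "c \<in> S" "c \<noteq> (\<lambda>_. 0)" for c
  proof
    assume "P c = 0"
    obtain \<alpha>0 where \<alpha>0: "c \<alpha>0 \<noteq> 0" using c(2) by auto
    define k where "k = \<alpha>0 j"
    \<comment> \<open>\<open>d\<close> is the coefficient of the k-th power of variable
      \<open>j\<close>, itself a polynomial in the old variables. It is non-trivial by the choice of
      \<open>k\<close>, so \<open>P c = 0\<close> would make it a relation between the old
      coordinates.\<close>
    define d where "d = (\<lambda>\<beta> :: 'i \<Rightarrow> nat. if \<beta> j = 0 then c (\<beta>(j := k)) else 0)"
    have fin: "finite {\<alpha>. c \<alpha> \<noteq> 0}" using c(1) by (simp add: S_def)
    have bij: "bij_betw (\<lambda>\<beta>. \<beta>(j := k)) {\<beta>. d \<beta> \<noteq> 0} {\<alpha>. c \<alpha> \<noteq> 0 \<and> \<alpha> j = k}"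
    proof (rule bij_betw_byWitness[where f' = "\<lambda>\<alpha>. \<alpha>(j := 0)"])
      have z: "\<beta> j = 0" if "d \<beta> \<noteq> 0" for \<beta> using that by (simp add: d_def split: if_splits)
      then show "\<forall>\<beta>\<in>{\<beta>. d \<beta> \<noteq> 0}. (\<beta>(j := k))(j := 0) = \<beta>" by (simp add: fun_upd_idem)
      show "\<forall>\<alpha>\<in>{\<alpha>. c \<alpha> \<noteq> 0 \<and> \<alpha> j = k}. (\<alpha>(j := 0))(j := k) = \<alpha>" by (simp add: fun_upd_idem)
      show "(\<lambda>\<beta>. \<beta>(j := k)) ` {\<beta>. d \<beta> \<noteq> 0} \<subseteq> {\<alpha>. c \<alpha> \<noteq> 0 \<and> \<alpha> j = k}"
        by (rule image_subsetI) (simp add: d_def split: if_splits)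
      show "(\<lambda>\<alpha>. \<alpha>(j := 0)) ` {\<alpha>. c \<alpha> \<noteq> 0 \<and> \<alpha> j = k} \<subseteq> {\<beta>. d \<beta> \<noteq> 0}"
        by (rule image_subsetI) (auto simp: d_def fun_upd_idem)
    qed
    have "finite {\<beta>. d \<beta> \<noteq> 0}"
      using bij_betw_finite[OF bij] fin by simp
    moreover have "\<forall>\<beta>. d \<beta> \<noteq> 0 \<longrightarrow> (\<forall>i. i \<notin> I \<longrightarrow> \<beta> i = 0)"
    proof (intro allI impI)
      fix \<beta> i assume "d \<beta> \<noteq> 0" "i \<notin> I"
      then have "\<beta> j = 0" "c (\<beta>(j := k)) \<noteq> 0" by (auto simp: d_def split: if_splits)
      then have "i = j \<or> (\<beta>(j := k)) i = 0" using c(1) \<open>i \<notin> I\<close> by (auto simp: S_def)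
      then show "\<beta> i = 0" using \<open>\<beta> j = 0\<close> by (cases "i = j") auto
    qed
    moreover have "(\<Sum>\<beta>\<in>{\<beta>. d \<beta> \<noteq> 0}. of_rat (d \<beta>) * (\<Prod>i\<in>I. x i ^ \<beta> i)) = 0"
    proof -
      have "(\<Sum>\<beta>\<in>{\<beta>. d \<beta> \<noteq> 0}. of_rat (d \<beta>) * (\<Prod>i\<in>I. x i ^ \<beta> i)) =
        (\<Sum>\<beta>\<in>{\<beta>. d \<beta> \<noteq> 0}. of_rat (c (\<beta>(j := k))) * (\<Prod>i\<in>I. x i ^ (\<beta>(j := k)) i))"
        using insert.hyps(2) by (intro sum.cong arg_cong2[where f = "(*)"] prod.cong) (auto simp: d_def split: if_splits)
      also have "\<dots> = (\<Sum>\<alpha>\<in>{\<alpha>. c \<alpha> \<noteq> 0 \<and> \<alpha> j = k}. of_rat (c \<alpha>) * (\<Prod>i\<in>I. x i ^ \<alpha> i))"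
        by (rule sum.reindex_bij_betw[OF bij])
      also have "\<dots> = coeff (P c) k"
        unfolding P_def coeff_sum
        using fin by (simp add: sum.If_cases Int_def conj_commute)
      finally show ?thesis using \<open>P c = 0\<close> by simp
    qed
    ultimately have "\<forall>\<beta>. d \<beta> = 0" using x unfolding alg_indep_over_Q_def by blast
    then have "d (\<alpha>0(j := 0)) = 0" by blast
    then show False using \<alpha>0 by (simp add: d_def k_def)
  qed
  have "countable S" unfolding S_def by (rule countable_rat_polys) (use insert in auto)
  then have "countable (\<Union>c\<in>S - {\<lambda>_. 0}. {t. poly (P c) t = 0})"
    using P0 poly_roots_finite by (intro countable_UN) (auto intro!: countable_finite)
  then obtain t where t: "t \<notin> (\<Union>c\<in>S - {\<lambda>_. 0}. {t. poly (P c) t = 0})"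
    using uncountable_UNIV_real by (metis UNIV_I countable_subset subsetI)
  have "alg_indep_over_Q ?J (x(j := t))"
    unfolding alg_indep_over_Q_def
  proof (intro allI impI, elim conjE)
    fix c :: "('i \<Rightarrow> nat) \<Rightarrow> rat" and \<alpha>
    assume c: "finite {\<alpha>. c \<alpha> \<noteq> 0}" "\<forall>\<alpha>. c \<alpha> \<noteq> 0 \<longrightarrow> (\<forall>i. i \<notin> ?J \<longrightarrow> \<alpha> i = 0)"
      "(\<Sum>\<alpha>\<in>{\<alpha>. c \<alpha> \<noteq> 0}. of_rat (c \<alpha>) * (\<Prod>i\<in>?J. (x(j := t)) i ^ \<alpha> i)) = 0"
    have pr: "(\<Prod>i\<in>?J. (x(j := t)) i ^ \<alpha> i) = (\<Prod>i\<in>I. x i ^ \<alpha> i) * t ^ \<alpha> j" for \<alpha>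
    proof -
      have "(\<Prod>i\<in>I. (x(j := t)) i ^ \<alpha> i) = (\<Prod>i\<in>I. x i ^ \<alpha> i)"
        using insert.hyps(2) by (intro prod.cong) auto
      then show ?thesis using insert.hyps by simp
    qed
    have "poly (P c) t = 0"
      using c(3) unfolding pr P_def by (simp add: poly_sum poly_monom mult.assoc)
    moreover have "c \<in> S" using c by (simp add: S_def)
    ultimately have "c = (\<lambda>_. 0)" using t by blast
    then show "c \<alpha> = 0" by simp
  qed
  then show ?case by blast
qed

lemma exists_generic:
  assumes "finite V"
  shows "\<exists>p. generic V p"
proof -
  obtain x :: "'a \<times> 3 \<Rightarrow> real" where x: "alg_indep_over_Q (V \<times> UNIV) x"
    using exists_alg_indep[of "V \<times> (UNIV :: 3 set)"] assms by auto
  have "(\<lambda>(v, k). (\<chi> k. x (v, k)) $ k) = x" by auto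
  then have "generic V (\<lambda>v. \<chi> k. x (v, k))" using x by (simp add: generic_def)
  then show ?thesis by blast
qed

lemma generic_mono:
  assumes "generic V p" "W \<subseteq> V" "finite V"
  shows "generic W p"
  using assms unfolding generic_def by (elim alg_indep_mono) auto

text \<open>Any point \<open>y\<close>, however special, at which \<open>f\<close> does not vanish
  shows that \<open>f\<close> is a non-zero polynomial. General position of a generic placement is
  proved through such sample points.\<close>

lemma generic_poly_fun_nonzero:
  assumes "generic V p" "poly_fun (V \<times> UNIV) f" "f y \<noteq> 0"
  shows "f (\<lambda>(v, k). p v $ k) \<noteq> 0"
  using assms alg_indep_poly_fun_zero unfolding generic_def by blast

lemma lin_indep_generic:
  assumes "finite V" "generic V p" "finite I"
    and "\<And>i c. i \<in> I \<Longrightarrow> c \<in> K \<Longrightarrow> poly_fun (V \<times> UNIV) (\<lambda>y. r y i c)" "lin_indep I K (r y0)"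
  shows "lin_indep I K (r (\<lambda>(v, k). p v $ k))"
proof -
  have "\<exists>f\<in>{f. poly_fun (V \<times> UNIV) f}. f y0 \<noteq> 0 \<and> (\<forall>y. f y \<noteq> 0 \<longrightarrow> lin_indep I K (r y))"
    by (rule lin_indep_witness)
      (use assms poly_fun_const[of "V \<times> UNIV" 1] poly_fun_diff poly_fun_mult in auto)
  then show ?thesis using generic_poly_fun_nonzero[OF assms(2)] by blast
qed

section \<open>Equilibrium stresses\<close>

text \<open>Rigidity rows with an arbitrary direction \<open>D v w\<close> in place of the
  difference of positions. In vertex splitting the row of \<open>{u,v}\<close> must keep a direction
  when both ends coincide.\<close>

definition edge_row :: "('a \<Rightarrow> 'a \<Rightarrow> real^3) \<Rightarrow> 'a set \<Rightarrow> 'a \<times> 3 \<Rightarrow> real" where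
  "edge_row D e = (\<lambda>(v, k). if v \<in> e then D v (THE w. w \<in> e \<and> w \<noteq> v) $ k else 0)"

text \<open>Triviality of the left kernel of the edge rows. Stresses are symmetric functions of two
  vertices vanishing off \<open>E\<close>, so that equilibrium sums run over all of \<open>V\<close>
  and stresses can be restricted and merged pointwise.\<close>

definition stress_free :: "'a set \<Rightarrow> 'a set set \<Rightarrow> ('a \<Rightarrow> 'a \<Rightarrow> real^3) \<Rightarrow> bool" where
  "stress_free V E D \<longleftrightarrow> (\<forall>\<omega>. (\<forall>x y. \<omega> x y = \<omega> y x) \<and> (\<forall>x y. {x,y} \<notin> E \<longrightarrow> \<omega> x y = (0::real)) \<and>
     (\<forall>x\<in>V. (\<Sum>y\<in>V. \<omega> x y *\<^sub>R D x y) = 0) \<longrightarrow> (\<forall>x y. \<omega> x y = 0))"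

lemma stress_freeD:
  "stress_free V E D \<Longrightarrow> (\<And>x y. \<omega> x y = \<omega> y x) \<Longrightarrow> (\<And>x y. {x,y} \<notin> E \<Longrightarrow> \<omega> x y = (0::real)) \<Longrightarrow>
     (\<And>x. x \<in> V \<Longrightarrow> (\<Sum>y\<in>V. \<omega> x y *\<^sub>R D x y) = 0) \<Longrightarrow> \<omega> x y = 0"
  unfolding stress_free_def by blast

lemma rigidity_row_eq: "rigidity_row p = edge_row (\<lambda>x y. p x - p y)"
  by (simp add: fun_eq_iff rigidity_row_def edge_row_def)

lemma rows_independent_eq: "rows_independent E p \<longleftrightarrow> lin_indep E UNIV (edge_row (\<lambda>x y. p x - p y))"
  by (simp add: rows_independent_def lin_indep_def rigidity_row_eq)

lemma edge_row_doubleton: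
  assumes "v \<noteq> w"
  shows "edge_row D {v,w} (v,k) = D v w $ k"
proof -
  have "(THE u. u \<in> {v,w} \<and> u \<noteq> v) = w" using assms by (intro the_equality) auto
  then show ?thesis by (simp add: edge_row_def)
qed

lemma sum_edge_row:
  assumes s: "simple_graph V E" and om: "\<And>x y. \<omega> x y = (if {x,y} \<in> E then lam {x,y} else 0)"
  shows "(\<Sum>e\<in>E. lam e * edge_row D e (v,k)) = (\<Sum>y\<in>V. \<omega> v y *\<^sub>R D v y) $ k"
proof -
  note fin = simple_graph_finite[OF s]
  have "(\<Sum>e\<in>E. lam e * edge_row D e (v,k)) = (\<Sum>e\<in>{e\<in>E. v \<in> e}. lam e * edge_row D e (v,k))"
    using fin(2) by (intro sum.mono_neutral_right) (auto simp: edge_row_def)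
  also have "\<dots> = (\<Sum>w\<in>nbr E v. lam {v,w} * edge_row D {v,w} (v,k))"
    unfolding edges_at[OF s] by (subst sum.reindex[OF inj_on_doubleton]) simp
  also have "\<dots> = (\<Sum>w\<in>nbr E v. \<omega> v w * D v w $ k)"
  proof (intro sum.cong refl)
    fix w assume w: "w \<in> nbr E v"
    then have "v \<noteq> w" using fin(4)[of v] by auto
    then show "lam {v,w} * edge_row D {v,w} (v,k) = \<omega> v w * D v w $ k"
      using w om[of v w] by (simp add: edge_row_doubleton nbr_def)
  qed
  also have "\<dots> = (\<Sum>y\<in>V. \<omega> v y * D v y $ k)"
    using fin(1) fin(5)[of v] om[of v] by (intro sum.mono_neutral_left) (auto simp: nbr_def)
  finally show ?thesis by simp
qed

lemma lin_indep_edge_row_iff: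
  assumes s: "simple_graph V E"
  shows "lin_indep E UNIV (edge_row D) \<longleftrightarrow> stress_free V E D"
proof
  assume L: "lin_indep E UNIV (edge_row D)"
  show "stress_free V E D"
    unfolding stress_free_def
  proof (intro allI impI, elim conjE)
    fix \<omega> :: "_ \<Rightarrow> _ \<Rightarrow> real" and x y
    assume sym: "\<forall>x y. \<omega> x y = \<omega> y x" and supp: "\<forall>x y. {x,y} \<notin> E \<longrightarrow> \<omega> x y = 0"
      and eq: "\<forall>x\<in>V. (\<Sum>y\<in>V. \<omega> x y *\<^sub>R D x y) = 0"
    \<comment> \<open>The choice is unambiguous on every \<open>{x,y}\<close> because
      \<open>\<omega>\<close> is symmetric.\<close>
    define lam where "lam = (\<lambda>e. SOME t. \<exists>x y. e = {x,y} \<and> t = \<omega> x y)"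
    have lam: "lam {x,y} = \<omega> x y" for x y
    proof -
      have "\<exists>x' y'. {x,y} = {x',y'} \<and> lam {x,y} = \<omega> x' y'"
        unfolding lam_def by (rule someI_ex) blast
      then obtain x' y' where xy: "{x,y} = {x',y'}" "lam {x,y} = \<omega> x' y'" by blast
      then have "x = x' \<and> y = y' \<or> x = y' \<and> y = x'" by (simp add: doubleton_eq_iff)
      then show ?thesis using xy(2) sym by auto
    qed
    have "\<omega> x y = (if {x,y} \<in> E then lam {x,y} else 0)" for x y using lam supp by simp
    note sr = sum_edge_row[OF s this]
    have "(\<Sum>e\<in>E. lam e * edge_row D e c) = 0" for c
    proof (cases c)
      case (Pair v k)
      show ?thesis
      proof (cases "v \<in> V")
        case True then show ?thesis using sr[of D v k] eq by (simp add: Pair del: sum_component)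
      next
        case False
        then have "\<omega> v y = 0" for y using supp simple_graph_edge(2)[OF s, of v y] by auto
        then show ?thesis using sr[of D v k] by (simp add: Pair)
      qed
    qed
    then have "\<forall>e\<in>E. lam e = 0" using L unfolding lin_indep_def by blast
    then show "\<omega> x y = 0" using lam supp by metis
  qed
next
  assume R: "stress_free V E D"
  show "lin_indep E UNIV (edge_row D)"
    unfolding lin_indep_def
  proof (intro allI impI ballI)
    fix lam e assume z: "\<forall>c\<in>UNIV. (\<Sum>e\<in>E. lam e * edge_row D e c) = 0" and e: "e \<in> E"
    define \<omega> where "\<omega> = (\<lambda>x y. if {x,y} \<in> E then lam {x,y} else 0)"
    have "\<omega> x y = 0" for x y
    proof (rule stress_freeD[OF R])
      fix x assume "x \<in> V"
      show "(\<Sum>y\<in>V. \<omega> x y *\<^sub>R D x y) = 0"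
        using sum_edge_row[OF s, of \<omega> lam D x] z by (simp add: vec_eq_iff \<omega>_def del: sum_component)
    qed (simp_all add: \<omega>_def insert_commute)
    moreover obtain x y where xy: "e = {x,y}" using simple_graph_edgeE[OF s e] by metis
    ultimately have "\<omega> x y = 0" by blast
    then show "lam e = 0" using e xy by (simp add: \<omega>_def)
  qed
qed

lemma rows_independent_iff:
  "simple_graph V E \<Longrightarrow> rows_independent E p \<longleftrightarrow> stress_free V E (\<lambda>x y. p x - p y)"
  by (simp add: rows_independent_eq lin_indep_edge_row_iff)

lemma rows_independent_generic:
  assumes s: "simple_graph V E" and p0: "rows_independent E p0" and p: "generic V p"
  shows "rows_independent E p"
proof -
  note fin = simple_graph_finite[OF s]
  define r where "r = (\<lambda>y :: 'a \<times> 3 \<Rightarrow> real. edge_row (\<lambda>u w. (\<chi> k. y (u,k)) - (\<chi> k. y (w,k))))"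
  have r: "r (\<lambda>(v, k). q v $ k) = edge_row (\<lambda>x y. q x - q y)" for q
    by (simp add: r_def)
  have "poly_fun (V \<times> UNIV) (\<lambda>y. r y e c)" if e: "e \<in> E" for e c
  proof (cases c)
    case (Pair v k)
    show ?thesis
    proof (cases "v \<in> e")
      case True
      obtain x y where xy: "e = {x,y}" "x \<noteq> y" "x \<in> V" "y \<in> V" using simple_graph_edgeE[OF s e] .
      then obtain w where w: "e = {v,w}" "v \<noteq> w" "v \<in> V" "w \<in> V" using True by auto
      have "r y e c = y (v,k) - y (w,k)" for y
        using w unfolding r_def Pair by (simp add: edge_row_doubleton)
      then show ?thesis using w fin(1) by (simp add: poly_fun_diff poly_fun_var)
    next
      case False
      then have "r y e c = 0" for y by (simp add: r_def edge_row_def Pair)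
      then show ?thesis using poly_fun_const[of _ 0] by simp
    qed
  qed
  moreover have "lin_indep E UNIV (r (\<lambda>(v, k). p0 v $ k))" using p0 r by (simp add: rows_independent_eq)
  ultimately have "lin_indep E UNIV (r (\<lambda>(v, k). p v $ k))"
    by (intro lin_indep_generic[OF fin(1) p fin(2)]) auto
  then show ?thesis using r by (simp add: rows_independent_eq)
qed

text \<open>Generic placements exist, so the universal quantifier in \<open>R3_independent\<close>
  is not vacuous; conversely, independence at one placement, generic or not, carries over to all
  generic ones.\<close>

lemma R3_independent_iff:
  assumes "simple_graph V E"
  shows "R3_independent V E \<longleftrightarrow> (\<exists>p. rows_independent E p)"
  using exists_generic simple_graph_finite(1)[OF assms] rows_independent_generic[OF assms]
  unfolding R3_independent_def by blast

text \<open>Placing \<open>x\<close> at the origin and \<open>S\<close> at distinct unit vectors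
  makes the differences independent, which passes to generic placements. The bound 3 is the
  dimension of the space; it decides how many stresses at one vertex can be forced to
  vanish.\<close>

lemma generic_affinely_independent:
  assumes V: "finite V" "generic V p" and x: "x \<in> V" "S \<subseteq> V - {x}" "card S \<le> 3"
    and z: "(\<Sum>w\<in>S. a w *\<^sub>R (p w - p x)) = 0" and w: "w \<in> S"
  shows "a w = 0"
proof -
  have finS: "finite S" using V(1) x(2) finite_subset by blast
  obtain h :: "'a \<Rightarrow> 3" where h: "inj_on h S"
    using card_le_inj[OF finS, of "UNIV :: 3 set"] x(3) by auto
  define r where "r = (\<lambda>(y :: 'a \<times> 3 \<Rightarrow> real) w k. y (w,k) - y (x,k))"
  define y0 where "y0 = (\<lambda>(w,k). if w \<in> S \<and> h w = k then 1 else 0 :: real)"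
  have "lin_indep S UNIV (r y0)"
    unfolding lin_indep_def
  proof (intro allI impI ballI)
    fix lam u assume z: "\<forall>k\<in>UNIV. (\<Sum>w\<in>S. lam w * r y0 w k) = 0" and u: "u \<in> S"
    have "(\<Sum>w\<in>S. lam w * r y0 w (h u)) = (\<Sum>w\<in>S. if w = u then lam w else 0)"
      using x(2) h u by (intro sum.cong) (auto simp: r_def y0_def inj_on_def)
    then show "lam u = 0" using z u finS by simp
  qed
  moreover have "poly_fun (V \<times> UNIV) (\<lambda>y. r y w k)" if "w \<in> S" for w k
    unfolding r_def using that x V(1) by (intro poly_fun_diff poly_fun_var) auto
  ultimately have "lin_indep S UNIV (r (\<lambda>(v, k). p v $ k))"
    by (intro lin_indep_generic[OF V finS]) auto
  moreover have "(\<Sum>w\<in>S. a w * r (\<lambda>(v, k). p v $ k) w k) = 0" for k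
    using arg_cong[OF z, of "\<lambda>v. v $ k"] by (simp add: r_def)
  ultimately show ?thesis using lin_indepD[of S UNIV _ a w] w by blast
qed

section \<open>Extension moves preserving independence\<close>

text \<open>Equilibrium at \<open>v\<close> is a relation between at most three generic directions,
  so the stress vanishes on all edges at \<open>v\<close> and restricts to a stress of the graph
  without \<open>v\<close>.\<close>

lemma rows_independent_add_low_degree:
  assumes s: "simple_graph V E" and v: "v \<in> V" "card (nbr E v) \<le> 3"
    and F: "rows_independent (del_vertex_edges E v) p0"
  shows "\<exists>p. rows_independent E p"
proof -
  note fin = simple_graph_finite[OF s]
  obtain p where p: "generic V p" using exists_generic[OF fin(1)] by blast
  have sF: "simple_graph (V - {v}) (del_vertex_edges E v)" using simple_graph_del[OF s] .
  have "rows_independent (del_vertex_edges E v) p"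
    using rows_independent_generic[OF sF F] generic_mono[OF p _ fin(1)] by blast
  then have free: "stress_free (V - {v}) (del_vertex_edges E v) (\<lambda>x y. p x - p y)"
    using rows_independent_iff[OF sF] by simp
  have "stress_free V E (\<lambda>x y. p x - p y)"
    unfolding stress_free_def
  proof (intro allI impI, elim conjE)
    fix \<omega> :: "_ \<Rightarrow> _ \<Rightarrow> real" and a b
    assume sym: "\<forall>x y. \<omega> x y = \<omega> y x" and supp: "\<forall>x y. {x,y} \<notin> E \<longrightarrow> \<omega> x y = 0"
      and eq: "\<forall>x\<in>V. (\<Sum>y\<in>V. \<omega> x y *\<^sub>R (p x - p y)) = 0"
    have "(\<Sum>y\<in>nbr E v. \<omega> v y *\<^sub>R (p y - p v)) = - (\<Sum>y\<in>nbr E v. \<omega> v y *\<^sub>R (p v - p y))"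
      by (simp add: sum_negf[symmetric] scaleR_right_diff_distrib)
    also have "(\<Sum>y\<in>nbr E v. \<omega> v y *\<^sub>R (p v - p y)) = (\<Sum>y\<in>V. \<omega> v y *\<^sub>R (p v - p y))"
      using fin(1) fin(5)[of v] supp by (intro sum.mono_neutral_left) (auto simp: nbr_def)
    finally have "(\<Sum>y\<in>nbr E v. \<omega> v y *\<^sub>R (p y - p v)) = 0" using eq v(1) by simp
    then have "\<omega> v y = 0" if "y \<in> nbr E v" for y
      using generic_affinely_independent[OF fin(1) p v(1) _ v(2), of "\<omega> v" y] that fin(4,5)[of v] by auto
    then have v0: "\<omega> v y = 0" for y using supp by (cases "y \<in> nbr E v") (auto simp: nbr_def)
    then have 0: "\<omega> v y = 0" "\<omega> y v = 0" for y using v0[of y] sym[rule_format, of v y] by simp_all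
    show "\<omega> a b = 0"
    proof (rule stress_freeD[OF free])
      fix x y assume "{x,y} \<notin> del_vertex_edges E v"
      then show "\<omega> x y = 0" using supp 0 by (auto simp: del_vertex_edges_def)
    next
      fix x assume x: "x \<in> V - {v}"
      have "(\<Sum>y\<in>V - {v}. \<omega> x y *\<^sub>R (p x - p y)) = (\<Sum>y\<in>V. \<omega> x y *\<^sub>R (p x - p y))"
        using fin(1) 0 by (intro sum.mono_neutral_left) auto
      then show "(\<Sum>y\<in>V - {v}. \<omega> x y *\<^sub>R (p x - p y)) = 0" using eq x by simp
    qed (use sym in auto)
  qed
  then show ?thesis using rows_independent_iff[OF s] by blast
qed

text \<open>The new vertex of degree 4 is placed at the midpoint of the removed edge \<open>{x,y}\<close>.\<close>

lemma rows_independent_one_extension: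
  assumes s: "simple_graph V E" and v: "v \<in> V" "card (nbr E v) = 4"
    and xy: "x \<in> nbr E v" "y \<in> nbr E v" "x \<noteq> y" "{x,y} \<notin> E"
    and F: "rows_independent (insert {x,y} (del_vertex_edges E v)) p0"
  shows "\<exists>p. rows_independent E p"
proof -
  note fin = simple_graph_finite[OF s]
  let ?F = "insert {x,y} (del_vertex_edges E v)" and ?W = "V - {v}" and ?N = "nbr E v"
  obtain p where p: "generic V p" using exists_generic[OF fin(1)] by blast
  have xyW: "x \<in> ?W" "y \<in> ?W" using xy fin(4,5)[of v] by auto
  have sF: "simple_graph ?W ?F" using simple_graph_del[OF s, of v] xyW xy(3) by (auto simp: simple_graph_def)
  have "rows_independent ?F p"
    using rows_independent_generic[OF sF F] generic_mono[OF p _ fin(1)] by blast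
  then have free: "stress_free ?W ?F (\<lambda>a b. p a - p b)"
    using rows_independent_iff[OF sF] by simp
  define m where "m = p x + (1/2) *\<^sub>R (p y - p x)"
  define q where "q = p(v := m)"
  have "stress_free V E (\<lambda>a b. q a - q b)"
    unfolding stress_free_def
  proof (intro allI impI, elim conjE)
    fix \<omega> :: "_ \<Rightarrow> _ \<Rightarrow> real" and a b
    assume sym: "\<forall>x y. \<omega> x y = \<omega> y x" and supp: "\<forall>x y. {x,y} \<notin> E \<longrightarrow> \<omega> x y = 0"
      and eq: "\<forall>x\<in>V. (\<Sum>y\<in>V. \<omega> x y *\<^sub>R (q x - q y)) = 0"
    have vv: "\<omega> v v = 0" using supp fin(4)[of v] by (auto simp: nbr_def)
    \<comment> \<open>Writing \<open>m - p w\<close> as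
      \<open>(1/2) *\<^sub>R (p y - p x) - (p w - p x)\<close> turns equilibrium at \<open>v\<close>
      into a relation between the three vectors \<open>p w - p x\<close> with
      \<open>w \<noteq> x\<close>. Its coefficients vanish: away from \<open>x\<close> and
      \<open>y\<close> this kills the stress, and at \<open>y\<close> it equates the stresses
      towards \<open>x\<close> and \<open>y\<close>.\<close>
    let ?c = "\<lambda>w. (if w = y then (\<Sum>w\<in>?N. \<omega> v w) / 2 else 0) - \<omega> v w"
    have "(\<Sum>w\<in>?N - {x}. ?c w *\<^sub>R (p w - p x)) =
        ((\<Sum>w\<in>?N. \<omega> v w) / 2) *\<^sub>R (p y - p x) - (\<Sum>w\<in>?N - {x}. \<omega> v w *\<^sub>R (p w - p x))"
    proof -
      have "(\<Sum>w\<in>?N - {x}. (if w = y then (\<Sum>w\<in>?N. \<omega> v w) / 2 else 0) *\<^sub>R (p w - p x)) =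
          (\<Sum>w\<in>?N - {x}. if w = y then ((\<Sum>w\<in>?N. \<omega> v w) / 2) *\<^sub>R (p y - p x) else 0)"
        by (intro sum.cong) auto
      also have "\<dots> = ((\<Sum>w\<in>?N. \<omega> v w) / 2) *\<^sub>R (p y - p x)"
        using xy fin(3)[of v] by (simp add: sum.delta)
      finally show ?thesis by (simp only: scaleR_left_diff_distrib sum_subtractf)
    qed
    also have "(\<Sum>w\<in>?N - {x}. \<omega> v w *\<^sub>R (p w - p x)) = (\<Sum>w\<in>?N. \<omega> v w *\<^sub>R (p w - p x))"
      using fin(3)[of v] by (intro sum.mono_neutral_left) auto
    also have "((\<Sum>w\<in>?N. \<omega> v w) / 2) *\<^sub>R (p y - p x) = (\<Sum>w\<in>?N. \<omega> v w *\<^sub>R ((1/2) *\<^sub>R (p y - p x)))"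
      by (simp add: scaleR_sum_left[symmetric] sum_divide_distrib[symmetric])
    also have "\<dots> - (\<Sum>w\<in>?N. \<omega> v w *\<^sub>R (p w - p x)) = (\<Sum>w\<in>?N. \<omega> v w *\<^sub>R (m - p w))"
      unfolding sum_subtractf[symmetric] m_def by (intro sum.cong) (auto simp: algebra_simps)
    also have "\<dots> = (\<Sum>w\<in>?N. \<omega> v w *\<^sub>R (q v - q w))"
      using fin(4)[of v] by (intro sum.cong) (auto simp: q_def)
    also have "\<dots> = (\<Sum>w\<in>V. \<omega> v w *\<^sub>R (q v - q w))"
      using fin(1) fin(5)[of v] supp by (intro sum.mono_neutral_left) (auto simp: nbr_def)
    finally have "(\<Sum>w\<in>?N - {x}. ?c w *\<^sub>R (p w - p x)) = 0" using eq v(1) by simp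
    moreover have "card (?N - {x}) \<le> 3" using v(2) xy(1) by simp
    moreover have "?N - {x} \<subseteq> V - {x}" "x \<in> V" using fin(5)[of v] xyW by auto
    ultimately have c0: "?c w = 0" if "w \<in> ?N - {x}" for w
      using generic_affinely_independent[OF fin(1) p, of x "?N - {x}" ?c w] that by blast
    have rest: "\<omega> v w = 0" if "w \<noteq> x" "w \<noteq> y" for w
      using c0[of w] that supp by (cases "w \<in> ?N") (auto simp: nbr_def)
    have "(\<Sum>w\<in>?N. \<omega> v w) = (\<Sum>w\<in>{x,y}. \<omega> v w)"
      using xy fin(3)[of v] rest by (intro sum.mono_neutral_right) auto
    then have xx: "\<omega> v y = \<omega> v x" using c0[of y] xy by simp
    \<comment> \<open>Since \<open>m\<close> is the midpoint, equal stresses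
      \<open>\<omega> v x\<close> on both halves act at \<open>x\<close> and \<open>y\<close> like
      half that stress on the whole edge \<open>{x,y}\<close>.\<close>
    let ?t = "\<omega> v x / 2"
    define \<mu> where "\<mu> = (\<lambda>a b. if a = v \<or> b = v then 0 else \<omega> a b + (if {a,b} = {x,y} then ?t else 0))"
    have mu: "\<mu> a b = 0" for a b
    proof (rule stress_freeD[OF free])
      show "\<mu> a b = \<mu> b a" for a b using sym by (simp add: \<mu>_def insert_commute)
      show "\<mu> a b = 0" if "{a,b} \<notin> ?F" for a b
        using that supp by (auto simp: \<mu>_def del_vertex_edges_def)
      fix a assume a: "a \<in> ?W"
      have "(\<Sum>b\<in>V. \<omega> a b *\<^sub>R (q a - q b)) = \<omega> a v *\<^sub>R (p a - m) + (\<Sum>b\<in>?W. \<omega> a b *\<^sub>R (p a - p b))"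
      proof -
        have "(\<Sum>b\<in>V. \<omega> a b *\<^sub>R (q a - q b)) = \<omega> a v *\<^sub>R (q a - q v) + (\<Sum>b\<in>?W. \<omega> a b *\<^sub>R (q a - q b))"
          using fin(1) v(1) by (simp add: sum.remove)
        also have "(\<Sum>b\<in>?W. \<omega> a b *\<^sub>R (q a - q b)) = (\<Sum>b\<in>?W. \<omega> a b *\<^sub>R (p a - p b))"
          using a by (intro sum.cong) (auto simp: q_def)
        finally show ?thesis using a by (simp add: q_def)
      qed
      then have e: "(\<Sum>b\<in>?W. \<omega> a b *\<^sub>R (p a - p b)) = - (\<omega> a v *\<^sub>R (p a - m))"
        using eq a by (simp add: eq_neg_iff_add_eq_0 add.commute)
      have "(\<Sum>b\<in>?W. \<mu> a b *\<^sub>R (p a - p b)) =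
          (\<Sum>b\<in>?W. \<omega> a b *\<^sub>R (p a - p b)) + (\<Sum>b\<in>?W. (if {a,b} = {x,y} then ?t else 0) *\<^sub>R (p a - p b))"
        unfolding sum.distrib[symmetric] using a by (intro sum.cong) (auto simp: \<mu>_def algebra_simps)
      also have "(\<Sum>b\<in>?W. (if {a,b} = {x,y} then ?t else 0) *\<^sub>R (p a - p b)) = \<omega> a v *\<^sub>R (p a - m)"
      proof -
        consider "a = x" | "a = y" | "a \<noteq> x" "a \<noteq> y" by blast
        then show ?thesis
        proof cases
          case 1
          have "(\<Sum>b\<in>?W. (if {a,b} = {x,y} then ?t else 0) *\<^sub>R (p a - p b)) = (\<Sum>b\<in>?W. if b = y then ?t *\<^sub>R (p x - p y) else 0)"
            using 1 xy(3) by (intro sum.cong) (auto simp: doubleton_eq_iff)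
          also have "\<dots> = ?t *\<^sub>R (p x - p y)" using xyW fin(1) by (simp add: sum.delta)
          finally show ?thesis using 1 sym by (simp add: m_def algebra_simps)
        next
          case 2
          have "(\<Sum>b\<in>?W. (if {a,b} = {x,y} then ?t else 0) *\<^sub>R (p a - p b)) = (\<Sum>b\<in>?W. if b = x then ?t *\<^sub>R (p y - p x) else 0)"
            using 2 xy(3) by (intro sum.cong) (auto simp: doubleton_eq_iff)
          also have "\<dots> = ?t *\<^sub>R (p y - p x)" using xyW fin(1) by (simp add: sum.delta)
          also have "\<dots> = \<omega> v x *\<^sub>R (p y - m)"
          proof -
            have "p y - m = (1/2) *\<^sub>R (p y - p x)" unfolding m_def by (simp add: vec_eq_iff field_simps)
            then show ?thesis by simp
          qed
          finally show ?thesis using 2 sym xx by simp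
        next
          case 3
          then have "{a,b} \<noteq> {x,y}" for b by (auto simp: doubleton_eq_iff)
          then show ?thesis using rest[of a] 3 sym by simp
        qed
      qed
      finally show "(\<Sum>b\<in>?W. \<mu> a b *\<^sub>R (p a - p b)) = 0" using e by simp
    qed
    \<comment> \<open>\<open>{x,y}\<close> is not in \<open>E\<close>, so the transferred stress is
      all that \<open>\<mu>\<close> carries there.\<close>
    have "\<mu> x y = ?t" using xyW supp xy(4) by (simp add: \<mu>_def)
    then have "\<omega> v x = 0" using mu[of x y] by simp
    then have 0: "\<omega> v w = 0" for w using rest xx by metis
    show "\<omega> a b = 0"
      using mu[of a b] 0 sym \<open>\<omega> v x = 0\<close> by (cases "a = v \<or> b = v") (auto simp: \<mu>_def split: if_splits)
  qed
  then show ?thesis using rows_independent_iff[OF s] by blast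
qed

text \<open>Vertex splitting: let \<open>v\<close> approach \<open>u\<close> along a generic line and rescale the row of \<open>{u,v}\<close>.
  A stress of the limit configuration induces a stress of the contracted graph.\<close>

lemma rows_independent_vertex_split:
  assumes s: "simple_graph V E" and uv: "{u,v} \<in> E" and t: "card (nbr E u \<inter> nbr E v) \<le> 2"
    and F: "rows_independent (contract E u v) p0"
  shows "\<exists>p. rows_independent E p"
proof -
  note fin = simple_graph_finite[OF s]
  have ne: "u \<noteq> v" "u \<in> V" "v \<in> V" using simple_graph_edge[OF s uv] by auto
  let ?F = "contract E u v" and ?W = "V - {v}" and ?A = "nbr E u \<inter> nbr E v"
  obtain p where p: "generic V p" using exists_generic[OF fin(1)] by blast
  have sF: "simple_graph ?W ?F" using simple_graph_contract[OF s uv] .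
  have "rows_independent ?F p"
    using rows_independent_generic[OF sF F] generic_mono[OF p _ fin(1)] by blast
  then have free: "stress_free ?W ?F (\<lambda>a b. p a - p b)"
    using rows_independent_iff[OF sF] by simp
  \<comment> \<open>\<open>q\<close> places \<open>v\<close> on the line through \<open>p u\<close>
    and \<open>p v\<close>, at \<open>p u\<close> for parameter 0. \<open>D\<close> uses the row of
    \<open>{u,v}\<close> divided by the parameter, so at 0 it still has the direction
    \<open>p u - p v\<close>.\<close>
  define q where "q = (\<lambda>\<epsilon>::real. p(v := p u + \<epsilon> *\<^sub>R (p v - p u)))"
  define D where "D = (\<lambda>\<epsilon> a b. if {a,b} = {u,v} then p a - p b else q \<epsilon> a - q \<epsilon> b)"
  have "stress_free V E (D 0)"
    unfolding stress_free_def
  proof (intro allI impI, elim conjE)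
    fix \<omega> :: "_ \<Rightarrow> _ \<Rightarrow> real" and a b
    assume sym: "\<forall>x y. \<omega> x y = \<omega> y x" and supp: "\<forall>x y. {x,y} \<notin> E \<longrightarrow> \<omega> x y = 0"
      and eq: "\<forall>x\<in>V. (\<Sum>y\<in>V. \<omega> x y *\<^sub>R D 0 x y) = 0"
    have loop: "\<omega> x x = 0" for x using supp fin(4)[of x] by (auto simp: nbr_def)
    let ?U = "V - {u,v}"
    have W: "?W = insert u ?U" using ne by auto
    have sV: "(\<Sum>y\<in>V. f y) = f u + (f v + (\<Sum>y\<in>?U. f y))" for f :: "_ \<Rightarrow> real^3"
    proof -
      have 1: "V - {u} - {v} = ?U" by auto
      have 2: "sum f V = f u + sum f (V - {u})" using ne fin(1) by (intro sum.remove) auto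
      have 3: "sum f (V - {u}) = f v + sum f (V - {u} - {v})" using ne fin(1) by (intro sum.remove) auto
      show ?thesis unfolding 2 3 1 ..
    qed
    have sW: "(\<Sum>y\<in>?W. f y) = f u + (\<Sum>y\<in>?U. f y)" for f :: "_ \<Rightarrow> real^3"
      by (subst W, subst sum.insert) (use fin(1) in auto)
    have Du: "D 0 u y = p u - p y" "D 0 v y = p u - p y" "D 0 y u = p y - p u" "D 0 y v = p y - p u" if "y \<in> ?U" for y
      using that ne by (auto simp: D_def q_def doubleton_eq_iff)
    have DU: "D 0 x y = p x - p y" if "x \<in> ?U" "y \<in> ?U" for x y
      using that by (auto simp: D_def q_def doubleton_eq_iff)
    have Duv: "D 0 u v = p u - p v" "D 0 v u = p v - p u"
      by (auto simp: D_def insert_commute)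
    have eu: "\<omega> u v *\<^sub>R (p u - p v) + (\<Sum>y\<in>?U. \<omega> u y *\<^sub>R (p u - p y)) = 0"
    proof -
      have "(\<Sum>y\<in>?U. \<omega> u y *\<^sub>R D 0 u y) = (\<Sum>y\<in>?U. \<omega> u y *\<^sub>R (p u - p y))"
        by (intro sum.cong refl) (simp only: Du)
      then show ?thesis using bspec[OF eq ne(2)] by (simp add: sV loop Duv)
    qed
    have ev: "\<omega> u v *\<^sub>R (p v - p u) + (\<Sum>y\<in>?U. \<omega> v y *\<^sub>R (p u - p y)) = 0"
    proof -
      have "(\<Sum>y\<in>?U. \<omega> v y *\<^sub>R D 0 v y) = (\<Sum>y\<in>?U. \<omega> v y *\<^sub>R (p u - p y))"
        by (intro sum.cong refl) (simp only: Du)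
      then show ?thesis using bspec[OF eq ne(3)] sym[rule_format, of v u] by (simp add: sV loop Duv)
    qed
    \<comment> \<open>With \<open>u\<close> and \<open>v\<close> at the same point, stresses on
      edges identified by the contraction add up, and the two forces along \<open>{u,v}\<close>
      cancel in the sum.\<close>
    define \<mu> where "\<mu> = (\<lambda>a b. if a = b \<or> a = v \<or> b = v then 0
       else if a = u then \<omega> u b + \<omega> v b else if b = u then \<omega> u a + \<omega> v a else \<omega> a b)"
    have mu: "\<mu> a b = 0" for a b
    proof (rule stress_freeD[OF free])
      show "\<mu> a b = \<mu> b a" for a b using sym by (simp add: \<mu>_def)
      show "\<mu> a b = 0" if nF: "{a,b} \<notin> ?F" for a b
      proof (cases "a = b \<or> a = v \<or> b = v")
        case False
        have E: "{a,b} \<notin> E" using nF False by (auto simp: contract_def del_vertex_edges_def)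
        have b: "a = u \<Longrightarrow> {v,b} \<notin> E" and a: "b = u \<Longrightarrow> {v,a} \<notin> E"
          using nF False by (auto simp: contract_def nbr_def insert_commute)
        then show ?thesis using E supp by (auto simp: \<mu>_def insert_commute)
      qed (simp add: \<mu>_def)
      fix x assume x: "x \<in> ?W"
      show "(\<Sum>y\<in>?W. \<mu> x y *\<^sub>R (p x - p y)) = 0"
      proof (cases "x = u")
        case True
        have "(\<Sum>y\<in>?U. \<mu> u y *\<^sub>R (p u - p y)) = (\<Sum>y\<in>?U. \<omega> u y *\<^sub>R (p u - p y)) + (\<Sum>y\<in>?U. \<omega> v y *\<^sub>R (p u - p y))"
          unfolding sum.distrib[symmetric] using ne by (intro sum.cong) (auto simp: \<mu>_def algebra_simps)
        also have "\<dots> = - (\<omega> u v *\<^sub>R (p u - p v)) - \<omega> u v *\<^sub>R (p v - p u)"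
          using eu ev by (simp add: add_eq_0_iff)
        also have "\<dots> = 0" by (simp add: algebra_simps)
        finally show ?thesis using True by (simp add: sW)
      next
        case False
        then have xU: "x \<in> ?U" using x by simp
        have "(\<Sum>y\<in>?U. \<mu> x y *\<^sub>R (p x - p y)) = (\<Sum>y\<in>?U. \<omega> x y *\<^sub>R D 0 x y)"
          using xU loop by (intro sum.cong) (auto simp: \<mu>_def DU)
        moreover have "\<omega> x u *\<^sub>R (p x - p u) + (\<omega> x v *\<^sub>R (p x - p u) + (\<Sum>y\<in>?U. \<omega> x y *\<^sub>R D 0 x y)) = 0"
          using bspec[OF eq, of x] x by (simp add: sV Du(3,4)[OF xU])
        moreover have "\<mu> x u = \<omega> x u + \<omega> x v" using xU ne sym by (simp add: \<mu>_def)
        ultimately show ?thesis by (simp add: sW algebra_simps)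
      qed
    qed
    \<comment> \<open>As the sum vanishes, a stress at \<open>v\<close> can survive only towards
      \<open>u\<close> and common neighbours. The directions involved are at most three generic
      vectors; this is where the bound of two triangles enters.\<close>
    have sum0: "\<omega> u b + \<omega> v b = 0" if "b \<noteq> u" "b \<noteq> v" for b
      using mu[of u b] that ne by (simp add: \<mu>_def)
    have vb: "\<omega> v b = 0" if "b \<noteq> u" "b \<noteq> v" "b \<notin> ?A" for b
    proof (cases "b \<in> nbr E v")
      case True
      then have "\<omega> u b = 0" using that supp by (simp add: nbr_def)
      then show ?thesis using sum0[OF that(1,2)] by simp
    next
      case False
      then show ?thesis using supp by (simp add: nbr_def)
    qed
    have A: "?A \<subseteq> ?U" "v \<notin> ?A" using fin(4)[of u] fin(4)[of v] fin(5)[of u] by auto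
    have finA: "finite ?A" using fin(3)[of u] by simp
    let ?c = "\<lambda>w. if w = v then \<omega> u v else - \<omega> v w"
    have "(\<Sum>y\<in>?U. \<omega> v y *\<^sub>R (p u - p y)) = (\<Sum>y\<in>?A. \<omega> v y *\<^sub>R (p u - p y))"
      using fin(1) A(1) vb by (intro sum.mono_neutral_right) auto
    also have "\<dots> = (\<Sum>y\<in>?A. ?c y *\<^sub>R (p y - p u))"
      using A(2) by (intro sum.cong) (auto simp: algebra_simps)
    finally have "(\<Sum>y\<in>insert v ?A. ?c y *\<^sub>R (p y - p u)) = 0"
      using ev finA A(2) by simp
    moreover have "card (insert v ?A) \<le> 3" using t finA by (simp add: card_insert_if)
    moreover have "insert v ?A \<subseteq> V - {u}" using A(1) ne by auto
    ultimately have c0: "?c w = 0" if "w \<in> insert v ?A" for w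
      using generic_affinely_independent[OF fin(1) p ne(2), of "insert v ?A" ?c w] that by blast
    have uv0: "\<omega> u v = 0" using c0[of v] by simp
    have v0: "\<omega> v b = 0" for b
    proof -
      consider "b = u" | "b = v" | "b \<in> ?A" | "b \<noteq> u" "b \<noteq> v" "b \<notin> ?A" by blast
      then show ?thesis
      proof cases
        case 1 then show ?thesis using uv0 sym[rule_format, of u v] by simp
      next
        case 2 then show ?thesis using loop by simp
      next
        case 3
        then have "b \<noteq> v" using A(2) by blast
        then show ?thesis using c0[of b] 3 by simp
      next
        case 4 then show ?thesis using vb by blast
      qed
    qed
    have u0: "\<omega> u b = 0" for b
      using uv0 loop sum0[of b] v0[of b] by (cases "b = u \<or> b = v") auto
    have uv00: "\<omega> b v = 0" "\<omega> b u = 0" for b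
      using u0[of b] v0[of b] sym[rule_format, of b v] sym[rule_format, of b u] by simp_all
    consider "a = b" | "a = u \<or> a = v" | "b = u \<or> b = v" | "a \<noteq> b" "a \<noteq> u" "a \<noteq> v" "b \<noteq> u" "b \<noteq> v" by blast
    then show "\<omega> a b = 0"
      by cases (use loop u0 v0 uv00 mu[of a b] in \<open>auto simp: \<mu>_def\<close>)
  qed
  then have L0: "lin_indep E UNIV (edge_row (D 0))" using lin_indep_edge_row_iff[OF s] by blast
  \<comment> \<open>The ring is that of continuous functions of the parameter, so independence at 0
    persists nearby.\<close>
  have "\<exists>f\<in>{f :: real \<Rightarrow> real. continuous_on UNIV f}. f 0 \<noteq> 0 \<and> (\<forall>\<epsilon>. f \<epsilon> \<noteq> 0 \<longrightarrow> lin_indep E UNIV (edge_row (D \<epsilon>)))"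
  proof (rule lin_indep_witness[where r = "\<lambda>\<epsilon>. edge_row (D \<epsilon>)"])
    show "(\<lambda>\<epsilon>. edge_row (D \<epsilon>) e c) \<in> {f. continuous_on UNIV f}" if "e \<in> E" "c \<in> UNIV" for e c
    proof (cases c)
      case (Pair w k)
      have cq: "continuous_on UNIV (\<lambda>\<epsilon>. q \<epsilon> a)" for a
        by (cases "a = v") (auto simp: q_def intro!: continuous_intros)
      have "continuous_on UNIV (\<lambda>\<epsilon>. D \<epsilon> a b)" for a b
        by (cases "{a,b} = {u,v}") (simp_all add: D_def cq continuous_on_diff)
      then have "continuous_on UNIV (\<lambda>\<epsilon>. D \<epsilon> a b $ k)" for a b
        by (rule continuous_on_component)
      then show ?thesis by (cases "w \<in> e") (simp_all add: Pair edge_row_def)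
    qed
  qed (use fin L0 in \<open>auto intro: continuous_intros\<close>)
  then obtain f where f: "continuous_on UNIV f" "f (0::real) \<noteq> (0::real)"
    "\<And>\<epsilon>. f \<epsilon> \<noteq> 0 \<Longrightarrow> lin_indep E UNIV (edge_row (D \<epsilon>))" by blast
  have "open {\<epsilon>. f \<epsilon> \<noteq> 0}" using f(1) by (intro open_Collect_neq) auto
  then obtain d where d: "d > 0" "ball 0 d \<subseteq> {\<epsilon>. f \<epsilon> \<noteq> 0}" using f(2) by (auto simp: open_contains_ball)
  define \<epsilon> where "\<epsilon> = d / 2"
  have eps: "\<epsilon> > 0" "f \<epsilon> \<noteq> 0" using d by (auto simp: \<epsilon>_def subset_iff dist_norm)
  have free': "stress_free V E (D \<epsilon>)" using f(3)[OF eps(2)] lin_indep_edge_row_iff[OF s] by blast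
  have "stress_free V E (\<lambda>a b. q \<epsilon> a - q \<epsilon> b)"
    unfolding stress_free_def
  proof (intro allI impI, elim conjE)
    fix \<omega> :: "_ \<Rightarrow> _ \<Rightarrow> real" and a b
    assume sym: "\<forall>x y. \<omega> x y = \<omega> y x" and supp: "\<forall>x y. {x,y} \<notin> E \<longrightarrow> \<omega> x y = 0"
      and eq: "\<forall>x\<in>V. (\<Sum>y\<in>V. \<omega> x y *\<^sub>R (q \<epsilon> x - q \<epsilon> y)) = 0"
    \<comment> \<open>For a positive parameter the rescaling of the row of \<open>{u,v}\<close> can
      be undone, so the true placement is stress free too.\<close>
    define \<mu> where "\<mu> = (\<lambda>a b. if {a,b} = {u,v} then \<epsilon> * \<omega> a b else \<omega> a b)"
    have m: "\<mu> x y *\<^sub>R D \<epsilon> x y = \<omega> x y *\<^sub>R (q \<epsilon> x - q \<epsilon> y)" for x y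
    proof (cases "{x,y} = {u,v}")
      case True
      then have "q \<epsilon> x - q \<epsilon> y = \<epsilon> *\<^sub>R (p x - p y)"
        using ne by (auto simp: q_def doubleton_eq_iff algebra_simps)
      then show ?thesis using True by (simp add: \<mu>_def D_def)
    next
      case False
      then show ?thesis by (simp add: \<mu>_def D_def)
    qed
    have "\<mu> a b = 0"
      by (rule stress_freeD[OF free']) (use sym supp eq in \<open>auto simp: m\<close>, auto simp: \<mu>_def insert_commute)
    then show "\<omega> a b = 0" using eps(1) by (simp add: \<mu>_def split: if_splits)
  qed
  then show ?thesis using rows_independent_iff[OF s] by blast
qed

section \<open>Necessity of sparsity\<close>

lemma sum_antisymmetric:
  fixes g :: "'a \<Rightarrow> 'a \<Rightarrow> real"
  assumes "\<And>x y. g x y = - g y x"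
  shows "(\<Sum>x\<in>X. \<Sum>y\<in>X. g x y) = 0"
proof -
  have "(\<Sum>x\<in>X. \<Sum>y\<in>X. g x y) = (\<Sum>y\<in>X. \<Sum>x\<in>X. g x y)" by (rule sum.swap)
  also have "\<dots> = (\<Sum>y\<in>X. \<Sum>x\<in>X. - g y x)" by (intro sum.cong refl assms)
  also have "\<dots> = - (\<Sum>x\<in>X. \<Sum>y\<in>X. g x y)" by (simp add: sum_negf)
  finally show ?thesis by simp
qed

text \<open>Resultant force and torque of any combination of edge rows vanish, so six coordinates at three
  vertices in general position are determined by the others.\<close>

lemma rows_independent_card_le:
  assumes s: "simple_graph X H" and p: "generic X p" and X: "3 \<le> card X" and ind: "rows_independent H p"
  shows "card H + 6 \<le> 3 * card X"
proof -
  note fin = simple_graph_finite[OF s]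
  obtain T where T: "T \<subseteq> X" "card T = 3" using obtain_subset_with_card_n[OF X] by metis
  then obtain x1 x2 x3 where "T = {x1,x2,x3}" and d: "x1 \<noteq> x2" "x1 \<noteq> x3" "x2 \<noteq> x3"
    by (auto simp: card_3_iff)
  then have x: "x1 \<in> X" "x2 \<in> X" "x3 \<in> X" using T(1) by auto
  \<comment> \<open>Three coordinates are dropped at \<open>x1\<close>, two at \<open>x2\<close> and
    one at \<open>x3\<close>: the usual pinning against rigid motions.\<close>
  define K where "K = X \<times> (UNIV :: 3 set) - {(x1,1),(x1,2),(x1,3),(x2,2),(x2,3),(x3,3)}"
  define q2 q3 where "q2 = p x2 - p x1" and "q3 = p x3 - p x1"
  have pv: "poly_fun (X \<times> UNIV) (\<lambda>y. y (x,k) - y (x1,k))" if "x \<in> X" for x and k :: 3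
    using that x fin(1) by (intro poly_fun_diff poly_fun_var) auto
  have nz1: "q2 $ 1 \<noteq> 0"
  proof -
    let ?f = "\<lambda>y :: 'a \<times> 3 \<Rightarrow> real. y (x2,1) - y (x1,1)"
    have "?f (\<lambda>c. if c = (x2,1) then 1 else 0) \<noteq> 0" using d by simp
    from generic_poly_fun_nonzero[OF p pv[OF x(2)] this] show ?thesis by (simp add: q2_def)
  qed
  \<comment> \<open>The sample point puts \<open>x1\<close> at the origin and \<open>x2\<close>,
    \<open>x3\<close> at the first two unit vectors.\<close>
  have nz2: "q2 $ 1 * q3 $ 2 - q2 $ 2 * q3 $ 1 \<noteq> 0"
  proof -
    let ?f = "\<lambda>y :: 'a \<times> 3 \<Rightarrow> real. (y (x2,1) - y (x1,1)) * (y (x3,2) - y (x1,2)) - (y (x2,2) - y (x1,2)) * (y (x3,1) - y (x1,1))"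
    have 1: "?f (\<lambda>c. if c = (x2,1) \<or> c = (x3,2) then 1 else 0) \<noteq> 0" using d by simp
    have 2: "poly_fun (X \<times> UNIV) ?f"
      by (rule poly_fun_diff[OF poly_fun_mult[OF pv[OF x(2)] pv[OF x(3)]] poly_fun_mult[OF pv[OF x(2)] pv[OF x(3)]]])
    show ?thesis
      using generic_poly_fun_nonzero[of X p ?f "\<lambda>c. if c = (x2,1) \<or> c = (x3,2) then 1 else 0", OF p 2 1]
      by (simp add: q2_def q3_def)
  qed
  have L: "lin_indep H UNIV (edge_row (\<lambda>x y. p x - p y))" using ind by (simp add: rows_independent_eq)
  have "lin_indep H K (edge_row (\<lambda>x y. p x - p y))"
    unfolding lin_indep_def
  proof (intro allI impI)
    fix lam assume z: "\<forall>c\<in>K. (\<Sum>e\<in>H. lam e * edge_row (\<lambda>x y. p x - p y) e c) = 0"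
    define \<omega> where "\<omega> = (\<lambda>x y. if {x,y} \<in> H then lam {x,y} else 0)"
    define F where "F = (\<lambda>x. \<Sum>y\<in>X. \<omega> x y *\<^sub>R (p x - p y))"
    have sym: "\<omega> x y = \<omega> y x" for x y by (simp add: \<omega>_def insert_commute)
    have Fc: "F x $ k = (\<Sum>y\<in>X. \<omega> x y * (p x $ k - p y $ k))" for x k by (simp add: F_def)
    have row: "(\<Sum>e\<in>H. lam e * edge_row (\<lambda>x y. p x - p y) e (w,k)) = F w $ k" for w k
      unfolding F_def by (rule sum_edge_row[OF s]) (simp add: \<omega>_def)
    have K0: "F w $ k = 0" if "(w,k) \<in> K" for w k using bspec[OF z that] row[of w k] by simp
    have F0: "F w = 0" if "w \<in> X - {x1,x2,x3}" for w
      using that K0[of w] by (auto simp: vec_eq_iff K_def)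
    have c: "F x2 $ 1 = 0" "F x3 $ 1 = 0" "F x3 $ 2 = 0"
      using K0[of x2 1] K0[of x3 1] K0[of x3 2] x d by (auto simp: K_def)
    have three: "(\<Sum>w\<in>X. f w) = f x1 + f x2 + f x3" if "\<And>w. w \<in> X - {x1,x2,x3} \<Longrightarrow> f w = 0" for f :: "'a \<Rightarrow> real"
    proof -
      have "(\<Sum>w\<in>X. f w) = (\<Sum>w\<in>{x1,x2,x3}. f w)"
        using that x fin(1) by (intro sum.mono_neutral_right) auto
      then show ?thesis using d by simp
    qed
    have force: "F x1 $ k + F x2 $ k + F x3 $ k = 0" for k
    proof -
      have "(\<Sum>w\<in>X. F w $ k) = 0"
        unfolding Fc by (rule sum_antisymmetric) (use sym in \<open>simp add: algebra_simps\<close>)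
      then show ?thesis using three[of "\<lambda>w. F w $ k"] F0 by simp
    qed
    \<comment> \<open>Torque about \<open>x1\<close>: force balance eliminates the force at
      \<open>x1\<close>, so only \<open>x2\<close> and \<open>x3\<close> contribute.\<close>
    have torque: "q2 $ i * F x2 $ j - q2 $ j * F x2 $ i + (q3 $ i * F x3 $ j - q3 $ j * F x3 $ i) = 0" for i j
    proof -
      have "(\<Sum>w\<in>X. p w $ i * F w $ j - p w $ j * F w $ i) =
          (\<Sum>w\<in>X. \<Sum>y\<in>X. \<omega> w y * (p w $ j * p y $ i - p w $ i * p y $ j))"
        unfolding Fc sum_distrib_left sum_subtractf[symmetric]
        by (intro sum.cong refl) (simp add: algebra_simps)
      also have "\<dots> = 0" by (rule sum_antisymmetric) (use sym in \<open>simp add: algebra_simps\<close>)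
      finally have "(p x1 $ i * F x1 $ j - p x1 $ j * F x1 $ i) + (p x2 $ i * F x2 $ j - p x2 $ j * F x2 $ i)
          + (p x3 $ i * F x3 $ j - p x3 $ j * F x3 $ i) = 0"
        using three[of "\<lambda>w. p w $ i * F w $ j - p w $ j * F w $ i"] F0 by simp
      moreover have "F x1 $ j = - F x2 $ j - F x3 $ j" "F x1 $ i = - F x2 $ i - F x3 $ i"
        using force[of i] force[of j] by linarith+
      ultimately show ?thesis by (simp add: q2_def q3_def algebra_simps)
    qed
    \<comment> \<open>The plane 1, 2 leaves one unknown. The planes 1, 3 and 2, 3 then give a
      homogeneous 2 by 2 system for the third components, with the minor from \<open>nz2\<close> as
      determinant.\<close>
    have a: "F x2 $ 2 = 0" using torque[of 1 2] c nz1 by simp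
    have b1: "q2 $ 1 * F x2 $ 3 + q3 $ 1 * F x3 $ 3 = 0" and b2: "q2 $ 2 * F x2 $ 3 + q3 $ 2 * F x3 $ 3 = 0"
      using torque[of 1 3] torque[of 2 3] c a by simp_all
    have "(q2 $ 1 * q3 $ 2 - q2 $ 2 * q3 $ 1) * F x3 $ 3 =
        q2 $ 1 * (q2 $ 2 * F x2 $ 3 + q3 $ 2 * F x3 $ 3) - q2 $ 2 * (q2 $ 1 * F x2 $ 3 + q3 $ 1 * F x3 $ 3)"
      by (simp add: algebra_simps)
    then have e3: "F x3 $ 3 = 0" using b1 b2 nz2 by simp
    then have e2: "F x2 $ 3 = 0" using b1 nz1 by simp
    have f23: "F x2 = 0" "F x3 = 0" using a c e2 e3 by (auto simp: vec_eq_iff forall_3)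
    have f1: "F x1 = 0" using force f23 by (simp add: vec_eq_iff)
    have all0: "F w $ k = 0" for w k
    proof (cases "w \<in> X")
      case True
      then show ?thesis using F0[of w] f1 f23 by (cases "w \<in> {x1,x2,x3}") auto
    next
      case False
      then have "\<omega> w y = 0" for y using simple_graph_edge(2)[OF s, of w y] by (auto simp: \<omega>_def)
      then show ?thesis by (simp add: Fc)
    qed
    have "(\<Sum>e\<in>H. lam e * edge_row (\<lambda>x y. p x - p y) e c) = 0" for c
      using row[of "fst c" "snd c"] all0 by simp
    then show "\<forall>e\<in>H. lam e = 0" using L unfolding lin_indep_def by blast
  qed
  moreover have "finite K" using fin(1) by (simp add: K_def)
  ultimately have "card H \<le> card K" using lin_indep_card_le[OF fin(2)] by blast
  moreover have "card K = 3 * card X - 6"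
  proof -
    have "card {(x1,1::3),(x1,2),(x1,3),(x2,2),(x2,3),(x3,3)} = 6" using d by simp
    then show ?thesis
      using x fin(1) unfolding K_def by (subst card_Diff_subset) (auto simp: card_cartesian_product)
  qed
  ultimately show ?thesis using X by simp
qed

lemma R3_independent_imp_sparse36:
  assumes s: "simple_graph V E" and R: "R3_independent V E"
  shows "sparse36 V E"
  unfolding sparse36_def
proof (intro allI impI)
  fix X assume X: "X \<subseteq> V" "3 \<le> card X"
  note fin = simple_graph_finite[OF s]
  obtain p where p: "generic V p" using exists_generic[OF fin(1)] by blast
  then have "lin_indep E UNIV (edge_row (\<lambda>x y. p x - p y))"
    using R by (simp add: R3_independent_def rows_independent_eq)
  then have "rows_independent (induced E X) p"
    unfolding rows_independent_eq by (rule lin_indep_mono) (use fin in \<open>auto simp: induced_def\<close>)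
  then have "card (induced E X) + 6 \<le> 3 * card X"
    using rows_independent_card_le[OF simple_graph_induced[OF s X(1)] generic_mono[OF p X(1) fin(1)] X(2)] by blast
  then show "card {e \<in> E. e \<subseteq> X} \<le> 3 * card X - 6" by (simp add: induced_def)
qed

section \<open>Sufficiency of sparsity\<close>

lemma crit_apex_rows_independent:
  assumes "crit_apex V E" "sparse36 V E"
  shows "\<exists>p. rows_independent E p"
  using assms
proof (induction "card V" arbitrary: V E rule: less_induct)
  case less
  have s: "simple_graph V E" using less.prems by (simp add: crit_apex_def)
  note fin = simple_graph_finite[OF s]
  show ?case
  proof (cases "V = {}")
    case True
    then have "E = {}" using s by (auto simp: simple_graph_def)
    then have "rows_independent E undefined" by (simp add: rows_independent_def)
    then show ?thesis by blast
  next
    case False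
    have cV: "card (V - {v}) = card V - 1" "card (V - {v}) < card V" if "v \<in> V" for v
      using that fin(1) card_Diff1_less[of V v] by (simp_all add: card_Diff_singleton)
    from less.prems False show ?thesis
    proof (cases rule: crit_apex_reducible)
      case (low v)
      have "sparse36 (V - {v}) (del_vertex_edges E v)"
        unfolding sparse36_def
      proof (intro allI impI)
        fix X assume X: "X \<subseteq> V - {v}" "3 \<le> card X"
        then have "card (induced E X) + 6 \<le> 3 * card X" using sparse36_induced[OF less.prems(2), of X] by auto
        moreover have "{e \<in> del_vertex_edges E v. e \<subseteq> X} = induced E X"
          using X by (auto simp: del_vertex_edges_def induced_def)
        ultimately show "card {e \<in> del_vertex_edges E v. e \<subseteq> X} \<le> 3 * card X - 6" by simp
      qed
      then obtain p where "rows_independent (del_vertex_edges E v) p"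
        using less.hyps[OF cV(2)[OF low(1)] crit_apex_del[OF less.prems(1) low(1)]] by blast
      then show ?thesis using rows_independent_add_low_degree[OF s low] by blast
    next
      case (four v x y)
      let ?F = "insert {x,y} (del_vertex_edges E v)"
      have vx: "{x,v} \<in> E" using four(3) by (simp add: nbr_def insert_commute)
      \<comment> \<open>The new edge \<open>{x,y}\<close> arises when \<open>v\<close> is merged
        into \<open>x\<close>, so the reduced graph is a subgraph of a contraction and remains
        critically apex. It loses four edges and gains one, matching the drop of the bound by
        3.\<close>
      have "?F \<subseteq> contract E x v" using four by (auto simp: contract_def)
      then have cF: "crit_apex (V - {v}) ?F" using crit_apex_mono[OF crit_apex_contract[OF less.prems(1) vx]] by blast
      have n5: "5 \<le> card V" using degree_less_card[OF s four(1)] four(2) by simp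
      have "induced E V = E" using s by (auto simp: induced_def simple_graph_def)
      then have "card E + 6 \<le> 3 * card V" using sparse36_induced[OF less.prems(2), of V] n5 by simp
      moreover have "card E = card (del_vertex_edges E v) + 4"
        using card_del_vertex_edges[OF s, of v] four(2) by simp
      moreover have "card ?F \<le> Suc (card (del_vertex_edges E v))" by (rule card_insert_le_m1) auto
      ultimately have "card ?F + 6 \<le> 3 * card (V - {v})" using cV(1)[OF four(1)] n5 by linarith
      then obtain p where "rows_independent ?F p"
        using less.hyps[OF cV(2)[OF four(1)] cF] crit_apex_imp_sparse36[OF cF] by blast
      then show ?thesis using rows_independent_one_extension[OF s four] by blast
    next
      case (split u v)
      have v: "v \<in> V" using simple_graph_edge[OF s split(1)] by simp
      have cF: "crit_apex (V - {v}) (contract E u v)" using crit_apex_contract[OF less.prems(1) split(1)] .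
      then obtain p where "rows_independent (contract E u v) p"
        using less.hyps[OF cV(2)[OF v] cF] crit_apex_imp_sparse36[OF cF split(3)] by blast
      then show ?thesis using rows_independent_vertex_split[OF s split(1,2)] by blast
    qed
  qed
qed

theorem theorem5p6:
  fixes V :: "'a set" and E :: "'a set set"
  assumes "simple_graph V E"
    and "critically_apex V E"
  shows "R3_independent V E \<longleftrightarrow> sparse36 V E"
proof
  show "sparse36 V E" if "R3_independent V E"
    using R3_independent_imp_sparse36[OF assms(1) that] .
  have "crit_apex V E"
    using assms planar_imp_fat_planar unfolding crit_apex_def critically_apex_def by blast
  then show "R3_independent V E" if "sparse36 V E"
    using crit_apex_rows_independent that R3_independent_iff[OF assms(1)] by blast
qed

end
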